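(* Let $B$ be a (finitely generated) $R$-order with $C\subseteq B\subseteq C[t^{-1}]$. Then $B$ is rigid as a left $C$-module (i.e. $\mathrm{Ext}^1_C(B,B)=0$) if and only if $B$ is a necklace algebra.
   Context: Fix integers $0<k<n$ and let $[n]=\{1,\dots,n\}$, cyclically ordered and identified with $\mathbb Z/n$. Let $R=\mathbb C[[t]]$. $C=C(k,n)$ is the path $R$-algebra of the quiver with vertex set $\mathbb Z/n$ and arrows $x_i\colon i-1\to i$, $y_i\colon i\to i-1$ ($i\in\mathbb Z/n$), modulo the relations $xy=t=yx$ and $x^k=y^{n-k}$ starting at every vertex; $e_i$ is the idempotent at vertex $i$. One has $C[t^{-1}]\cong M_n(R[t^{-1}])$. An $R$-order here is a subalgebra that is finitely generated (hence free) as an $R$-module. For a $k$-subset $J\subset[n]$, the rank one $C$-module $M_J$ has $e_iM_J=R$ for all $i$, with $x_i$ acting by $1$ and $y_i$ by $t$ if $i\in J$, and $x_i$ acting by $t$ and $y_i$ by $1$ if $i\notin J$. A Grassmann necklace (of type $(k,n)$) is a sequence $\mathcal I=(I_1,\dots,I_n)$ of $k$-subsets of $[n]$ such that $I_i\setminus\{i\}\subseteq I_{i+1}$ for all $i\in\mathbb Z/n$. For any sequence $\mathcal I=(I_i)$ of $k$-subsets, $B_{\mathcal I}$ denotes the unique left $C$-module with $C\subseteq B_{\mathcal I}\subseteq C[t^{-1}]$ such that, for every vertex $\ell$, $e_\ell$ is an $R$-module generator of $e_\ell B_{\mathcal I}e_\ell$ and $B_{\mathcal I}e_\ell\cong M_{I_{\ell+1}}$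 as $C$-modules (when such a module exists). When $\mathcal I$ is a Grassmann necklace, $B_{\mathcal I}$ is a subalgebra of $C[t^{-1}]$ and is called a necklace algebra. *)

theory Defs
  imports
    "HOL-Algebra.QuotRing"
    "HOL-Algebra.Embedded_Algebras"
    "HOL-Algebra.Elementary_Groups"
    "HOL-Algebra.Module"
    "HOL-Computational_Algebra.Formal_Power_Series"
    "Graph_Theory.Arc_Walk"
    Complex_Main
begin

text \<open>A path of a quiver is a pair (start vertex, list of arrows in order of traversal).
  Multiplication in the path algebra is written as composition of maps: \<open>a b\<close> means first \<open>b\<close>,
  then \<open>a\<close>. Left modules are then (covariant) representations of the quiver, with \<open>x\<^sub>i\<close> mapping
  \<open>e\<^sub>i\<^sub>-\<^sub>1 M\<close> to \<open>e\<^sub>i M\<close>.\<close>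

type_synonym ('v, 'e) qpath = "'v \<times> 'e list"

definition path_end :: "('v, 'e) pre_digraph \<Rightarrow> ('v, 'e) qpath \<Rightarrow> 'v" where
  "path_end Q p = last (pre_digraph.awalk_verts Q (fst p) (snd p))"

definition qpaths :: "('v, 'e) pre_digraph \<Rightarrow> ('v, 'e) qpath set" where
  "qpaths Q = {p. pre_digraph.awalk Q (fst p) (snd p) (path_end Q p)}"

text \<open>Finitely supported functions on paths. In the product, the path \<open>(u, w)\<close> is cut after its
  first \<open>j\<close> arrows: the right factor sees the initial part, the left factor the final part.\<close>

definition path_algebra ::
    "('v, 'e) pre_digraph \<Rightarrow> (('v, 'e) qpath \<Rightarrow> 'r::comm_ring_1) ring" where
  "path_algebra Q =
    \<lparr>carrier = {f. finite {p. f p \<noteq> 0} \<and> {p. f p \<noteq> 0} \<subseteq> qpaths Q},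
     monoid.mult = (\<lambda>f g (u, w). \<Sum>j\<le>length w.
       f (path_end Q (u, take j w), drop j w) * g (u, take j w)),
     one = (\<lambda>(u, w). if u \<in> verts Q \<and> w = [] then 1 else 0),
     ring.zero = (\<lambda>_. 0),
     add = (\<lambda>f g p. f p + g p)\<rparr>"

definition path_elem :: "('v, 'e) qpath \<Rightarrow> ('v, 'e) qpath \<Rightarrow> 'r::comm_ring_1" where
  "path_elem p = (\<lambda>q. if q = p then 1 else 0)"


text \<open>The cyclic set \<open>\<int>/n\<close> is represented by \<open>{1..n}\<close>. The arrows are
  \<open>x\<^sub>i : i - 1 \<rightarrow> i\<close> and \<open>y\<^sub>i : i \<rightarrow> i - 1\<close>.\<close>

definition csucc :: "nat \<Rightarrow> nat \<Rightarrow> nat" where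
  "csucc n i = (if i = n then 1 else i + 1)"

definition cpred :: "nat \<Rightarrow> nat \<Rightarrow> nat" where
  "cpred n i = (if i = 1 then n else i - 1)"

datatype arrow = Xarr nat | Yarr nat

definition circle_quiver :: "nat \<Rightarrow> (nat, arrow) pre_digraph" where
  "circle_quiver n =
    \<lparr>verts = {1..n},
     arcs = Xarr ` {1..n} \<union> Yarr ` {1..n},
     tail = (\<lambda>a. case a of Xarr i \<Rightarrow> cpred n i | Yarr i \<Rightarrow> i),
     head = (\<lambda>a. case a of Xarr i \<Rightarrow> i | Yarr i \<Rightarrow> cpred n i)\<rparr>"

type_synonym path_fun = "(nat, arrow) qpath \<Rightarrow> complex fps"

abbreviation circle_path_algebra :: "nat \<Rightarrow> path_fun ring" where
  "circle_path_algebra n \<equiv> path_algebra (circle_quiver n)"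

definition xpow :: "nat \<Rightarrow> nat \<Rightarrow> nat \<Rightarrow> (nat, arrow) qpath" where
  "xpow n m i = (i, map (\<lambda>j. Xarr ((csucc n ^^ Suc j) i)) [0..<m])"

definition ypow :: "nat \<Rightarrow> nat \<Rightarrow> nat \<Rightarrow> (nat, arrow) qpath" where
  "ypow n m i = (i, map (\<lambda>j. Yarr ((cpred n ^^ j) i)) [0..<m])"

text \<open>The relators \<open>x y - t\<close>, \<open>y x - t\<close> and \<open>x\<^sup>k - y\<^sup>n\<^sup>-\<^sup>k\<close> at every vertex \<open>i\<close>.\<close>

definition circle_relators :: "nat \<Rightarrow> nat \<Rightarrow> path_fun set" where
  "circle_relators k n =
     {(\<lambda>p. path_elem (i, [Yarr i, Xarr i]) p - fps_X * path_elem (i, []) p) | i. i \<in> {1..n}}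
   \<union> {(\<lambda>p. path_elem (i, [Xarr (csucc n i), Yarr (csucc n i)]) p - fps_X * path_elem (i, []) p)
        | i. i \<in> {1..n}}
   \<union> {(\<lambda>p. path_elem (xpow n k i) p - path_elem (ypow n (n - k) i) p) | i. i \<in> {1..n}}"

definition circle_ideal :: "nat \<Rightarrow> nat \<Rightarrow> path_fun set" where
  "circle_ideal k n = genideal (circle_path_algebra n) (circle_relators k n)"

definition circle_algebra :: "nat \<Rightarrow> nat \<Rightarrow> path_fun set ring" where
  "circle_algebra k n = circle_path_algebra n Quot circle_ideal k n"

definition circle_class :: "nat \<Rightarrow> nat \<Rightarrow> path_fun \<Rightarrow> path_fun set" where
  "circle_class k n f = a_r_coset (circle_path_algebra n) (circle_ideal k n) f"

definition idem :: "nat \<Rightarrow> nat \<Rightarrow> nat \<Rightarrow> path_fun set" where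
  "idem k n i = circle_class k n (path_elem (i, []))"

text \<open>The structure map of \<open>C(k,n)\<close> as an algebra over \<open>R = \<complex>[[t]]\<close>.\<close>

definition scalar :: "nat \<Rightarrow> nat \<Rightarrow> complex fps \<Rightarrow> path_fun set" where
  "scalar k n r = circle_class k n (\<lambda>p. r * \<one>\<^bsub>circle_path_algebra n\<^esub> p)"


text \<open>\<open>\<iota> : C \<rightarrow> L\<close> exhibits \<open>L\<close> as the localization \<open>C[s\<^sup>-\<^sup>1]\<close> at a central element \<open>s\<close>; this
  determines \<open>(L, \<iota>)\<close> up to unique isomorphism.\<close>

definition is_central_localization ::
    "('c, 'x) ring_scheme \<Rightarrow> 'c \<Rightarrow> ('l, 'y) ring_scheme \<Rightarrow> ('c \<Rightarrow> 'l) \<Rightarrow> bool" where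
  "is_central_localization C s L \<iota> \<longleftrightarrow>
     ring C \<and> ring L \<and> \<iota> \<in> ring_hom C L \<and>
     s \<in> carrier C \<and> (\<forall>c\<in>carrier C. s \<otimes>\<^bsub>C\<^esub> c = c \<otimes>\<^bsub>C\<^esub> s) \<and>
     \<iota> s \<in> Units L \<and>
     (\<forall>l\<in>carrier L. \<exists>m::nat. \<exists>c\<in>carrier C. l \<otimes>\<^bsub>L\<^esub> \<iota> (s [^]\<^bsub>C\<^esub> m) = \<iota> c) \<and>
     (\<forall>c\<in>carrier C. \<iota> c = \<zero>\<^bsub>L\<^esub> \<longrightarrow> (\<exists>m::nat. s [^]\<^bsub>C\<^esub> m \<otimes>\<^bsub>C\<^esub> c = \<zero>\<^bsub>C\<^esub>))"


text \<open>Left modules over a not necessarily commutative ring \<open>A\<close> are given by the library's module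
  records, whose multiplicative fields are irrelevant. Homomorphisms are extensional functions, so
  that they form an honest abelian group.\<close>

definition lmod_hom ::
    "('a, 'x) ring_scheme \<Rightarrow> ('a, 'm, 'y) module_scheme \<Rightarrow> ('a, 'n, 'z) module_scheme
      \<Rightarrow> ('m \<Rightarrow> 'n) set" where
  "lmod_hom A M N = {f \<in> carrier M \<rightarrow>\<^sub>E carrier N.
     (\<forall>u\<in>carrier M. \<forall>v\<in>carrier M. f (u \<oplus>\<^bsub>M\<^esub> v) = f u \<oplus>\<^bsub>N\<^esub> f v) \<and>
     (\<forall>a\<in>carrier A. \<forall>u\<in>carrier M. f (a \<odot>\<^bsub>M\<^esub> u) = a \<odot>\<^bsub>N\<^esub> f u)}"

definition lmod_iso ::
    "('a, 'x) ring_scheme \<Rightarrow> ('a, 'm, 'y) module_scheme \<Rightarrow> ('a, 'n, 'z) module_scheme \<Rightarrow> bool" where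
  "lmod_iso A M N \<longleftrightarrow> (\<exists>f\<in>lmod_hom A M N. bij_betw f (carrier M) (carrier N))"

definition hom_group ::
    "('a, 'x) ring_scheme \<Rightarrow> ('a, 'm, 'y) module_scheme \<Rightarrow> ('a, 'n, 'z) module_scheme
      \<Rightarrow> ('m \<Rightarrow> 'n) monoid" where
  "hom_group A M N =
    \<lparr>carrier = lmod_hom A M N,
     monoid.mult = (\<lambda>f g. \<lambda>u\<in>carrier M. f u \<oplus>\<^bsub>N\<^esub> g u),
     one = (\<lambda>u\<in>carrier M. \<zero>\<^bsub>N\<^esub>)\<rparr>"

definition free_lmod :: "('a, 'x) ring_scheme \<Rightarrow> 'b set \<Rightarrow> ('a, 'b \<Rightarrow> 'a) module" where
  "free_lmod A S =
    \<lparr>carrier = {f. f ` S \<subseteq> carrier A \<and> {b. f b \<noteq> \<zero>\<^bsub>A\<^esub>} \<subseteq> S \<and> finite {b. f b \<noteq> \<zero>\<^bsub>A\<^esub>}},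
     monoid.mult = undefined, one = undefined,
     ring.zero = (\<lambda>_. \<zero>\<^bsub>A\<^esub>),
     add = (\<lambda>f g b. f b \<oplus>\<^bsub>A\<^esub> g b),
     smult = (\<lambda>a f b. a \<otimes>\<^bsub>A\<^esub> f b)\<rparr>"

definition lincomb :: "('a, 'x) ring_scheme \<Rightarrow> ('a, 'm, 'y) module_scheme \<Rightarrow> ('m \<Rightarrow> 'a) \<Rightarrow> 'm" where
  "lincomb A M f = (\<Oplus>\<^bsub>M\<^esub>b\<in>{b. f b \<noteq> \<zero>\<^bsub>A\<^esub>}. f b \<odot>\<^bsub>M\<^esub> b)"

text \<open>The start \<open>P\<^sub>2 \<rightarrow> P\<^sub>1 \<rightarrow> P\<^sub>0 \<rightarrow> M \<rightarrow> 0\<close> of the canonical free resolution of \<open>M\<close>: \<open>P\<^sub>0\<close> is free on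
  the set \<open>M\<close>, and \<open>P\<^sub>i\<^sub>+\<^sub>1\<close> is free on the set of elements of \<open>P\<^sub>i\<close> killed by the previous map; all
  maps are evaluation of formal linear combinations.\<close>

definition res0 :: "('a, 'x) ring_scheme \<Rightarrow> ('a, 'm, 'y) module_scheme \<Rightarrow> ('a, 'm \<Rightarrow> 'a) module" where
  "res0 A M = free_lmod A (carrier M)"

definition res1 ::
    "('a, 'x) ring_scheme \<Rightarrow> ('a, 'm, 'y) module_scheme \<Rightarrow> ('a, ('m \<Rightarrow> 'a) \<Rightarrow> 'a) module" where
  "res1 A M = free_lmod A {f \<in> carrier (res0 A M). lincomb A M f = \<zero>\<^bsub>M\<^esub>}"

definition res2 ::
    "('a, 'x) ring_scheme \<Rightarrow> ('a, 'm, 'y) module_scheme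
      \<Rightarrow> ('a, (('m \<Rightarrow> 'a) \<Rightarrow> 'a) \<Rightarrow> 'a) module" where
  "res2 A M =
     free_lmod A {f \<in> carrier (res1 A M). lincomb A (res0 A M) f = \<zero>\<^bsub>res0 A M\<^esub>}"

text \<open>\<open>Ext\<^sup>1\<^sub>A(M,N)\<close> is the first cohomology group of the complex \<open>Hom\<^sub>A(P\<^sub>\<bullet>, N)\<close>.\<close>

definition ext1_cocycles ::
    "('a, 'x) ring_scheme \<Rightarrow> ('a, 'm, 'y) module_scheme \<Rightarrow> ('a, 'n, 'z) module_scheme
      \<Rightarrow> ((('m \<Rightarrow> 'a) \<Rightarrow> 'a) \<Rightarrow> 'n) set" where
  "ext1_cocycles A M N =
     {f \<in> lmod_hom A (res1 A M) N.
        \<forall>u\<in>carrier (res2 A M). f (lincomb A (res1 A M) u) = \<zero>\<^bsub>N\<^esub>}"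

definition ext1_coboundaries ::
    "('a, 'x) ring_scheme \<Rightarrow> ('a, 'm, 'y) module_scheme \<Rightarrow> ('a, 'n, 'z) module_scheme
      \<Rightarrow> ((('m \<Rightarrow> 'a) \<Rightarrow> 'a) \<Rightarrow> 'n) set" where
  "ext1_coboundaries A M N =
     (\<lambda>g. \<lambda>u\<in>carrier (res1 A M). g (lincomb A (res0 A M) u)) ` lmod_hom A (res0 A M) N"

definition Ext1 ::
    "('a, 'x) ring_scheme \<Rightarrow> ('a, 'm, 'y) module_scheme \<Rightarrow> ('a, 'n, 'z) module_scheme
      \<Rightarrow> ((('m \<Rightarrow> 'a) \<Rightarrow> 'a) \<Rightarrow> 'n) set monoid" where
  "Ext1 A M N =
     (hom_group A (res1 A M) N)\<lparr>carrier := ext1_cocycles A M N\<rparr> Mod ext1_coboundaries A M N"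

definition rigid :: "('a, 'x) ring_scheme \<Rightarrow> ('a, 'm, 'y) module_scheme \<Rightarrow> bool" where
  "rigid A M \<longleftrightarrow> trivial_group (Ext1 A M M)"

text \<open>A subset of \<open>L\<close>, stable under addition and under left multiplication by the image of \<open>\<iota>\<close>,
  seen as a left module over the source of \<open>\<iota>\<close>.\<close>

definition sub_lmod :: "('l, 'y) ring_scheme \<Rightarrow> ('c \<Rightarrow> 'l) \<Rightarrow> 'l set \<Rightarrow> ('c, 'l) module" where
  "sub_lmod L \<iota> S =
    \<lparr>carrier = S, monoid.mult = monoid.mult L, one = one L, ring.zero = ring.zero L, add = add L,
     smult = (\<lambda>c l. \<iota> c \<otimes>\<^bsub>L\<^esub> l)\<rparr>"


text \<open>The rank one module \<open>M\<^sub>J\<close>: a vector \<open>v\<close> has component \<open>v i \<in> R\<close> at the vertex \<open>i\<close>. A path acts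
  by the product of the actions of its arrows, from the component at its start to the component
  at its end. A class in \<open>C(k,n)\<close> acts through any of its representatives.\<close>

definition arrow_act :: "nat set \<Rightarrow> arrow \<Rightarrow> complex fps \<Rightarrow> complex fps" where
  "arrow_act J a r = (case a of Xarr i \<Rightarrow> (if i \<in> J then r else fps_X * r)
                              | Yarr i \<Rightarrow> (if i \<in> J then fps_X * r else r))"

definition path_act ::
    "nat \<Rightarrow> nat set \<Rightarrow> (nat, arrow) qpath \<Rightarrow> (nat \<Rightarrow> complex fps) \<Rightarrow> nat \<Rightarrow> complex fps" where
  "path_act n J p v i =
     (if i = path_end (circle_quiver n) p then fold (arrow_act J) (snd p) (v (fst p)) else 0)"

definition path_fun_act ::
    "nat \<Rightarrow> nat set \<Rightarrow> path_fun \<Rightarrow> (nat \<Rightarrow> complex fps) \<Rightarrow> nat \<Rightarrow> complex fps" where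
  "path_fun_act n J f v = (\<lambda>i. \<Sum>p | f p \<noteq> 0. f p * path_act n J p v i)"

definition rank_one_module :: "nat \<Rightarrow> nat set \<Rightarrow> (path_fun set, nat \<Rightarrow> complex fps) module" where
  "rank_one_module n J =
    \<lparr>carrier = {v. \<forall>i. i \<notin> {1..n} \<longrightarrow> v i = 0},
     monoid.mult = undefined, one = undefined,
     ring.zero = (\<lambda>_. 0),
     add = (\<lambda>v w i. v i + w i),
     smult = (\<lambda>c v. the_elem ((\<lambda>f. path_fun_act n J f v) ` c))\<rparr>"


definition grassmann_necklace :: "nat \<Rightarrow> nat \<Rightarrow> (nat \<Rightarrow> nat set) \<Rightarrow> bool" where
  "grassmann_necklace k n I \<longleftrightarrow>
     (\<forall>i\<in>{1..n}. I i \<subseteq> {1..n} \<and> card (I i) = k \<and> I i - {i} \<subseteq> I (csucc n i))"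

text \<open>\<open>B = B\<^sub>I\<close>, for \<open>L = C[t\<^sup>-\<^sup>1]\<close> and \<open>\<iota>\<close> the inclusion of \<open>C\<close>.\<close>

definition is_necklace_module ::
    "nat \<Rightarrow> nat \<Rightarrow> ('l, 'y) ring_scheme \<Rightarrow> (path_fun set \<Rightarrow> 'l) \<Rightarrow> (nat \<Rightarrow> nat set) \<Rightarrow> 'l set \<Rightarrow> bool"
  where
  "is_necklace_module k n L \<iota> I B \<longleftrightarrow>
     additive_subgroup B L \<and>
     (\<forall>c\<in>carrier (circle_algebra k n). \<forall>b\<in>B. \<iota> c \<otimes>\<^bsub>L\<^esub> b \<in> B) \<and>
     \<iota> ` carrier (circle_algebra k n) \<subseteq> B \<and>
     (\<forall>l\<in>{1..n}. let e = \<iota> (idem k n l) in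
        {e \<otimes>\<^bsub>L\<^esub> b \<otimes>\<^bsub>L\<^esub> e | b. b \<in> B} = {\<iota> (scalar k n r) \<otimes>\<^bsub>L\<^esub> e | r. True} \<and>
        lmod_iso (circle_algebra k n)
          (sub_lmod L \<iota> {b \<otimes>\<^bsub>L\<^esub> e | b. b \<in> B}) (rank_one_module n (I (csucc n l))))"

definition is_necklace_algebra ::
    "nat \<Rightarrow> nat \<Rightarrow> ('l, 'y) ring_scheme \<Rightarrow> (path_fun set \<Rightarrow> 'l) \<Rightarrow> 'l set \<Rightarrow> bool" where
  "is_necklace_algebra k n L \<iota> B \<longleftrightarrow>
     (\<exists>I. grassmann_necklace k n I \<and> is_necklace_module k n L \<iota> I B)"

definition is_R_order ::
    "nat \<Rightarrow> nat \<Rightarrow> ('l, 'y) ring_scheme \<Rightarrow> (path_fun set \<Rightarrow> 'l) \<Rightarrow> 'l set \<Rightarrow> bool" where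
  "is_R_order k n L \<iota> B \<longleftrightarrow>
     subring B L \<and>
     (\<forall>r. \<forall>b\<in>B. \<iota> (scalar k n r) \<otimes>\<^bsub>L\<^esub> b \<in> B) \<and>
     (\<exists>bs. set bs \<subseteq> B \<and> B = ring.Span L (range (\<lambda>r. \<iota> (scalar k n r))) bs)"

end

theory Submission
  imports Defs "HOL-Computational_Algebra.Formal_Laurent_Series"
begin

text \<open>For an \<open>A\<close>-submodule \<open>B\<close> of a central localization \<open>L\<close> of \<open>A\<close> with \<open>1 \<in> B\<close> one has
  \<open>Ext\<^sup>1(B, L) = 0\<close> and \<open>Hom(B, L) = L\<close>, so by the long exact sequence of \<open>B \<subseteq> L\<close> the module \<open>B\<close>
  is rigid iff every map \<open>B \<rightarrow> L\<close> that is linear modulo \<open>B\<close> agrees modulo \<open>B\<close> with a right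
  multiplication. The action on a rank one module identifies \<open>C[t\<^sup>-\<^sup>1]\<close> with the \<open>n \<times> n\<close>
  matrices over Laurent series, and an order \<open>B\<close> becomes the set of matrices whose \<open>(i,j)\<close> entry
  has valuation at least \<open>\<beta> i j\<close>; hence \<open>B = B\<^sub>I\<close> for a sequence of labels \<open>I\<close> read off from the
  differences of \<open>\<beta>\<close>. Since \<open>B\<close> is an algebra, the function \<open>c i = \<beta> i l - \<beta> i (l - 1)\<close> is
  maximal at \<open>l - 1\<close>, minimal at \<open>l\<close>, and drops by at most one between them. The necklace
  condition says that \<open>c\<close> increases weakly around the circle from \<open>l\<close> to \<open>l - 1\<close>. If it does
  not, truncating to an arc where \<open>c\<close> changes gives a map that is linear modulo \<open>B\<close> but not a
  right multiplication. If it does, then for all columns \<open>j\<close>, \<open>l\<close> the difference is monotone on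
  both arcs between \<open>j\<close> and \<open>l\<close>, so a map that is linear modulo \<open>B\<close> and vanishes at \<open>1\<close> can be
  followed along the arcs from the diagonal, where it takes values in \<open>B\<close>.\<close>

section \<open>Left modules and free modules\<close>

text \<open>The quotient \<open>L/B\<close> is never formed: a map into it is a choice of values in
  \<open>L\<close> whose defects of linearity lie in \<open>B\<close>. On the free module with basis
  \<open>B\<close> such a choice extends linearly, and the extension carries relations into
  \<open>B\<close>, which gives a cocycle. The way back has to extend a homomorphism from the
  relations to the whole free module. This works because every element of \<open>B\<close> lands in
  the image of \<open>C\<close> after multiplication by a power of \<open>t\<close>, so the values
  on the basis are forced once the basis element of \<open>1\<close> is sent to 0.

  Injectivity of \<iota> is not assumed. Its kernel is killed by powers of \<open>t\<close>, and
  elements of \<open>C\<close> are therefore compared only through their images in \<open>L\<close>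
  or through matrices, where \<open>t\<close> is injective.

  That a corner of \<open>L\<close> between two vertices is one-dimensional over Laurent series
  rests on the last relation of \<open>C\<close>: it turns the full cycle \<open>x^n\<close> into
  \<open>t^(n-k)\<close>, which makes all paths between two vertices proportional.\<close>

locale left_module = R?: ring R + M?: abelian_group M
  for R :: "('a, 'x) ring_scheme" (structure) and M :: "('a, 'm, 'y) module_scheme" (structure) +
  assumes smult_closed [simp, intro]:
      "\<lbrakk>a \<in> carrier R; x \<in> carrier M\<rbrakk> \<Longrightarrow> a \<odot>\<^bsub>M\<^esub> x \<in> carrier M"
    and smult_l_distr:
      "\<lbrakk>a \<in> carrier R; b \<in> carrier R; x \<in> carrier M\<rbrakk> \<Longrightarrow>
       (a \<oplus> b) \<odot>\<^bsub>M\<^esub> x = a \<odot>\<^bsub>M\<^esub> x \<oplus>\<^bsub>M\<^esub> b \<odot>\<^bsub>M\<^esub> x"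
    and smult_r_distr:
      "\<lbrakk>a \<in> carrier R; x \<in> carrier M; y \<in> carrier M\<rbrakk> \<Longrightarrow>
       a \<odot>\<^bsub>M\<^esub> (x \<oplus>\<^bsub>M\<^esub> y) = a \<odot>\<^bsub>M\<^esub> x \<oplus>\<^bsub>M\<^esub> a \<odot>\<^bsub>M\<^esub> y"
    and smult_assoc:
      "\<lbrakk>a \<in> carrier R; b \<in> carrier R; x \<in> carrier M\<rbrakk> \<Longrightarrow>
       (a \<otimes> b) \<odot>\<^bsub>M\<^esub> x = a \<odot>\<^bsub>M\<^esub> (b \<odot>\<^bsub>M\<^esub> x)"
    and smult_one [simp]: "x \<in> carrier M \<Longrightarrow> \<one> \<odot>\<^bsub>M\<^esub> x = x"
begin

lemma smult_l_null [simp]: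
  assumes x: "x \<in> carrier M"
  shows "\<zero> \<odot>\<^bsub>M\<^esub> x = \<zero>\<^bsub>M\<^esub>"
proof -
  have "\<zero> \<odot>\<^bsub>M\<^esub> x = \<zero> \<odot>\<^bsub>M\<^esub> x \<oplus>\<^bsub>M\<^esub> \<zero> \<odot>\<^bsub>M\<^esub> x"
    using smult_l_distr[OF R.zero_closed R.zero_closed x] by simp
  then show ?thesis using x by (metis M.add.r_cancel_one R.zero_closed smult_closed)
qed

lemma smult_r_null [simp]:
  assumes a: "a \<in> carrier R"
  shows "a \<odot>\<^bsub>M\<^esub> \<zero>\<^bsub>M\<^esub> = \<zero>\<^bsub>M\<^esub>"
proof -
  have "a \<odot>\<^bsub>M\<^esub> \<zero>\<^bsub>M\<^esub> = a \<odot>\<^bsub>M\<^esub> \<zero>\<^bsub>M\<^esub> \<oplus>\<^bsub>M\<^esub> a \<odot>\<^bsub>M\<^esub> \<zero>\<^bsub>M\<^esub>"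
    using smult_r_distr[OF a M.zero_closed M.zero_closed] by simp
  then show ?thesis using a by (metis M.add.r_cancel_one M.zero_closed smult_closed)
qed

lemma smult_r_minus:
  assumes "a \<in> carrier R" "x \<in> carrier M"
  shows "a \<odot>\<^bsub>M\<^esub> (\<ominus>\<^bsub>M\<^esub> x) = \<ominus>\<^bsub>M\<^esub> (a \<odot>\<^bsub>M\<^esub> x)"
proof -
  have "a \<odot>\<^bsub>M\<^esub> (\<ominus>\<^bsub>M\<^esub> x) \<oplus>\<^bsub>M\<^esub> a \<odot>\<^bsub>M\<^esub> x = \<zero>\<^bsub>M\<^esub>"
    using assms smult_r_distr[of a "\<ominus>\<^bsub>M\<^esub> x" x] by (simp add: M.l_neg)
  then show ?thesis using assms by (simp add: M.minus_equality)
qed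

lemma smult_finsum:
  assumes "a \<in> carrier R" "f \<in> F \<rightarrow> carrier M"
  shows "a \<odot>\<^bsub>M\<^esub> (\<Oplus>\<^bsub>M\<^esub>b\<in>F. f b) = (\<Oplus>\<^bsub>M\<^esub>b\<in>F. a \<odot>\<^bsub>M\<^esub> f b)"
proof (cases "finite F")
  case True
  then show ?thesis using assms(2)
    by (induction F) (use assms(1) in \<open>auto simp: smult_r_distr Pi_iff\<close>)
qed (use assms in simp)

end

text \<open>The linearity conditions of \<open>lmod_hom\<close> without extensionality, so that maps
  compose as plain lambda terms and are restricted only when an element of a Hom group is
  required.\<close>

definition lmod_map ::
    "('a, 'x) ring_scheme \<Rightarrow> ('a, 'm, 'y) module_scheme \<Rightarrow> ('a, 'n, 'z) module_scheme
      \<Rightarrow> ('m \<Rightarrow> 'n) \<Rightarrow> bool" where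
  "lmod_map A M N f \<longleftrightarrow> f \<in> carrier M \<rightarrow> carrier N \<and>
     (\<forall>u\<in>carrier M. \<forall>v\<in>carrier M. f (u \<oplus>\<^bsub>M\<^esub> v) = f u \<oplus>\<^bsub>N\<^esub> f v) \<and>
     (\<forall>a\<in>carrier A. \<forall>u\<in>carrier M. f (a \<odot>\<^bsub>M\<^esub> u) = a \<odot>\<^bsub>N\<^esub> f u)"

lemma lmod_homD: "f \<in> lmod_hom A M N \<Longrightarrow> lmod_map A M N f"
  by (auto simp: lmod_hom_def lmod_map_def PiE_iff)

lemma lmod_hom_eqI:
  assumes "f \<in> lmod_hom A M N" "g \<in> lmod_hom A M N" "\<And>u. u \<in> carrier M \<Longrightarrow> f u = g u"
  shows "f = g"
  using assms by (auto simp: lmod_hom_def intro: PiE_ext)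

lemma lmod_map_comp:
  assumes "lmod_map A M N f" "lmod_map A N K g"
  shows "lmod_map A M K (\<lambda>u. g (f u))"
  using assms by (auto simp: lmod_map_def Pi_iff)

lemma lmod_map_zero:
  assumes "left_module A M" "left_module A N" "lmod_map A M N f"
  shows "f \<zero>\<^bsub>M\<^esub> = \<zero>\<^bsub>N\<^esub>"
proof -
  interpret M: left_module A M by fact
  interpret N: left_module A N by fact
  have "f (\<zero>\<^bsub>A\<^esub> \<odot>\<^bsub>M\<^esub> \<zero>\<^bsub>M\<^esub>) = \<zero>\<^bsub>A\<^esub> \<odot>\<^bsub>N\<^esub> f \<zero>\<^bsub>M\<^esub>" and "f \<zero>\<^bsub>M\<^esub> \<in> carrier N"
    using assms(3) M.R.zero_closed M.M.zero_closed unfolding lmod_map_def by blast+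
  then show ?thesis by simp
qed

lemma restrict_lmod_hom:
  assumes "left_module A M" "lmod_map A M N f"
  shows "restrict f (carrier M) \<in> lmod_hom A M N"
proof -
  interpret M: left_module A M by fact
  show ?thesis using assms(2) by (auto simp: lmod_hom_def lmod_map_def Pi_iff)
qed

text \<open>The map out of a free module that sends the basis element of \<open>b\<close> to
  \<open>\<gamma> b\<close>. For \<gamma> the identity it is \<open>lincomb\<close>, hence every
  differential of the resolution.\<close>

definition lin_ext ::
    "('a, 'x) ring_scheme \<Rightarrow> ('a, 'm, 'y) module_scheme \<Rightarrow> ('b \<Rightarrow> 'm) \<Rightarrow> ('b \<Rightarrow> 'a) \<Rightarrow> 'm" where
  "lin_ext A M \<gamma> f = (\<Oplus>\<^bsub>M\<^esub>b\<in>{b. f b \<noteq> \<zero>\<^bsub>A\<^esub>}. f b \<odot>\<^bsub>M\<^esub> \<gamma> b)"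

lemma lincomb_eq_lin_ext: "lincomb A M f = lin_ext A M (\<lambda>b. b) f"
  by (simp add: lincomb_def lin_ext_def)

definition free_gen :: "('a, 'x) ring_scheme \<Rightarrow> 'b \<Rightarrow> 'b \<Rightarrow> 'a" where
  "free_gen A b = (\<lambda>c. if c = b then \<one>\<^bsub>A\<^esub> else \<zero>\<^bsub>A\<^esub>)"

lemma free_lmod_simps:
  "\<zero>\<^bsub>free_lmod A S\<^esub> = (\<lambda>_. \<zero>\<^bsub>A\<^esub>)"
  "f \<oplus>\<^bsub>free_lmod A S\<^esub> g = (\<lambda>b. f b \<oplus>\<^bsub>A\<^esub> g b)"
  "a \<odot>\<^bsub>free_lmod A S\<^esub> f = (\<lambda>b. a \<otimes>\<^bsub>A\<^esub> f b)"
  by (simp_all add: free_lmod_def)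

section \<open>Free modules and their universal property\<close>

context ring
begin

text \<open>\<open>free_lmod\<close> restricts values only on \<open>S\<close>; off \<open>S\<close>
  they are zero, hence also in the ring, so membership can be used without asking where
  \<open>b\<close> lies.\<close>

lemma free_lmod_carrier:
  "f \<in> carrier (free_lmod R S) \<longleftrightarrow>
     (\<forall>b. f b \<in> carrier R) \<and> {b. f b \<noteq> \<zero>} \<subseteq> S \<and> finite {b. f b \<noteq> \<zero>}"
  proof
  assume "f \<in> carrier (free_lmod R S)"
  then have f: "f ` S \<subseteq> carrier R" "{b. f b \<noteq> \<zero>} \<subseteq> S" "finite {b. f b \<noteq> \<zero>}"
    by (auto simp: free_lmod_def)
  have "f b \<in> carrier R" for b
    by (cases "f b = \<zero>") (use f(1,2) in auto)
  then show "(\<forall>b. f b \<in> carrier R) \<and> {b. f b \<noteq> \<zero>} \<subseteq> S \<and> finite {b. f b \<noteq> \<zero>}"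
    using f by blast
qed (auto simp: free_lmod_def)

lemma free_lmod_add_closed:
  assumes "f \<in> carrier (free_lmod R S)" "g \<in> carrier (free_lmod R S)"
  shows "(\<lambda>b. f b \<oplus> g b) \<in> carrier (free_lmod R S)"
proof -
  have "{b. f b \<oplus> g b \<noteq> \<zero>} \<subseteq> {b. f b \<noteq> \<zero>} \<union> {b. g b \<noteq> \<zero>}" by auto
  moreover have "finite ({b. f b \<noteq> \<zero>} \<union> {b. g b \<noteq> \<zero>})" using assms by (simp add: free_lmod_carrier)
  ultimately show ?thesis using assms unfolding free_lmod_carrier
    by (meson add.m_closed finite_subset le_sup_iff subset_trans)
qed

lemma free_lmod_smult_closed:
  assumes "a \<in> carrier R" "f \<in> carrier (free_lmod R S)"
  shows "(\<lambda>b. a \<otimes> f b) \<in> carrier (free_lmod R S)"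
proof -
  have "{b. a \<otimes> f b \<noteq> \<zero>} \<subseteq> {b. f b \<noteq> \<zero>}" using assms(1) by auto
  then show ?thesis using assms unfolding free_lmod_carrier
    by (meson m_closed finite_subset subset_trans)
qed

lemma free_gen_closed: "b \<in> S \<Longrightarrow> free_gen R b \<in> carrier (free_lmod R S)"
  unfolding free_lmod_carrier free_gen_def
  by (auto intro: finite_subset[of _ "{b}"])

lemma left_module_free_lmod: "left_module R (free_lmod R S)"
proof (intro left_module.intro left_module_axioms.intro)
  show "ring R" by (rule ring_axioms)
  show "abelian_group (free_lmod R S)"
  proof (rule abelian_groupI)
    fix f assume f: "f \<in> carrier (free_lmod R S)"
    have "(\<lambda>b. (\<ominus> \<one>) \<otimes> f b) \<in> carrier (free_lmod R S)"
      using f by (intro free_lmod_smult_closed) auto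
    moreover have "(\<lambda>b. (\<ominus> \<one>) \<otimes> f b \<oplus> f b) = (\<lambda>_. \<zero>)"
      using f by (auto simp: free_lmod_carrier l_minus l_neg)
    ultimately show "\<exists>g\<in>carrier (free_lmod R S). g \<oplus>\<^bsub>free_lmod R S\<^esub> f = \<zero>\<^bsub>free_lmod R S\<^esub>"
      by (auto simp: free_lmod_simps)
  qed (auto simp: free_lmod_simps free_lmod_add_closed, auto simp: free_lmod_carrier a_ac)
qed (auto simp: free_lmod_simps free_lmod_smult_closed, auto simp: free_lmod_carrier l_distr
    r_distr m_assoc)

lemma free_lmod_induct [consumes 1, case_names zero add gen]:
  assumes "f \<in> carrier (free_lmod R S)"
    and "P (\<lambda>_. \<zero>)"
    and add: "\<And>f g. \<lbrakk>f \<in> carrier (free_lmod R S); g \<in> carrier (free_lmod R S); P f; P g\<rbrakk>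
           \<Longrightarrow> P (\<lambda>b. f b \<oplus> g b)"
    and gen: "\<And>a b. \<lbrakk>a \<in> carrier R; b \<in> S\<rbrakk> \<Longrightarrow> P (\<lambda>c. a \<otimes> free_gen R b c)"
  shows "P f"
proof -
  \<comment> \<open>The induction runs over a finite set containing the support: after one value is
    set to zero the smaller set still contains it, and no exact support has to be computed.\<close>
  have "finite F \<Longrightarrow> f \<in> carrier (free_lmod R S) \<Longrightarrow> {b. f b \<noteq> \<zero>} \<subseteq> F \<Longrightarrow> P f" for F
  proof (induction F arbitrary: f rule: finite_induct)
    case empty
    then have "f = (\<lambda>_. \<zero>)" by auto
    then show ?case using assms(2) by simp
  next
    case (insert x F)
    show ?case
    proof (cases "f x = \<zero>")
      case True
      then have "{b. f b \<noteq> \<zero>} \<subseteq> F" using insert.prems(2) by auto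
      then show ?thesis using insert.IH insert.prems(1) by blast
    next
      case False
      then have x: "x \<in> S" using insert.prems(1) by (auto simp: free_lmod_carrier)
      define g where "g = (\<lambda>b. if b = x then \<zero> else f b)"
      have fc: "\<And>b. f b \<in> carrier R" using insert.prems(1) by (auto simp: free_lmod_carrier)
      have g: "g \<in> carrier (free_lmod R S)" using insert.prems(1) unfolding free_lmod_carrier g_def
        by (auto intro: finite_subset[of _ "{b. f b \<noteq> \<zero>}"])
      have "P g" using g insert.prems(2) by (intro insert.IH) (auto simp: g_def)
      moreover have "P (\<lambda>c. f x \<otimes> free_gen R x c)" using gen x fc by blast
      ultimately have "P (\<lambda>b. g b \<oplus> f x \<otimes> free_gen R x b)"
        using add g free_lmod_smult_closed[OF fc free_gen_closed[OF x]] by blast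
      moreover have "(\<lambda>b. g b \<oplus> f x \<otimes> free_gen R x b) = f"
        using fc by (auto simp: g_def free_gen_def)
      ultimately show ?thesis by simp
    qed
  qed
  then show ?thesis using assms(1) free_lmod_carrier by blast
qed

end

context left_module
begin

text \<open>Two vectors and their sum have different supports; summing over one common finite set
  makes the linearity of \<open>lin_ext\<close> a termwise identity.\<close>

lemma lin_ext_superset:
  assumes "f \<in> carrier (free_lmod R S)" "\<gamma> \<in> S \<rightarrow> carrier M" "finite F" "F \<subseteq> S" "{b. f b \<noteq> \<zero>} \<subseteq> F"
  shows "lin_ext R M \<gamma> f = (\<Oplus>\<^bsub>M\<^esub>b\<in>F. f b \<odot>\<^bsub>M\<^esub> \<gamma> b)"
  unfolding lin_ext_def
  by (rule M.add.finprod_mono_neutral_cong_left)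
    (use assms in \<open>auto simp: R.free_lmod_carrier Pi_iff subset_iff\<close>)

lemma lin_ext_closed:
  assumes "f \<in> carrier (free_lmod R S)" "\<gamma> \<in> S \<rightarrow> carrier M"
  shows "lin_ext R M \<gamma> f \<in> carrier M"
  unfolding lin_ext_def by (rule M.finsum_closed) (use assms in \<open>auto simp: R.free_lmod_carrier
      Pi_iff subset_iff\<close>)

lemma lin_ext_lmod_map:
  assumes "\<gamma> \<in> S \<rightarrow> carrier M"
  shows "lmod_map R (free_lmod R S) M (lin_ext R M \<gamma>)"
  unfolding lmod_map_def
proof (intro conjI ballI)
  show "lin_ext R M \<gamma> \<in> carrier (free_lmod R S) \<rightarrow> carrier M" using lin_ext_closed assms by blast
next
  fix f g assume f: "f \<in> carrier (free_lmod R S)" and g: "g \<in> carrier (free_lmod R S)"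
  let ?F = "{b. f b \<noteq> \<zero>} \<union> {b. g b \<noteq> \<zero>}"
  have F: "finite ?F" "?F \<subseteq> S" using f g by (auto simp: R.free_lmod_carrier)
  have "lin_ext R M \<gamma> f \<oplus>\<^bsub>M\<^esub> lin_ext R M \<gamma> g =
      (\<Oplus>\<^bsub>M\<^esub>b\<in>?F. f b \<odot>\<^bsub>M\<^esub> \<gamma> b) \<oplus>\<^bsub>M\<^esub> (\<Oplus>\<^bsub>M\<^esub>b\<in>?F. g b \<odot>\<^bsub>M\<^esub> \<gamma> b)"
    using lin_ext_superset[OF f assms F] lin_ext_superset[OF g assms F] by simp
  also have "\<dots> = (\<Oplus>\<^bsub>M\<^esub>b\<in>?F. f b \<odot>\<^bsub>M\<^esub> \<gamma> b \<oplus>\<^bsub>M\<^esub> g b \<odot>\<^bsub>M\<^esub> \<gamma> b)"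
    by (rule M.finsum_addf[symmetric]) (use F f g assms in \<open>auto simp: R.free_lmod_carrier Pi_iff
        subset_iff\<close>)
  also have "\<dots> = (\<Oplus>\<^bsub>M\<^esub>b\<in>?F. (f b \<oplus> g b) \<odot>\<^bsub>M\<^esub> \<gamma> b)"
    by (rule M.finsum_cong') (use F f g assms in \<open>auto simp: R.free_lmod_carrier Pi_iff subset_iff
        smult_l_distr\<close>)
  also have "\<dots> = lin_ext R M \<gamma> (\<lambda>b. f b \<oplus> g b)"
    by (rule lin_ext_superset[symmetric, OF R.free_lmod_add_closed[OF f g] assms F])
      (use f g in \<open>auto simp: R.free_lmod_carrier\<close>)
  finally show "lin_ext R M \<gamma> (f \<oplus>\<^bsub>free_lmod R S\<^esub> g) = lin_ext R M \<gamma> f \<oplus>\<^bsub>M\<^esub> lin_ext R M \<gamma> g"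
    by (simp add: free_lmod_simps)
next
  fix a f assume a: "a \<in> carrier R" and f: "f \<in> carrier (free_lmod R S)"
  let ?F = "{b. f b \<noteq> \<zero>}"
  have F: "finite ?F" "?F \<subseteq> S" using f by (auto simp: R.free_lmod_carrier)
  have "a \<odot>\<^bsub>M\<^esub> lin_ext R M \<gamma> f = (\<Oplus>\<^bsub>M\<^esub>b\<in>?F. a \<odot>\<^bsub>M\<^esub> (f b \<odot>\<^bsub>M\<^esub> \<gamma> b))"
    unfolding lin_ext_def
    by (rule smult_finsum) (use a f assms in \<open>auto simp: R.free_lmod_carrier Pi_iff subset_iff\<close>)
  also have "\<dots> = (\<Oplus>\<^bsub>M\<^esub>b\<in>?F. (a \<otimes> f b) \<odot>\<^bsub>M\<^esub> \<gamma> b)"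
    by (rule M.finsum_cong') (use a f assms in \<open>auto simp: R.free_lmod_carrier Pi_iff subset_iff
        smult_assoc\<close>)
  also have "\<dots> = lin_ext R M \<gamma> (\<lambda>b. a \<otimes> f b)"
    by (rule lin_ext_superset[symmetric, OF R.free_lmod_smult_closed[OF a f] assms F])
      (use a in auto)
  finally show "lin_ext R M \<gamma> (a \<odot>\<^bsub>free_lmod R S\<^esub> f) = a \<odot>\<^bsub>M\<^esub> lin_ext R M \<gamma> f"
    by (simp add: free_lmod_simps)
qed

lemma lin_ext_gen:
  assumes "b \<in> S" "\<gamma> \<in> S \<rightarrow> carrier M"
  shows "lin_ext R M \<gamma> (free_gen R b) = \<gamma> b"
proof -
  have "lin_ext R M \<gamma> (free_gen R b) = (\<Oplus>\<^bsub>M\<^esub>c\<in>{b}. free_gen R b c \<odot>\<^bsub>M\<^esub> \<gamma> c)"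
    by (rule lin_ext_superset) (use assms R.free_gen_closed in \<open>auto simp: free_gen_def\<close>)
  also have "\<dots> = \<gamma> b" using assms by (simp add: free_gen_def Pi_iff)
  finally show ?thesis .
qed

lemma lmod_map_free_eqI:
  assumes f: "lmod_map R (free_lmod R S) M f" and g: "lmod_map R (free_lmod R S) M g"
    and eq: "\<And>b. b \<in> S \<Longrightarrow> f (free_gen R b) = g (free_gen R b)"
    and u: "u \<in> carrier (free_lmod R S)"
  shows "f u = g u"
  using u
proof (induction u rule: R.free_lmod_induct)
  case zero
  have "left_module R M" by unfold_locales
  from lmod_map_zero[OF R.left_module_free_lmod this f] lmod_map_zero[OF R.left_module_free_lmod
      this g]
  show ?case by (simp add: free_lmod_simps)
next
  case (add u v)
  have "h (\<lambda>b. u b \<oplus> v b) = h u \<oplus>\<^bsub>M\<^esub> h v" if "lmod_map R (free_lmod R S) M h" for h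
    using that add(1,2) by (simp add: lmod_map_def free_lmod_simps)
  from this[OF f] this[OF g] show ?case using add(3,4) by simp
next
  case (gen a b)
  have "h (\<lambda>c. a \<otimes> free_gen R b c) = a \<odot>\<^bsub>M\<^esub> h (free_gen R b)"
    if "lmod_map R (free_lmod R S) M h" for h
    using that gen R.free_gen_closed[OF gen(2)] by (simp add: lmod_map_def free_lmod_simps)
  from this[OF f] this[OF g] show ?case using eq[OF gen(2)] by simp
qed

end

section \<open>The first extension group\<close>

locale two_left_modules = MM: left_module A M + NN: left_module A N
  for A :: "('a, 'x) ring_scheme" and M :: "('a, 'm, 'y) module_scheme"
    and N :: "('a, 'n, 'z) module_scheme"
begin

abbreviation "P0 \<equiv> res0 A M"
abbreviation "P1 \<equiv> res1 A M"
abbreviation "P2 \<equiv> res2 A M"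
abbreviation "d0 \<equiv> lincomb A M"
abbreviation "d1 \<equiv> lincomb A P0"
abbreviation "d2 \<equiv> lincomb A P1"
abbreviation "K0 \<equiv> {f \<in> carrier P0. d0 f = \<zero>\<^bsub>M\<^esub>}"
abbreviation "K1 \<equiv> {f \<in> carrier P1. d1 f = \<zero>\<^bsub>P0\<^esub>}"

lemma res_left_module: "left_module A P0" "left_module A P1" "left_module A P2"
  unfolding res0_def res1_def res2_def by (rule MM.R.left_module_free_lmod)+

lemma d0_map: "lmod_map A P0 M d0"
  using MM.lin_ext_lmod_map[of "\<lambda>b. b" "carrier M"]
  unfolding res0_def lincomb_eq_lin_ext[abs_def] by simp

lemma d1_map: "lmod_map A P1 P0 d1"
  using left_module.lin_ext_lmod_map[OF res_left_module(1), of "\<lambda>b. b" K0]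
  unfolding res1_def lincomb_eq_lin_ext[abs_def] by (simp add: Pi_iff)

lemma d2_map: "lmod_map A P2 P1 d2"
  using left_module.lin_ext_lmod_map[OF res_left_module(2), of "\<lambda>b. b" K1]
  unfolding res2_def lincomb_eq_lin_ext[abs_def] by (simp add: Pi_iff)

lemma d0_gen: "m \<in> carrier M \<Longrightarrow> d0 (free_gen A m) = m"
  unfolding lincomb_eq_lin_ext by (rule MM.lin_ext_gen) auto

lemma d1_gen: "\<kappa> \<in> K0 \<Longrightarrow> d1 (free_gen A \<kappa>) = \<kappa>"
  unfolding lincomb_eq_lin_ext by (rule left_module.lin_ext_gen[OF res_left_module(1), of _ K0])
    (auto simp: lincomb_eq_lin_ext)

lemma d2_gen: "\<kappa> \<in> K1 \<Longrightarrow> d2 (free_gen A \<kappa>) = \<kappa>"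
  unfolding lincomb_eq_lin_ext by (rule left_module.lin_ext_gen[OF res_left_module(2), of _ K1])
    (auto simp: lincomb_eq_lin_ext)

lemma gen0_closed: "m \<in> carrier M \<Longrightarrow> free_gen A m \<in> carrier P0"
  unfolding res0_def by (rule MM.R.free_gen_closed)

lemma gen1_closed: "\<kappa> \<in> K0 \<Longrightarrow> free_gen A \<kappa> \<in> carrier P1"
  unfolding res1_def by (rule MM.R.free_gen_closed)

lemma gen2_closed: "\<kappa> \<in> K1 \<Longrightarrow> free_gen A \<kappa> \<in> carrier P2"
  unfolding res2_def by (rule MM.R.free_gen_closed)

lemma zero_map: "left_module A X \<Longrightarrow> left_module A Y \<Longrightarrow> lmod_map A X Y (\<lambda>_. \<zero>\<^bsub>Y\<^esub>)"
  using left_module.smult_r_null abelian_group.r_neg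
  unfolding lmod_map_def by (force simp: left_module_def abelian_group.axioms(1)
      abelian_monoid.zero_closed abelian_monoid.r_zero)

text \<open>A basis element of \<open>P1\<close> is a relation, and \<open>d1\<close> returns this
  relation, which \<open>d0\<close> kills by the choice of the basis.\<close>

lemma d0_d1: assumes "u \<in> carrier P1" shows "d0 (d1 u) = \<zero>\<^bsub>M\<^esub>"
  by (rule MM.lmod_map_free_eqI[of K0 "\<lambda>u. d0 (d1 u)" "\<lambda>_. \<zero>\<^bsub>M\<^esub>"])
    (use lmod_map_comp[OF d1_map d0_map] zero_map[OF res_left_module(2) MM.left_module_axioms]
        d1_gen assms
      in \<open>auto simp: res1_def\<close>)

lemma d1_d2: assumes "u \<in> carrier P2" shows "d1 (d2 u) = \<zero>\<^bsub>P0\<^esub>"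
  by (rule left_module.lmod_map_free_eqI[OF res_left_module(1), of K1 "\<lambda>u. d1 (d2 u)" "\<lambda>_. \<zero>\<^bsub>P0\<^esub>"])
    (use lmod_map_comp[OF d2_map d1_map] zero_map[OF res_left_module(3) res_left_module(1)] d2_gen
        assms
      in \<open>auto simp: res2_def\<close>)

text \<open>Each element of \<open>K1\<close> is itself a basis element of \<open>P2\<close>, so
  vanishing on the image of \<open>d2\<close> is vanishing on the kernel of \<open>d1\<close>. This
  removes \<open>P2\<close> from all later arguments.\<close>

lemma cocycles_iff:
  "f \<in> ext1_cocycles A M N \<longleftrightarrow> f \<in> lmod_hom A P1 N \<and> (\<forall>u\<in>K1. f u = \<zero>\<^bsub>N\<^esub>)"
proof
  assume f: "f \<in> ext1_cocycles A M N"
  have "f u = \<zero>\<^bsub>N\<^esub>" if "u \<in> K1" for u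
    using f d2_gen[OF that] gen2_closed[OF that] unfolding ext1_cocycles_def by force
  then show "f \<in> lmod_hom A P1 N \<and> (\<forall>u\<in>K1. f u = \<zero>\<^bsub>N\<^esub>)" using f by (auto simp: ext1_cocycles_def)
next
  assume "f \<in> lmod_hom A P1 N \<and> (\<forall>u\<in>K1. f u = \<zero>\<^bsub>N\<^esub>)"
  then show "f \<in> ext1_cocycles A M N"
    using d1_d2 d2_map by (auto simp: ext1_cocycles_def lmod_map_def)
qed

lemma coboundaries_subset: "ext1_coboundaries A M N \<subseteq> ext1_cocycles A M N"
proof
  fix f assume "f \<in> ext1_coboundaries A M N"
  then obtain g where g: "g \<in> lmod_hom A P0 N" and f: "f = restrict (\<lambda>u. g (d1 u)) (carrier P1)"
    by (auto simp: ext1_coboundaries_def)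
  have "lmod_map A P1 N (\<lambda>u. g (d1 u))" using lmod_map_comp[OF d1_map lmod_homD[OF g]] .
  then have "f \<in> lmod_hom A P1 N" unfolding f by (rule restrict_lmod_hom[OF res_left_module(2)])
  moreover have "f u = \<zero>\<^bsub>N\<^esub>" if "u \<in> K1" for u
    using that lmod_map_zero[OF res_left_module(1) NN.left_module_axioms lmod_homD[OF g]] by (simp
        add: f)
  ultimately show "f \<in> ext1_cocycles A M N" by (simp add: cocycles_iff)
qed

lemma cocycles_comm_group: "comm_group (hom_group A P1 N\<lparr>carrier := ext1_cocycles A M N\<rparr>)"
proof -
  interpret P1: left_module A P1 by (rule res_left_module)
  let ?Z = "ext1_cocycles A M N"
  have val: "f u \<in> carrier N" if "f \<in> ?Z" "u \<in> carrier P1" for f u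
    using that by (auto simp: cocycles_iff lmod_hom_def)
  have add: "(\<lambda>u\<in>carrier P1. f u \<oplus>\<^bsub>N\<^esub> g u) \<in> ?Z" if f: "f \<in> ?Z" and g: "g \<in> ?Z" for f g
  proof -
    have "lmod_map A P1 N (\<lambda>u. f u \<oplus>\<^bsub>N\<^esub> g u)"
      unfolding lmod_map_def
    proof (intro conjI ballI)
      fix u v assume uv: "u \<in> carrier P1" "v \<in> carrier P1"
      have "f (u \<oplus>\<^bsub>P1\<^esub> v) = f u \<oplus>\<^bsub>N\<^esub> f v" "g (u \<oplus>\<^bsub>P1\<^esub> v) = g u \<oplus>\<^bsub>N\<^esub> g v"
        using f g uv by (auto simp: cocycles_iff lmod_hom_def)
      then show "f (u \<oplus>\<^bsub>P1\<^esub> v) \<oplus>\<^bsub>N\<^esub> g (u \<oplus>\<^bsub>P1\<^esub> v) = f u \<oplus>\<^bsub>N\<^esub> g u \<oplus>\<^bsub>N\<^esub> (f v \<oplus>\<^bsub>N\<^esub> g v)"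
        using val[OF f uv(1)] val[OF f uv(2)] val[OF g uv(1)] val[OF g uv(2)] by (simp add:
            NN.M.add.m_ac)
    next
      fix a u assume au: "a \<in> carrier A" "u \<in> carrier P1"
      have "f (a \<odot>\<^bsub>P1\<^esub> u) = a \<odot>\<^bsub>N\<^esub> f u" "g (a \<odot>\<^bsub>P1\<^esub> u) = a \<odot>\<^bsub>N\<^esub> g u"
        using f g au by (auto simp: cocycles_iff lmod_hom_def)
      then show "f (a \<odot>\<^bsub>P1\<^esub> u) \<oplus>\<^bsub>N\<^esub> g (a \<odot>\<^bsub>P1\<^esub> u) = a \<odot>\<^bsub>N\<^esub> (f u \<oplus>\<^bsub>N\<^esub> g u)"
        using val[OF f au(2)] val[OF g au(2)] au(1) by (simp add: NN.smult_r_distr)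
    qed (use val f g in auto)
    from restrict_lmod_hom[OF res_left_module(2) this] show ?thesis
      using f g by (simp add: cocycles_iff)
  qed
  show ?thesis
  proof (rule comm_groupI; simp add: hom_group_def)
    fix f g assume f: "f \<in> ?Z" and g: "g \<in> ?Z"
    show "(\<lambda>u\<in>carrier P1. f u \<oplus>\<^bsub>N\<^esub> g u) \<in> ?Z" using add f g .
    show "(\<lambda>u\<in>carrier P1. f u \<oplus>\<^bsub>N\<^esub> g u) = (\<lambda>u\<in>carrier P1. g u \<oplus>\<^bsub>N\<^esub> f u)"
      by (rule restrict_ext) (use val f g NN.M.a_comm in auto)
    fix h assume h: "h \<in> ?Z"
    show "(\<lambda>u\<in>carrier P1. (if u \<in> carrier P1 then f u \<oplus>\<^bsub>N\<^esub> g u else undefined) \<oplus>\<^bsub>N\<^esub> h u) =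
          (\<lambda>u\<in>carrier P1. f u \<oplus>\<^bsub>N\<^esub> (if u \<in> carrier P1 then g u \<oplus>\<^bsub>N\<^esub> h u else undefined))"
      by (rule restrict_ext) (use val f g h NN.M.a_assoc in auto)
  next
    have "(\<lambda>u\<in>carrier P1. \<zero>\<^bsub>N\<^esub>) \<in> lmod_hom A P1 N"
      by (rule restrict_lmod_hom[OF res_left_module(2) zero_map[OF res_left_module(2)
          NN.left_module_axioms]])
    then show "(\<lambda>u\<in>carrier P1. \<zero>\<^bsub>N\<^esub>) \<in> ?Z" by (simp add: cocycles_iff)
  next
    fix f assume f: "f \<in> ?Z"
    have "(\<lambda>u\<in>carrier P1. (if u \<in> carrier P1 then \<zero>\<^bsub>N\<^esub> else undefined) \<oplus>\<^bsub>N\<^esub> f u) = restrict f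
        (carrier P1)"
      by (rule restrict_ext) (use val f in auto)
    also have "\<dots> = f" using f unfolding cocycles_iff lmod_hom_def by (auto intro: PiE_restrict)
    finally show "(\<lambda>u\<in>carrier P1. (if u \<in> carrier P1 then \<zero>\<^bsub>N\<^esub> else undefined) \<oplus>\<^bsub>N\<^esub> f u) = f" .
    let ?g = "\<lambda>u\<in>carrier P1. \<ominus>\<^bsub>N\<^esub> f u"
    have "lmod_map A P1 N (\<lambda>u. \<ominus>\<^bsub>N\<^esub> f u)"
      unfolding lmod_map_def
    proof (intro conjI ballI)
      fix u v assume uv: "u \<in> carrier P1" "v \<in> carrier P1"
      have "f (u \<oplus>\<^bsub>P1\<^esub> v) = f u \<oplus>\<^bsub>N\<^esub> f v"
        using f uv by (auto simp: cocycles_iff lmod_hom_def)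
      then show "\<ominus>\<^bsub>N\<^esub> f (u \<oplus>\<^bsub>P1\<^esub> v) = \<ominus>\<^bsub>N\<^esub> f u \<oplus>\<^bsub>N\<^esub> \<ominus>\<^bsub>N\<^esub> f v"
        using val[OF f uv(1)] val[OF f uv(2)] by (simp add: NN.M.minus_add)
    next
      fix a u assume au: "a \<in> carrier A" "u \<in> carrier P1"
      have "f (a \<odot>\<^bsub>P1\<^esub> u) = a \<odot>\<^bsub>N\<^esub> f u"
        using f au by (auto simp: cocycles_iff lmod_hom_def)
      then show "\<ominus>\<^bsub>N\<^esub> f (a \<odot>\<^bsub>P1\<^esub> u) = a \<odot>\<^bsub>N\<^esub> (\<ominus>\<^bsub>N\<^esub> f u)"
        using val[OF f au(2)] au(1) by (simp add: NN.smult_r_minus)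
    qed (use val f in auto)
    from restrict_lmod_hom[OF res_left_module(2) this] have "?g \<in> ?Z"
      using f by (simp add: cocycles_iff)
    moreover have "(\<lambda>u\<in>carrier P1. ?g u \<oplus>\<^bsub>N\<^esub> f u) = (\<lambda>u\<in>carrier P1. \<zero>\<^bsub>N\<^esub>)"
      by (rule restrict_ext) (use val f NN.M.l_neg in auto)
    ultimately show "\<exists>g\<in>?Z. (\<lambda>u\<in>carrier P1. g u \<oplus>\<^bsub>N\<^esub> f u) = (\<lambda>u\<in>carrier P1. \<zero>\<^bsub>N\<^esub>)" by blast
  qed
qed

text \<open>Triviality says that the coset of every cocycle is the coboundary set itself. From right
  to left the coboundaries are the whole group, so the normality needed for the quotient is that of
  the whole group.\<close>

lemma trivial_Ext1_iff:
  "trivial_group (Ext1 A M N) \<longleftrightarrow> ext1_cocycles A M N \<subseteq> ext1_coboundaries A M N"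
proof -
  let ?G = "hom_group A P1 N\<lparr>carrier := ext1_cocycles A M N\<rparr>"
  let ?B = "ext1_coboundaries A M N"
  interpret G: comm_group ?G by (rule cocycles_comm_group)
  show ?thesis
  proof
    assume "trivial_group (Ext1 A M N)"
    then have *: "(\<lambda>x. r_coset ?G ?B x) ` carrier ?G = {?B}"
      unfolding trivial_group_def Ext1_def by (simp add: carrier_FactGroup)
    show "ext1_cocycles A M N \<subseteq> ?B"
    proof
      fix f assume f: "f \<in> ext1_cocycles A M N"
      have "r_coset ?G ?B \<one>\<^bsub>?G\<^esub> = ?B" "r_coset ?G ?B f = ?B" using * f G.one_closed by auto
      moreover have "?B \<subseteq> carrier ?G" using coboundaries_subset by simp
      \<comment> \<open>The unit is the coboundary of the zero map. Hence \<open>f\<close>, as the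
        unit times \<open>f\<close>, lies in its own coset, which is \<open>?B\<close>.\<close>
      moreover have "\<one>\<^bsub>?G\<^esub> \<in> ?B"
      proof -
        have "lmod_map A P0 N (\<lambda>_. \<zero>\<^bsub>N\<^esub>)" by (rule zero_map[OF res_left_module(1)
            NN.left_module_axioms])
        from restrict_lmod_hom[OF res_left_module(1) this]
        have "(\<lambda>u\<in>carrier P1. (\<lambda>u\<in>carrier P0. \<zero>\<^bsub>N\<^esub>) (d1 u)) \<in> ?B" unfolding ext1_coboundaries_def
            by blast
        moreover have "(\<lambda>u\<in>carrier P1. (\<lambda>u\<in>carrier P0. \<zero>\<^bsub>N\<^esub>) (d1 u)) = \<one>\<^bsub>?G\<^esub>"
          using d1_map by (auto simp: hom_group_def lmod_map_def intro!: restrict_ext)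
        ultimately show ?thesis by simp
      qed
      ultimately show "f \<in> ?B" using f G.l_one[of f] unfolding r_coset_def by force
    qed
  next
    assume "ext1_cocycles A M N \<subseteq> ?B"
    then have eq: "?B = carrier ?G" using coboundaries_subset by auto
    have "carrier ?G \<lhd> ?G" using G.subgroup_self G.normal_iff_subgroup by blast
    then have "group (Ext1 A M N)" unfolding Ext1_def eq by (rule normal.factorgroup_is_group)
    moreover have "carrier (Ext1 A M N) = {carrier ?G}"
      unfolding Ext1_def eq carrier_FactGroup
      using G.coset_join2[OF _ G.subgroup_self] G.one_closed by blast
    ultimately show "trivial_group (Ext1 A M N)"
      unfolding trivial_group_def by (simp add: Ext1_def eq)
  qed
qed

end

section \<open>Rigidity inside a central localization\<close>

lemma sub_lmod_simps [simp]:
  "carrier (sub_lmod L \<iota> S) = S" "\<zero>\<^bsub>sub_lmod L \<iota> S\<^esub> = \<zero>\<^bsub>L\<^esub>"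
  "x \<oplus>\<^bsub>sub_lmod L \<iota> S\<^esub> y = x \<oplus>\<^bsub>L\<^esub> y" "c \<odot>\<^bsub>sub_lmod L \<iota> S\<^esub> x = \<iota> c \<otimes>\<^bsub>L\<^esub> x"
  by (simp_all add: sub_lmod_def)

lemma left_module_sub_lmod:
  assumes "ring_hom_ring C L \<iota>" "additive_subgroup S L"
    and "\<And>c b. \<lbrakk>c \<in> carrier C; b \<in> S\<rbrakk> \<Longrightarrow> \<iota> c \<otimes>\<^bsub>L\<^esub> b \<in> S"
  shows "left_module C (sub_lmod L \<iota> S)"
proof -
  interpret h: ring_hom_ring C L \<iota> by fact
  interpret S: additive_subgroup S L by fact
  show ?thesis
  proof (intro left_module.intro left_module_axioms.intro)
    show "ring C" by (rule h.R.ring_axioms)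
    have "\<exists>y\<in>S. y \<oplus>\<^bsub>L\<^esub> x = \<zero>\<^bsub>L\<^esub>" if "x \<in> S" for x
      using that S.a_inv_closed S.a_Hcarr h.S.l_neg by metis
    moreover have "(x \<oplus>\<^bsub>L\<^esub> y) \<oplus>\<^bsub>L\<^esub> z = x \<oplus>\<^bsub>L\<^esub> (y \<oplus>\<^bsub>L\<^esub> z)" "x \<oplus>\<^bsub>L\<^esub> y = y \<oplus>\<^bsub>L\<^esub> x"
      "\<zero>\<^bsub>L\<^esub> \<oplus>\<^bsub>L\<^esub> x = x"
      if "x \<in> S" "y \<in> S" "z \<in> S" for x y z
      using that[THEN S.a_Hcarr] by (simp_all add: h.S.a_ac)
    ultimately show "abelian_group (sub_lmod L \<iota> S)"
      by (intro abelian_groupI) (simp_all only: sub_lmod_simps S.a_closed S.zero_closed)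
  next
    fix a b x y assume "a \<in> carrier C" "b \<in> carrier C" "x \<in> carrier (sub_lmod L \<iota> S)" "y \<in> carrier
        (sub_lmod L \<iota> S)"
    then have c: "\<iota> a \<in> carrier L" "\<iota> b \<in> carrier L" "x \<in> carrier L" "y \<in> carrier L" and ab: "a \<in>
        carrier C" "b \<in> carrier C"
      using S.a_Hcarr by simp_all
    show "(a \<oplus>\<^bsub>C\<^esub> b) \<odot>\<^bsub>sub_lmod L \<iota> S\<^esub> x = a \<odot>\<^bsub>sub_lmod L \<iota> S\<^esub> x \<oplus>\<^bsub>sub_lmod L \<iota> S\<^esub> b \<odot>\<^bsub>sub_lmod L
        \<iota> S\<^esub> x"
      using ab c by (simp add: h.S.l_distr)
    show "a \<odot>\<^bsub>sub_lmod L \<iota> S\<^esub> (x \<oplus>\<^bsub>sub_lmod L \<iota> S\<^esub> y) = a \<odot>\<^bsub>sub_lmod L \<iota> S\<^esub> x \<oplus>\<^bsub>sub_lmod L \<iota> S\<^esub> a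
        \<odot>\<^bsub>sub_lmod L \<iota> S\<^esub> y"
      using c by (simp add: h.S.r_distr)
    show "(a \<otimes>\<^bsub>C\<^esub> b) \<odot>\<^bsub>sub_lmod L \<iota> S\<^esub> x = a \<odot>\<^bsub>sub_lmod L \<iota> S\<^esub> (b \<odot>\<^bsub>sub_lmod L \<iota> S\<^esub> x)"
      using ab c by (simp add: h.S.m_assoc)
  qed (simp_all add: assms(3) S.a_Hcarr)
qed

section \<open>Fractions in a central localization\<close>

locale central_localization = ring_hom_ring C L \<iota>
  for C :: "('c, 'x) ring_scheme" and L :: "('l, 'y) ring_scheme" (structure) and \<iota> :: "'c \<Rightarrow> 'l" +
  fixes s :: 'c
  assumes loc: "is_central_localization C s L \<iota>"
begin

lemma s_closed [simp]: "s \<in> carrier C"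
  and s_comm: "c \<in> carrier C \<Longrightarrow> s \<otimes>\<^bsub>C\<^esub> c = c \<otimes>\<^bsub>C\<^esub> s"
  and s_unit: "\<iota> s \<in> Units L"
  and kernel_torsion: "\<lbrakk>c \<in> carrier C; \<iota> c = \<zero>\<rbrakk> \<Longrightarrow> \<exists>m::nat. s [^]\<^bsub>C\<^esub> m \<otimes>\<^bsub>C\<^esub> c = \<zero>\<^bsub>C\<^esub>"
  using loc unfolding is_central_localization_def by simp_all

lemma s_pow_comm: "c \<in> carrier C \<Longrightarrow> s [^]\<^bsub>C\<^esub> (m::nat) \<otimes>\<^bsub>C\<^esub> c = c \<otimes>\<^bsub>C\<^esub> s [^]\<^bsub>C\<^esub> m"
proof (induction m)
  case (Suc m)
  have "s [^]\<^bsub>C\<^esub> Suc m \<otimes>\<^bsub>C\<^esub> c = s [^]\<^bsub>C\<^esub> m \<otimes>\<^bsub>C\<^esub> (s \<otimes>\<^bsub>C\<^esub> c)" using Suc.prems by (simp add: R.m_assoc)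
  also have "\<dots> = (s [^]\<^bsub>C\<^esub> m \<otimes>\<^bsub>C\<^esub> c) \<otimes>\<^bsub>C\<^esub> s" using Suc.prems s_comm by (simp add: R.m_assoc)
  also have "\<dots> = c \<otimes>\<^bsub>C\<^esub> s [^]\<^bsub>C\<^esub> Suc m" using Suc by (simp add: R.m_assoc)
  finally show ?case .
qed simp

lemma s_pow_unit: "\<iota> (s [^]\<^bsub>C\<^esub> (m::nat)) \<in> Units L"
  by (induction m) (use s_unit in \<open>auto simp: S.Units_m_closed\<close>)

lemma s_pow_cancel:
  assumes "x \<in> carrier L" "y \<in> carrier L"
    "\<iota> (s [^]\<^bsub>C\<^esub> (m::nat)) \<otimes> x = \<iota> (s [^]\<^bsub>C\<^esub> m) \<otimes> y"
  shows "x = y"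
  using S.Units_l_cancel[OF s_pow_unit assms(1,2)] assms(3) by simp

text \<open>Write \<open>x\<close> as a fraction with numerator \<open>c\<close> in
  \<open>C\<close>. After multiplication by the denominator, which is invertible and commutes with
  \<open>\<iota> s\<close>, the claim is the image of \<open>s c = c s\<close>.\<close>

lemma s_central:
  assumes x: "x \<in> carrier L"
  shows "\<iota> s \<otimes> x = x \<otimes> \<iota> s"
proof -
  obtain m :: nat and c where c: "c \<in> carrier C" "x \<otimes> \<iota> (s [^]\<^bsub>C\<^esub> m) = \<iota> c"
    using loc x unfolding is_central_localization_def by blast
  let ?u = "\<iota> (s [^]\<^bsub>C\<^esub> m)"
  have u: "?u \<in> carrier L" "?u \<otimes> \<iota> s = \<iota> s \<otimes> ?u"
    using s_pow_comm[of s m] by (metis R.nat_pow_closed hom_closed s_closed, metis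
        R.nat_pow_closed hom_mult s_closed)
  have "(\<iota> s \<otimes> x) \<otimes> ?u = \<iota> (s \<otimes>\<^bsub>C\<^esub> c)" using x u c by (simp add: S.m_assoc)
  also have "\<dots> = \<iota> c \<otimes> \<iota> s" using c s_comm by simp
  also have "\<dots> = (x \<otimes> \<iota> s) \<otimes> ?u" using x u c(2)[symmetric] by (simp add: S.m_assoc)
  finally have "(\<iota> s \<otimes> x) \<otimes> ?u = (x \<otimes> \<iota> s) \<otimes> ?u" .
  moreover obtain v where "v \<in> carrier L" "?u \<otimes> v = \<one>"
    using s_pow_unit[of m] unfolding Units_def by blast
  ultimately show ?thesis using x u by (metis S.m_assoc S.m_closed S.r_one hom_closed s_closed)
qed

lemma s_pow_central:
  assumes x: "x \<in> carrier L"
  shows "\<iota> (s [^]\<^bsub>C\<^esub> (m::nat)) \<otimes> x = x \<otimes> \<iota> (s [^]\<^bsub>C\<^esub> m)"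
proof (induction m)
  case (Suc m)
  let ?u = "\<iota> (s [^]\<^bsub>C\<^esub> m)"
  have u: "?u \<in> carrier L" by simp
  have "\<iota> (s [^]\<^bsub>C\<^esub> Suc m) \<otimes> x = ?u \<otimes> (x \<otimes> \<iota> s)"
    using x u s_central[OF x] by (simp add: S.m_assoc)
  also have "\<dots> = (?u \<otimes> x) \<otimes> \<iota> s" using x u by (simp add: S.m_assoc)
  also have "\<dots> = x \<otimes> \<iota> (s [^]\<^bsub>C\<^esub> Suc m)" unfolding Suc.IH using x u by (simp add: S.m_assoc)
  finally show ?case .
qed (use x in simp)

text \<open>The localization is given by right fractions; centrality moves the denominator to the
  left, where the module structure acts.\<close>

lemma denominator:
  assumes "x \<in> carrier L"
  obtains m :: nat and c where "c \<in> carrier C" "\<iota> (s [^]\<^bsub>C\<^esub> m) \<otimes> x = \<iota> c"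
  using assms loc s_pow_central[OF assms] unfolding is_central_localization_def by metis

end

section \<open>Maps modulo a submodule and the connecting homomorphism\<close>

locale unital_submodule = central_localization C L \<iota> s + B: additive_subgroup B L
  for C :: "('c, 'x) ring_scheme" and L :: "('l, 'y) ring_scheme" (structure) and \<iota> :: "'c \<Rightarrow> 'l"
    and s :: 'c and B :: "'l set" +
  assumes smult_B: "\<lbrakk>c \<in> carrier C; b \<in> B\<rbrakk> \<Longrightarrow> \<iota> c \<otimes> b \<in> B"
    and one_B: "\<one> \<in> B"
begin

abbreviation "BM \<equiv> sub_lmod L \<iota> B"
abbreviation "LM \<equiv> sub_lmod L \<iota> (carrier L)"

lemma left_module_BM: "left_module C BM"
  by (rule left_module_sub_lmod[OF ring_hom_ring_axioms B.additive_subgroup_axioms smult_B])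

lemma left_module_LM: "left_module C LM"
  by (rule left_module_sub_lmod[OF ring_hom_ring_axioms additive_subgroup.intro[OF
      S.add.subgroup_self]]) simp

sublocale X: two_left_modules C BM BM
  by (intro two_left_modules.intro left_module_BM)

lemma incl_map: "lmod_map C BM LM (\<lambda>x. x)"
  using B.a_Hcarr by (auto simp: lmod_map_def)

lemma B_minus: "\<lbrakk>a \<in> B; b \<in> B\<rbrakk> \<Longrightarrow> a \<ominus> b \<in> B"
  unfolding a_minus_def by auto

text \<open>A homomorphism from \<open>B\<close> to \<open>L/B\<close>, encoded by representatives;
  the two defects are the values that must vanish in the quotient.\<close>

definition hom_mod_B :: "('l \<Rightarrow> 'l) \<Rightarrow> bool" where
  "hom_mod_B H \<longleftrightarrow> H \<in> B \<rightarrow> carrier L \<and>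
     (\<forall>u\<in>B. \<forall>v\<in>B. H (u \<oplus> v) \<ominus> (H u \<oplus> H v) \<in> B) \<and>
     (\<forall>a\<in>carrier C. \<forall>u\<in>B. H (\<iota> a \<otimes> u) \<ominus> \<iota> a \<otimes> H u \<in> B)"

text \<open>Evaluating a formal combination before or after applying \<open>H\<close> differs by a
  sum of linearity defects, each of which lies in \<open>B\<close>.\<close>

lemma lin_ext_hom_mod_B:
  assumes H: "hom_mod_B H" and f: "f \<in> carrier X.P0"
  shows "lin_ext C LM H f \<ominus> H (X.d0 f) \<in> B"
proof -
  interpret LM: left_module C LM by (rule left_module_LM)
  have HL: "H \<in> B \<rightarrow> carrier L" using H by (simp add: hom_mod_B_def)
  have P0: "X.P0 = free_lmod C B" by (simp add: res0_def)
  have E: "lmod_map C (free_lmod C B) LM (lin_ext C LM H)" by (rule LM.lin_ext_lmod_map) (use HL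
      in simp)
  have d0: "lmod_map C (free_lmod C B) BM X.d0" using X.d0_map by (simp add: P0)
  have dB: "X.d0 f \<in> B" if "f \<in> carrier (free_lmod C B)" for f using d0 that by (auto simp:
      lmod_map_def)
  have EL: "lin_ext C LM H f \<in> carrier L" if "f \<in> carrier (free_lmod C B)" for f
    using E that by (auto simp: lmod_map_def)
  have HL': "H x \<in> carrier L" if "x \<in> B" for x using HL that by auto
  show ?thesis using f unfolding P0
  proof (induction f rule: R.free_lmod_induct)
    case zero
    \<comment> \<open>The additivity defect at zero is the negative of \<open>H \<zero>\<close>; so
      \<open>H \<zero>\<close> lies in \<open>B\<close>, although it need not vanish.\<close>
    have "H (\<zero> \<oplus> \<zero>) \<ominus> (H \<zero> \<oplus> H \<zero>) \<in> B" using H B.zero_closed unfolding hom_mod_B_def by blast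
    moreover have "H \<zero> \<in> carrier L" using HL by auto
    then have "H \<zero> \<ominus> (H \<zero> \<oplus> H \<zero>) = \<zero> \<ominus> H \<zero>" by algebra
    moreover have "lin_ext C LM H (\<lambda>_. \<zero>\<^bsub>C\<^esub>) = \<zero>"
      using lmod_map_zero[OF R.left_module_free_lmod left_module_LM E] by (simp add:
          free_lmod_simps)
    moreover have "X.d0 (\<lambda>_. \<zero>\<^bsub>C\<^esub>) = \<zero>"
      using lmod_map_zero[OF R.left_module_free_lmod left_module_BM d0] by (simp add:
          free_lmod_simps)
    ultimately show ?case by simp
  next
    case (add f g)
    have 1: "lin_ext C LM H (\<lambda>b. f b \<oplus>\<^bsub>C\<^esub> g b) = lin_ext C LM H f \<oplus> lin_ext C LM H g"
      using E add(1,2) unfolding lmod_map_def by (simp add: free_lmod_simps)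
    have 2: "X.d0 (\<lambda>b. f b \<oplus>\<^bsub>C\<^esub> g b) = X.d0 f \<oplus> X.d0 g"
      using d0 add(1,2) unfolding lmod_map_def by (simp add: free_lmod_simps)
    have 3: "H (X.d0 f \<oplus> X.d0 g) \<ominus> (H (X.d0 f) \<oplus> H (X.d0 g)) \<in> B"
      using H dB add(1,2) unfolding hom_mod_B_def by blast
    have 4: "((lin_ext C LM H f \<ominus> H (X.d0 f)) \<oplus> (lin_ext C LM H g \<ominus> H (X.d0 g))) \<ominus>
       (H (X.d0 f \<oplus> X.d0 g) \<ominus> (H (X.d0 f) \<oplus> H (X.d0 g))) \<in> B"
      using add(3,4) 3 B_minus B.a_closed by blast
    have "((lin_ext C LM H f \<ominus> H (X.d0 f)) \<oplus> (lin_ext C LM H g \<ominus> H (X.d0 g))) \<ominus>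
       (H (X.d0 f \<oplus> X.d0 g) \<ominus> (H (X.d0 f) \<oplus> H (X.d0 g))) =
      (lin_ext C LM H f \<oplus> lin_ext C LM H g) \<ominus> H (X.d0 f \<oplus> X.d0 g)"
      using EL[OF add(1)] EL[OF add(2)] HL'[OF dB[OF add(1)]] HL'[OF dB[OF add(2)]]
        HL'[OF B.a_closed[OF dB[OF add(1)] dB[OF add(2)]]] by algebra
    then show ?case using 4 by (simp add: 1 2)
  next
    case (gen a b)
    have 1: "lin_ext C LM H (\<lambda>c. a \<otimes>\<^bsub>C\<^esub> free_gen C b c) = \<iota> a \<otimes> H b"
      using E gen R.free_gen_closed[OF gen(2)] LM.lin_ext_gen[of b B H] HL
      by (simp add: lmod_map_def free_lmod_simps)
    have 2: "X.d0 (\<lambda>c. a \<otimes>\<^bsub>C\<^esub> free_gen C b c) = \<iota> a \<otimes> b"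
      using d0 gen R.free_gen_closed[OF gen(2)] X.d0_gen[of b] by (simp add: lmod_map_def
          free_lmod_simps)
    have "H (\<iota> a \<otimes> b) \<ominus> \<iota> a \<otimes> H b \<in> B" using H gen unfolding hom_mod_B_def by blast
    then have "\<ominus> (H (\<iota> a \<otimes> b) \<ominus> \<iota> a \<otimes> H b) \<in> B" by simp
    moreover have "\<ominus> (H (\<iota> a \<otimes> b) \<ominus> \<iota> a \<otimes> H b) = \<iota> a \<otimes> H b \<ominus> H (\<iota> a \<otimes> b)"
      using HL'[OF gen(2)] HL'[OF smult_B[OF gen]] hom_closed[OF gen(1)] by algebra
    ultimately show ?case by (simp add: 1 2)
  qed
qed

text \<open>The linear extension of \<open>H\<close> to \<open>P0\<close> carries relations into
  \<open>B\<close>, so composing with \<open>d1\<close> gives a cocycle, the image of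
  \<open>H\<close> under the connecting map. If it is the coboundary of \<open>g\<close>, then
  \<open>H - g\<close> respects the relations, is \<open>C\<close>-equivariant into
  \<open>L\<close>, and is therefore right multiplication by its value at
  \<open>\<one>\<close>.\<close>

lemma rigid_imp_lift:
  assumes rig: "rigid C BM" and H: "hom_mod_B H"
  obtains z where "z \<in> carrier L" "\<And>u. u \<in> B \<Longrightarrow> H u \<ominus> u \<otimes> z \<in> B"
proof -
  interpret LM: left_module C LM by (rule left_module_LM)
  interpret P0: left_module C X.P0 by (rule X.res_left_module)
  let ?E = "lin_ext C LM H"
  have HL: "H \<in> B \<rightarrow> carrier L" using H by (simp add: hom_mod_B_def)
  have P0: "X.P0 = free_lmod C B" by (simp add: res0_def)
  have E: "lmod_map C X.P0 LM ?E" unfolding P0 by (rule LM.lin_ext_lmod_map) (use HL in simp)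
  have H0: "H \<zero> \<in> B"
  proof -
    have "?E (\<zero>\<^bsub>X.P0\<^esub>) \<ominus> H (X.d0 (\<zero>\<^bsub>X.P0\<^esub>)) \<in> B" by (rule lin_ext_hom_mod_B[OF H P0.M.zero_closed])
    moreover have "?E (\<zero>\<^bsub>X.P0\<^esub>) = \<zero>" using lmod_map_zero[OF X.res_left_module(1) left_module_LM E]
        by simp
    moreover have "X.d0 (\<zero>\<^bsub>X.P0\<^esub>) = \<zero>" using lmod_map_zero[OF X.res_left_module(1) left_module_BM
        X.d0_map] by simp
    moreover have "H \<zero> \<in> carrier L" using HL by auto
    moreover from this have "\<ominus> (\<zero> \<ominus> H \<zero>) = H \<zero>" by algebra
    ultimately show ?thesis using B.a_inv_closed by metis
  qed
  have EK: "?E \<kappa> \<in> B" if "\<kappa> \<in> X.K0" for \<kappa>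
  proof -
    have "?E \<kappa> \<ominus> H \<zero> \<in> B" using lin_ext_hom_mod_B[OF H, of \<kappa>] that by simp
    then have "(?E \<kappa> \<ominus> H \<zero>) \<oplus> H \<zero> \<in> B" using H0 by simp
    moreover have "?E \<kappa> \<in> carrier L" "H \<zero> \<in> carrier L" using E that H0 B.a_Hcarr by (auto simp:
        lmod_map_def)
    then have "(?E \<kappa> \<ominus> H \<zero>) \<oplus> H \<zero> = ?E \<kappa>" by algebra
    ultimately show ?thesis by simp
  qed
  have dK: "X.d1 u \<in> X.K0" if "u \<in> carrier X.P1" for u
    using X.d0_d1[OF that] X.d1_map that by (auto simp: lmod_map_def)
  define \<phi> where "\<phi> = restrict (\<lambda>u. ?E (X.d1 u)) (carrier X.P1)"
  have "lmod_map C X.P1 LM (\<lambda>u. ?E (X.d1 u))" by (rule lmod_map_comp[OF X.d1_map E])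
  then have "lmod_map C X.P1 BM (\<lambda>u. ?E (X.d1 u))" using EK dK by (auto simp: lmod_map_def)
  then have "\<phi> \<in> lmod_hom C X.P1 BM" unfolding \<phi>_def by (rule restrict_lmod_hom[OF
      X.res_left_module(2)])
  moreover have "\<phi> u = \<zero>\<^bsub>BM\<^esub>" if "u \<in> X.K1" for u
    using that lmod_map_zero[OF X.res_left_module(1) left_module_LM E] by (simp add: \<phi>_def)
  ultimately have "\<phi> \<in> ext1_cocycles C BM BM" unfolding X.cocycles_iff by blast
  then obtain g where g: "g \<in> lmod_hom C X.P0 BM" and \<phi>g: "\<phi> = restrict (\<lambda>u. g (X.d1 u)) (carrier
      X.P1)"
    using rig unfolding rigid_def X.trivial_Ext1_iff ext1_coboundaries_def by blast
  note gm = lmod_homD[OF g]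
  have eq: "?E \<kappa> = g \<kappa>" if "\<kappa> \<in> X.K0" for \<kappa>
  proof -
    have "\<phi> (free_gen C \<kappa>) = ?E \<kappa>" "\<phi> (free_gen C \<kappa>) = g \<kappa>"
      using X.gen1_closed[OF that] X.d1_gen[OF that] by (simp add: \<phi>_def, simp add: \<phi>g)
    then show ?thesis by simp
  qed
  define \<theta> where "\<theta> u = H u \<ominus> g (free_gen C u)" for u
  have gB: "g (free_gen C u) \<in> B" if "u \<in> B" for u
    using gm X.gen0_closed[of u] that by (auto simp: lmod_map_def)
  have \<theta>L: "\<theta> u \<in> carrier L" if "u \<in> B" for u using that HL gB[OF that] B.a_Hcarr by (auto simp:
      \<theta>_def)
  have hom: "\<theta> (\<iota> a \<otimes> u) = \<iota> a \<otimes> \<theta> u" if a: "a \<in> carrier C" and u: "u \<in> B" for a u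
  proof -
    let ?\<delta> = "free_gen C :: 'l \<Rightarrow> _"
    have au: "\<iota> a \<otimes> u \<in> B" by (rule smult_B[OF a u])
    have ia: "\<iota> (\<ominus>\<^bsub>C\<^esub> a) = \<ominus> \<iota> a" using a by simp
    have car: "\<iota> a \<in> carrier L" "u \<in> carrier L" "\<iota> a \<otimes> u \<in> carrier L" "H u \<in> carrier L" "H (\<iota> a \<otimes>
        u) \<in> carrier L"
       "g (?\<delta> u) \<in> carrier L" "g (?\<delta> (\<iota> a \<otimes> u)) \<in> carrier L"
      using a u au HL gB B.a_Hcarr by auto
    \<comment> \<open>The relation between the basis elements of \<open>a u\<close> and
      \<open>u\<close>. \<open>?E\<close> and \<open>g\<close> agree on it, and that is exactly the
      compatibility of \<theta> with \<open>a\<close>.\<close>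
    define \<kappa> where "\<kappa> = ?\<delta> (\<iota> a \<otimes> u) \<oplus>\<^bsub>X.P0\<^esub> (\<ominus>\<^bsub>C\<^esub> a) \<odot>\<^bsub>X.P0\<^esub> ?\<delta> u"
    have comp: "h \<kappa> = h (?\<delta> (\<iota> a \<otimes> u)) \<oplus> (\<ominus> \<iota> a) \<otimes> h (?\<delta> u)"
      if "lmod_map C X.P0 (sub_lmod L \<iota> S) h" for h S
      using that X.gen0_closed[of u] X.gen0_closed[of "\<iota> a \<otimes> u"] a u au ia
      unfolding \<kappa>_def lmod_map_def by simp
    have "X.d0 \<kappa> = \<iota> a \<otimes> u \<oplus> (\<ominus> \<iota> a) \<otimes> u"
      using comp[OF X.d0_map] X.d0_gen u au by simp
    also have "\<dots> = \<zero>" using car by algebra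
    finally have \<kappa>: "\<kappa> \<in> X.K0"
      using X.gen0_closed[of u] X.gen0_closed[of "\<iota> a \<otimes> u"] a u au by (simp add: \<kappa>_def)
    have EH: "?E (?\<delta> v) = H v" if "v \<in> B" for v
      by (rule LM.lin_ext_gen[OF that]) (use HL in simp)
    have "H (\<iota> a \<otimes> u) \<oplus> (\<ominus> \<iota> a) \<otimes> H u =
        g (?\<delta> (\<iota> a \<otimes> u)) \<oplus> (\<ominus> \<iota> a) \<otimes> g (?\<delta> u)"
      using eq[OF \<kappa>] comp[OF E] comp[OF gm] EH u au by simp
    moreover have "H (\<iota> a \<otimes> u) \<ominus> g (?\<delta> (\<iota> a \<otimes> u)) =
       (H (\<iota> a \<otimes> u) \<oplus> (\<ominus> \<iota> a) \<otimes> H u) \<oplus> \<iota> a \<otimes> H u \<ominus> g (?\<delta> (\<iota> a \<otimes> u))"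
      using car by algebra
    moreover have "(g (?\<delta> (\<iota> a \<otimes> u)) \<oplus> (\<ominus> \<iota> a) \<otimes> g (?\<delta> u)) \<oplus> \<iota> a \<otimes> H u \<ominus> g (?\<delta> (\<iota> a \<otimes> u)) =
       \<iota> a \<otimes> (H u \<ominus> g (?\<delta> u))"
      using car by algebra
    ultimately show ?thesis by (simp add: \<theta>_def)
  qed
  let ?z = "\<theta> \<one>"
  have z: "?z \<in> carrier L" using \<theta>L one_B .
  have \<theta>z: "\<theta> u = u \<otimes> ?z" if u: "u \<in> B" for u
  proof -
    \<comment> \<open>After multiplication by \<open>s^m\<close> the element \<open>u\<close>
      becomes \<open>c\<close> acting on \<open>\<one>\<close>; as \<open>s^m\<close> is invertible
      in \<open>L\<close>, the value of \<theta> at \<open>\<one>\<close> decides its value at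
      \<open>u\<close>.\<close>
    obtain m :: nat and c where c: "c \<in> carrier C" "\<iota> (s [^]\<^bsub>C\<^esub> m) \<otimes> u = \<iota> c"
      using denominator u B.a_Hcarr by metis
    let ?t = "\<iota> (s [^]\<^bsub>C\<^esub> m)"
    have t: "?t \<in> carrier L" by simp
    have "?t \<otimes> \<theta> u = \<theta> (?t \<otimes> u)" using hom[of "s [^]\<^bsub>C\<^esub> m" u] u by simp
    also have "\<dots> = \<theta> (\<iota> c \<otimes> \<one>)" using c by simp
    also have "\<dots> = ?t \<otimes> (u \<otimes> ?z)"
      using hom[OF c(1) one_B] c(2)[symmetric] t z u B.a_Hcarr by (simp add: S.m_assoc)
    finally show ?thesis using s_pow_cancel[of "\<theta> u" "u \<otimes> ?z" m] \<theta>L[OF u] z u B.a_Hcarr by blast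
  qed
  have "H u \<ominus> u \<otimes> ?z \<in> B" if u: "u \<in> B" for u
  proof -
    have "H u \<ominus> (H u \<ominus> g (free_gen C u)) = g (free_gen C u)"
    proof -
      have "H u \<in> carrier L" "g (free_gen C u) \<in> carrier L" using HL gB u B.a_Hcarr by auto
      then show ?thesis by algebra
    qed
    then show ?thesis using \<theta>z[OF u] gB[OF u] by (simp add: \<theta>_def)
  qed
  then show thesis using that z by blast
qed

end

section \<open>Extension of cocycles to L and the converse direction\<close>

context unital_submodule
begin

text \<open>This is the vanishing of the first extension group of \<open>B\<close> by
  \<open>L\<close>. A cocycle is a homomorphism \<psi> on the relations. For \<open>m\<close> in
  \<open>B\<close> some \<open>s^q m\<close> is the image of \<open>c\<close>, so
  \<open>s^q [m] - c [1]\<close> is a relation; sending \<open>[1]\<close> to zero forces the value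
  at \<open>[m]\<close> to be \<open>s^(-q)\<close> times \<psi> of it.\<close>

lemma cocycle_extends:
  assumes \<phi>: "\<phi> \<in> ext1_cocycles C BM BM"
  obtains \<gamma> where "\<gamma> \<in> B \<rightarrow> carrier L"
    "\<And>u. u \<in> carrier X.P1 \<Longrightarrow> \<phi> u = lin_ext C LM \<gamma> (X.d1 u)"
    "\<And>\<kappa>. \<kappa> \<in> X.K0 \<Longrightarrow> lin_ext C LM \<gamma> \<kappa> \<in> B"
proof -
  interpret LM: left_module C LM by (rule left_module_LM)
  interpret P0: left_module C X.P0 by (rule X.res_left_module)
  interpret P1: left_module C X.P1 by (rule X.res_left_module)
  have \<phi>m: "lmod_map C X.P1 BM \<phi>" using \<phi> lmod_homD unfolding X.cocycles_iff by blast
  have \<phi>0: "\<phi> u = \<zero>" if "u \<in> X.K1" for u using \<phi> that unfolding X.cocycles_iff by simp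
  define \<psi> where "\<psi> \<kappa> = \<phi> (free_gen C \<kappa>)" for \<kappa>
  have dK: "X.d1 u \<in> X.K0" if "u \<in> carrier X.P1" for u
    using X.d0_d1[OF that] X.d1_map that by (auto simp: lmod_map_def)
  have \<phi>add: "\<phi> (u \<oplus>\<^bsub>X.P1\<^esub> v) = \<phi> u \<oplus> \<phi> v" if "u \<in> carrier X.P1" "v \<in> carrier X.P1" for u v
    using \<phi>m that by (simp add: lmod_map_def)
  have \<phi>smult: "\<phi> (a \<odot>\<^bsub>X.P1\<^esub> u) = \<iota> a \<otimes> \<phi> u" if "a \<in> carrier C" "u \<in> carrier X.P1" for a u
    using \<phi>m that by (simp add: lmod_map_def)
  have \<phi>B: "\<phi> u \<in> B" if "u \<in> carrier X.P1" for u using \<phi>m that by (auto simp: lmod_map_def)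
  have d1add: "X.d1 (u \<oplus>\<^bsub>X.P1\<^esub> v) = X.d1 u \<oplus>\<^bsub>X.P0\<^esub> X.d1 v" if "u \<in> carrier X.P1" "v \<in> carrier
      X.P1" for u v
    using X.d1_map that by (simp add: lmod_map_def)
  have d1smult: "X.d1 (a \<odot>\<^bsub>X.P1\<^esub> u) = a \<odot>\<^bsub>X.P0\<^esub> X.d1 u" if "a \<in> carrier C" "u \<in> carrier X.P1" for
      a u
    using X.d1_map that by (simp add: lmod_map_def)
  have d0add: "X.d0 (u \<oplus>\<^bsub>X.P0\<^esub> v) = X.d0 u \<oplus> X.d0 v" if "u \<in> carrier X.P0" "v \<in> carrier X.P0" for
      u v
    using X.d0_map that by (simp add: lmod_map_def)
  have d0smult: "X.d0 (a \<odot>\<^bsub>X.P0\<^esub> u) = \<iota> a \<otimes> X.d0 u" if "a \<in> carrier C" "u \<in> carrier X.P0" for a u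
    using X.d0_map that by (simp add: lmod_map_def)
  have \<psi>\<phi>: "\<phi> u = \<psi> (X.d1 u)" if u: "u \<in> carrier X.P1" for u
  proof -
    \<comment> \<open>\<open>u\<close> and the basis element of \<open>d1 u\<close> have the same
      image under \<open>d1\<close>, so their difference lies in \<open>K1\<close>, where \<phi>
      vanishes; hence \<open>\<phi> u\<close> depends on \<open>d1 u\<close> only.\<close>
    let ?g = "free_gen C (X.d1 u)"
    have g: "?g \<in> carrier X.P1" by (rule X.gen1_closed[OF dK[OF u]])
    have dg: "X.d1 ?g = X.d1 u" by (rule X.d1_gen[OF dK[OF u]])
    let ?m = "\<ominus>\<^bsub>C\<^esub> \<one>\<^bsub>C\<^esub>"
    have du: "X.d1 u \<in> carrier X.P0" using dK[OF u] by simp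
    have "X.d1 (u \<oplus>\<^bsub>X.P1\<^esub> ?m \<odot>\<^bsub>X.P1\<^esub> ?g) = \<one>\<^bsub>C\<^esub> \<odot>\<^bsub>X.P0\<^esub> X.d1 u \<oplus>\<^bsub>X.P0\<^esub> ?m \<odot>\<^bsub>X.P0\<^esub> X.d1 u"
      using u g dg du by (simp add: d1add d1smult)
    also have "\<dots> = (\<one>\<^bsub>C\<^esub> \<oplus>\<^bsub>C\<^esub> ?m) \<odot>\<^bsub>X.P0\<^esub> X.d1 u"
      using du by (intro P0.smult_l_distr[symmetric]) auto
    also have "\<dots> = \<zero>\<^bsub>X.P0\<^esub>" using du by (simp add: R.r_neg)
    finally have "u \<oplus>\<^bsub>X.P1\<^esub> ?m \<odot>\<^bsub>X.P1\<^esub> ?g \<in> X.K1" using u g by simp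
    then have "\<phi> (u \<oplus>\<^bsub>X.P1\<^esub> ?m \<odot>\<^bsub>X.P1\<^esub> ?g) = \<zero>" by (rule \<phi>0)
    moreover have m: "?m \<in> carrier C" by simp
    ultimately have "\<phi> u \<oplus> \<iota> ?m \<otimes> \<phi> ?g = \<zero>"
      by (simp only: \<phi>add[OF u P1.smult_closed[OF m g]] \<phi>smult[OF m g])
    moreover have c: "\<phi> u \<in> carrier L" "\<phi> ?g \<in> carrier L"
      by (rule B.a_Hcarr[OF \<phi>B[OF u]], rule B.a_Hcarr[OF \<phi>B[OF g]])
    ultimately have "\<phi> u \<ominus> \<phi> ?g = \<zero>" by (simp add: S.l_minus a_minus_def)
    then show ?thesis unfolding \<psi>_def using c by (simp only: S.r_right_minus_eq)
  qed
  have \<psi>add: "\<psi> (\<kappa> \<oplus>\<^bsub>X.P0\<^esub> \<mu>) = \<psi> \<kappa> \<oplus> \<psi> \<mu>" if "\<kappa> \<in> X.K0" "\<mu> \<in> X.K0" for \<kappa> \<mu>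
    using \<psi>\<phi>[of "free_gen C \<kappa> \<oplus>\<^bsub>X.P1\<^esub> free_gen C \<mu>"] X.gen1_closed[OF that(1)] X.gen1_closed[OF
        that(2)]
      X.d1_gen[OF that(1)] X.d1_gen[OF that(2)] by (simp add: d1add \<phi>add \<psi>_def)
  have \<psi>smult: "\<psi> (a \<odot>\<^bsub>X.P0\<^esub> \<kappa>) = \<iota> a \<otimes> \<psi> \<kappa>" if "a \<in> carrier C" "\<kappa> \<in> X.K0" for a \<kappa>
    using \<psi>\<phi>[of "a \<odot>\<^bsub>X.P1\<^esub> free_gen C \<kappa>"] X.gen1_closed[OF that(2)]
      X.d1_gen[OF that(2)] that(1) by (simp add: d1smult \<phi>smult \<psi>_def)
  have \<psi>B: "\<psi> \<kappa> \<in> B" if "\<kappa> \<in> X.K0" for \<kappa> using \<phi>B X.gen1_closed[OF that] by (simp add: \<psi>_def)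
  have \<psi>L: "\<psi> \<kappa> \<in> carrier L" if "\<kappa> \<in> X.K0" for \<kappa> using \<psi>B[OF that] B.a_Hcarr by blast
  have K0add: "\<kappa> \<oplus>\<^bsub>X.P0\<^esub> \<mu> \<in> X.K0" if "\<kappa> \<in> X.K0" "\<mu> \<in> X.K0" for \<kappa> \<mu>
    using that by (simp add: d0add)
  have K0smult: "a \<odot>\<^bsub>X.P0\<^esub> \<kappa> \<in> X.K0" if "a \<in> carrier C" "\<kappa> \<in> X.K0" for a \<kappa>
    using that by (simp add: d0smult)
  let ?e = "free_gen C \<one>"
  have e: "?e \<in> carrier X.P0" "X.d0 ?e = \<one>" using X.gen0_closed X.d0_gen one_B by auto
  \<comment> \<open>A multiple \<open>a [1]\<close> is a relation when \<open>a\<close> dies in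
    \<open>L\<close>. Then a power of \<open>s\<close> kills \<open>a\<close>, and as
    \<open>s\<close> acts injectively on \<open>L\<close>, \<psi> vanishes there, in agreement with
    sending \<open>[1]\<close> to zero.\<close>
  have torsion: "a \<odot>\<^bsub>X.P0\<^esub> ?e \<in> X.K0" "\<psi> (a \<odot>\<^bsub>X.P0\<^esub> ?e) = \<zero>"
    if a: "a \<in> carrier C" "\<iota> a = \<zero>" for a
  proof -
    show K: "a \<odot>\<^bsub>X.P0\<^esub> ?e \<in> X.K0" using a e by (simp add: d0smult)
    obtain m :: nat where m: "s [^]\<^bsub>C\<^esub> m \<otimes>\<^bsub>C\<^esub> a = \<zero>\<^bsub>C\<^esub>" using kernel_torsion[OF a] by blast
    have "\<iota> (s [^]\<^bsub>C\<^esub> m) \<otimes> \<psi> (a \<odot>\<^bsub>X.P0\<^esub> ?e) = \<psi> (s [^]\<^bsub>C\<^esub> m \<odot>\<^bsub>X.P0\<^esub> (a \<odot>\<^bsub>X.P0\<^esub> ?e))"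
      by (rule \<psi>smult[symmetric, OF _ K]) simp
    also have "s [^]\<^bsub>C\<^esub> m \<odot>\<^bsub>X.P0\<^esub> (a \<odot>\<^bsub>X.P0\<^esub> ?e) = \<zero>\<^bsub>C\<^esub> \<odot>\<^bsub>X.P0\<^esub> (a \<odot>\<^bsub>X.P0\<^esub> ?e)"
      using P0.smult_assoc[of "s [^]\<^bsub>C\<^esub> m" a ?e] m a e by simp
    also have "\<psi> \<dots> = \<iota> \<zero>\<^bsub>C\<^esub> \<otimes> \<psi> (a \<odot>\<^bsub>X.P0\<^esub> ?e)" by (rule \<psi>smult[OF _ K]) simp
    also have "\<dots> = \<iota> (s [^]\<^bsub>C\<^esub> m) \<otimes> \<zero>" using \<psi>L[OF K] by simp
    finally show "\<psi> (a \<odot>\<^bsub>X.P0\<^esub> ?e) = \<zero>"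
      using s_pow_cancel[of "\<psi> (a \<odot>\<^bsub>X.P0\<^esub> ?e)" "\<zero>" m] \<psi>L[OF K] by simp
  qed
  \<comment> \<open>After multiplication by \<open>s^q\<close> and correction by
    \<open>c [1]\<close> the vector \<open>f\<close> is a relation, and \<open>v\<close> is the
    value that this forces at \<open>f\<close>.\<close>
  define good where "good f v q c \<longleftrightarrow> c \<in> carrier C \<and> s [^]\<^bsub>C\<^esub> q \<odot>\<^bsub>X.P0\<^esub> f \<oplus>\<^bsub>X.P0\<^esub> c \<odot>\<^bsub>X.P0\<^esub> ?e \<in>
      X.K0 \<and>
      \<iota> (s [^]\<^bsub>C\<^esub> q) \<otimes> v = \<psi> (s [^]\<^bsub>C\<^esub> q \<odot>\<^bsub>X.P0\<^esub> f \<oplus>\<^bsub>X.P0\<^esub> c \<odot>\<^bsub>X.P0\<^esub> ?e)" for f v c and q :: nat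
  have "\<exists>v\<in>carrier L. \<exists>q c. good (free_gen C m) v q c" if m: "m \<in> B" for m
  proof -
    obtain q :: nat and c where c: "c \<in> carrier C" "\<iota> (s [^]\<^bsub>C\<^esub> q) \<otimes> m = \<iota> c"
      using denominator m B.a_Hcarr by metis
    let ?\<kappa> = "s [^]\<^bsub>C\<^esub> q \<odot>\<^bsub>X.P0\<^esub> free_gen C m \<oplus>\<^bsub>X.P0\<^esub> (\<ominus>\<^bsub>C\<^esub> c) \<odot>\<^bsub>X.P0\<^esub> ?e"
    have gm: "free_gen C m \<in> carrier X.P0" "X.d0 (free_gen C m) = m" using X.gen0_closed X.d0_gen
        m by auto
    have K: "?\<kappa> \<in> X.K0" using gm e c by (simp add: d0add d0smult S.r_neg)
    obtain w where w: "w \<in> carrier L" "\<iota> (s [^]\<^bsub>C\<^esub> q) \<otimes> w = \<one>"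
      using s_pow_unit[of q] unfolding Units_def by blast
    have "\<iota> (s [^]\<^bsub>C\<^esub> q) \<otimes> (w \<otimes> \<psi> ?\<kappa>) = \<psi> ?\<kappa>"
      using w \<psi>L[OF K] by (simp add: S.m_assoc[symmetric] del: hom_nat_pow)
    then have "good (free_gen C m) (w \<otimes> \<psi> ?\<kappa>) q (\<ominus>\<^bsub>C\<^esub> c)" using K c unfolding good_def by simp
    then show ?thesis using w \<psi>L[OF K] by blast
  qed
  then obtain \<gamma> where \<gamma>: "\<And>m. m \<in> B \<Longrightarrow> \<gamma> m \<in> carrier L \<and> (\<exists>q c. good (free_gen C m) (\<gamma> m) q c)" by
      metis
  have \<gamma>L: "\<gamma> \<in> B \<rightarrow> carrier L" using \<gamma> by blast
  let ?G = "lin_ext C LM \<gamma>"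
  have P0: "X.P0 = free_lmod C B" by (simp add: res0_def)
  have G: "lmod_map C X.P0 LM ?G" unfolding P0 by (rule LM.lin_ext_lmod_map) (use \<gamma>L in simp)
  have GL: "?G f \<in> carrier L" if "f \<in> carrier X.P0" for f using G that by (auto simp: lmod_map_def)
  have Ggood: "\<exists>q c. good f (?G f) q c" if f: "f \<in> carrier X.P0" for f
    using f unfolding P0
  proof (induction f rule: R.free_lmod_induct)
    case zero
    have z: "(\<lambda>_. \<zero>\<^bsub>C\<^esub>) = \<zero>\<^bsub>X.P0\<^esub>" by (simp add: P0 free_lmod_simps)
    have "?G \<zero>\<^bsub>X.P0\<^esub> = \<zero>" using lmod_map_zero[OF X.res_left_module(1) left_module_LM G] by simp
    moreover have "X.d0 \<zero>\<^bsub>X.P0\<^esub> = \<zero>" using lmod_map_zero[OF X.res_left_module(1) left_module_BM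
        X.d0_map] by simp
    ultimately have "good \<zero>\<^bsub>X.P0\<^esub> (?G \<zero>\<^bsub>X.P0\<^esub>) 0 \<zero>\<^bsub>C\<^esub>"
      unfolding good_def using torsion(2)[of "\<zero>\<^bsub>C\<^esub>"] e by simp
    then show ?case unfolding z by blast
  next
    case (add f g)
    obtain q c q' c' where fg: "good f (?G f) q c" "good g (?G g) q' c'" using add by blast
    have car: "f \<in> carrier X.P0" "g \<in> carrier X.P0" using add P0 by auto
    \<comment> \<open>Denominators are multiplied: the relation for the sum is \<open>?s'\<close>
      times the first plus \<open>?s\<close> times the second.\<close>
    let ?s = "s [^]\<^bsub>C\<^esub> q" and ?s' = "s [^]\<^bsub>C\<^esub> q'"
    let ?\<kappa> = "?s \<odot>\<^bsub>X.P0\<^esub> f \<oplus>\<^bsub>X.P0\<^esub> c \<odot>\<^bsub>X.P0\<^esub> ?e" and ?\<kappa>' = "?s' \<odot>\<^bsub>X.P0\<^esub> g \<oplus>\<^bsub>X.P0\<^esub> c' \<odot>\<^bsub>X.P0\<^esub> ?e"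
    have cc: "c \<in> carrier C" "c' \<in> carrier C" "?s \<in> carrier C" "?s' \<in> carrier C" using fg by (auto
        simp: good_def)
    have K: "?\<kappa> \<in> X.K0" "?\<kappa>' \<in> X.K0" using fg by (simp_all only: good_def)
    have v: "\<iota> ?s \<otimes> ?G f = \<psi> ?\<kappa>" "\<iota> ?s' \<otimes> ?G g = \<psi> ?\<kappa>'" using fg by (simp_all only: good_def)
    have sum: "(\<lambda>b. f b \<oplus>\<^bsub>C\<^esub> g b) = f \<oplus>\<^bsub>X.P0\<^esub> g" by (simp add: P0 free_lmod_simps)
    have s2: "s [^]\<^bsub>C\<^esub> (q + q') = ?s' \<otimes>\<^bsub>C\<^esub> ?s" "?s' \<otimes>\<^bsub>C\<^esub> ?s = ?s \<otimes>\<^bsub>C\<^esub> ?s'"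
      by (simp_all add: R.nat_pow_mult add.commute)
    let ?cn = "?s' \<otimes>\<^bsub>C\<^esub> c \<oplus>\<^bsub>C\<^esub> ?s \<otimes>\<^bsub>C\<^esub> c'"
    have "(?s' \<otimes>\<^bsub>C\<^esub> ?s) \<odot>\<^bsub>X.P0\<^esub> (f \<oplus>\<^bsub>X.P0\<^esub> g) = ?s' \<odot>\<^bsub>X.P0\<^esub> (?s \<odot>\<^bsub>X.P0\<^esub> f) \<oplus>\<^bsub>X.P0\<^esub> ?s \<odot>\<^bsub>X.P0\<^esub> (?s'
        \<odot>\<^bsub>X.P0\<^esub> g)"
      using car cc P0.smult_r_distr[of "?s' \<otimes>\<^bsub>C\<^esub> ?s" f g] P0.smult_assoc[of ?s' ?s f]
          P0.smult_assoc[of ?s ?s' g]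
      by (simp add: s2(2))
    moreover have "?cn \<odot>\<^bsub>X.P0\<^esub> ?e = ?s' \<odot>\<^bsub>X.P0\<^esub> (c \<odot>\<^bsub>X.P0\<^esub> ?e) \<oplus>\<^bsub>X.P0\<^esub> ?s \<odot>\<^bsub>X.P0\<^esub> (c' \<odot>\<^bsub>X.P0\<^esub> ?e)"
      using e cc P0.smult_l_distr[of "?s' \<otimes>\<^bsub>C\<^esub> c" "?s \<otimes>\<^bsub>C\<^esub> c'" ?e] P0.smult_assoc[of ?s' c ?e]
          P0.smult_assoc[of ?s c' ?e]
      by simp
    ultimately have \<kappa>n: "s [^]\<^bsub>C\<^esub> (q + q') \<odot>\<^bsub>X.P0\<^esub> (f \<oplus>\<^bsub>X.P0\<^esub> g) \<oplus>\<^bsub>X.P0\<^esub> ?cn \<odot>\<^bsub>X.P0\<^esub> ?e =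
       ?s' \<odot>\<^bsub>X.P0\<^esub> ?\<kappa> \<oplus>\<^bsub>X.P0\<^esub> ?s \<odot>\<^bsub>X.P0\<^esub> ?\<kappa>'"
      unfolding s2(1) using car cc e by (simp add: P0.smult_r_distr P0.M.add.m_ac)
    have K': "?s' \<odot>\<^bsub>X.P0\<^esub> ?\<kappa> \<in> X.K0" "?s \<odot>\<^bsub>X.P0\<^esub> ?\<kappa>' \<in> X.K0" by (rule K0smult[OF cc(4) K(1)], rule
        K0smult[OF cc(3) K(2)])
    have "\<iota> (s [^]\<^bsub>C\<^esub> (q + q')) \<otimes> ?G (f \<oplus>\<^bsub>X.P0\<^esub> g) = (\<iota> ?s' \<otimes> \<iota> ?s) \<otimes> ?G f \<oplus> (\<iota> ?s \<otimes> \<iota> ?s') \<otimes> ?G g"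
    proof -
      have "?G (f \<oplus>\<^bsub>X.P0\<^esub> g) = ?G f \<oplus> ?G g" using G car by (simp add: lmod_map_def)
      moreover have "\<iota> (s [^]\<^bsub>C\<^esub> (q + q')) = \<iota> ?s' \<otimes> \<iota> ?s" "\<iota> ?s' \<otimes> \<iota> ?s = \<iota> ?s \<otimes> \<iota> ?s'"
        using s2 cc by (metis hom_mult)+
      ultimately show ?thesis using GL car cc by (metis S.r_distr S.m_closed hom_closed)
    qed
    also have "\<dots> = \<iota> ?s' \<otimes> \<psi> ?\<kappa> \<oplus> \<iota> ?s \<otimes> \<psi> ?\<kappa>'"
      unfolding v[symmetric] using GL car cc by (metis S.m_assoc hom_closed)
    also have "\<dots> = \<psi> (?s' \<odot>\<^bsub>X.P0\<^esub> ?\<kappa> \<oplus>\<^bsub>X.P0\<^esub> ?s \<odot>\<^bsub>X.P0\<^esub> ?\<kappa>')"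
      unfolding \<psi>add[OF K'] \<psi>smult[OF cc(4) K(1)] \<psi>smult[OF cc(3) K(2)] ..
    finally have "good (f \<oplus>\<^bsub>X.P0\<^esub> g) (?G (f \<oplus>\<^bsub>X.P0\<^esub> g)) (q + q') ?cn"
      unfolding good_def \<kappa>n using K0add[OF K'] cc by blast
    then show ?case unfolding sum by blast
  next
    case (gen a b)
    obtain q c where b: "good (free_gen C b) (\<gamma> b) q c" using \<gamma> gen by blast
    have gb: "free_gen C b \<in> carrier X.P0" using X.gen0_closed gen by simp
    have Gb: "?G (free_gen C b) = \<gamma> b" by (rule LM.lin_ext_gen[OF gen(2)]) (use \<gamma>L in simp)
    let ?s = "s [^]\<^bsub>C\<^esub> q"
    let ?\<kappa> = "?s \<odot>\<^bsub>X.P0\<^esub> free_gen C b \<oplus>\<^bsub>X.P0\<^esub> c \<odot>\<^bsub>X.P0\<^esub> ?e"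
    have K: "?\<kappa> \<in> X.K0" and cc: "c \<in> carrier C" "?s \<in> carrier C" and v: "\<iota> ?s \<otimes> \<gamma> b = \<psi> ?\<kappa>"
      using b by (simp_all only: good_def) simp
    have eq: "(\<lambda>c. a \<otimes>\<^bsub>C\<^esub> free_gen C b c) = a \<odot>\<^bsub>X.P0\<^esub> free_gen C b" by (simp add: P0
        free_lmod_simps)
    have \<kappa>n: "?s \<odot>\<^bsub>X.P0\<^esub> (a \<odot>\<^bsub>X.P0\<^esub> free_gen C b) \<oplus>\<^bsub>X.P0\<^esub> (a \<otimes>\<^bsub>C\<^esub> c) \<odot>\<^bsub>X.P0\<^esub> ?e = a \<odot>\<^bsub>X.P0\<^esub> ?\<kappa>"
      using gen(1) cc gb e P0.smult_assoc[of ?s a "free_gen C b"] P0.smult_assoc[of a ?s "free_gen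
          C b"]
        s_pow_comm[of a q] by (simp add: P0.smult_r_distr P0.smult_assoc)
    have "?G (a \<odot>\<^bsub>X.P0\<^esub> free_gen C b) = \<iota> a \<otimes> \<gamma> b" using G gb gen(1) Gb by (simp add: lmod_map_def)
    moreover have "\<iota> ?s \<otimes> (\<iota> a \<otimes> \<gamma> b) = \<iota> a \<otimes> (\<iota> ?s \<otimes> \<gamma> b)"
    proof -
      have "\<gamma> b \<in> carrier L" using \<gamma> gen by blast
      moreover have "\<iota> ?s \<otimes> \<iota> a = \<iota> a \<otimes> \<iota> ?s" using s_pow_comm[of a q] gen(1) cc by (metis hom_mult)
      ultimately show ?thesis using gen(1) cc by (metis S.m_assoc hom_closed)
    qed
    ultimately have "good (a \<odot>\<^bsub>X.P0\<^esub> free_gen C b) (?G (a \<odot>\<^bsub>X.P0\<^esub> free_gen C b)) q (a \<otimes>\<^bsub>C\<^esub> c)"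
      unfolding good_def \<kappa>n using K0smult[OF gen(1) K] \<psi>smult[OF gen(1) K] v gen(1) cc by simp
    then show ?case unfolding eq by blast
  qed
  have G\<psi>: "?G \<kappa> = \<psi> \<kappa>" if \<kappa>: "\<kappa> \<in> X.K0" for \<kappa>
  proof -
    \<comment> \<open>Both \<kappa> and its corrected multiple are relations, so the correction
      \<open>c [1]\<close> is one too, and by \<open>torsion\<close> it contributes nothing.\<close>
    obtain q c where g: "good \<kappa> (?G \<kappa>) q c" using Ggood \<kappa> by blast
    let ?s = "s [^]\<^bsub>C\<^esub> q"
    have cc: "c \<in> carrier C" "?s \<in> carrier C" using g by (auto simp: good_def)
    have sK: "?s \<odot>\<^bsub>X.P0\<^esub> \<kappa> \<in> X.K0" by (rule K0smult[OF cc(2) \<kappa>])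
    have "X.d0 (?s \<odot>\<^bsub>X.P0\<^esub> \<kappa> \<oplus>\<^bsub>X.P0\<^esub> c \<odot>\<^bsub>X.P0\<^esub> ?e) = \<iota> c"
      using sK cc e by (simp add: d0add d0smult)
    moreover have "X.d0 (?s \<odot>\<^bsub>X.P0\<^esub> \<kappa> \<oplus>\<^bsub>X.P0\<^esub> c \<odot>\<^bsub>X.P0\<^esub> ?e) = \<zero>" using g by (simp add: good_def)
    ultimately have "\<iota> c = \<zero>" by simp
    note t = torsion[OF cc(1) this]
    have "\<iota> ?s \<otimes> ?G \<kappa> = \<psi> (?s \<odot>\<^bsub>X.P0\<^esub> \<kappa> \<oplus>\<^bsub>X.P0\<^esub> c \<odot>\<^bsub>X.P0\<^esub> ?e)" using g by (simp only: good_def)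
    also have "\<dots> = \<iota> ?s \<otimes> \<psi> \<kappa>"
      unfolding \<psi>add[OF sK t(1)] t(2) \<psi>smult[OF cc(2) \<kappa>] using \<psi>L[OF \<kappa>] cc by simp
    finally show ?thesis using s_pow_cancel GL \<psi>L[OF \<kappa>] \<kappa> by blast
  qed
  show thesis
  proof (rule that[OF \<gamma>L])
    show "\<phi> u = ?G (X.d1 u)" if "u \<in> carrier X.P1" for u using \<psi>\<phi>[OF that] G\<psi>[OF dK[OF that]] by
        simp
    show "?G \<kappa> \<in> B" if "\<kappa> \<in> X.K0" for \<kappa> using G\<psi>[OF that] \<psi>B[OF that] by simp
  qed
qed

text \<open>The extended cocycle is given by values \<open>\<gamma> m\<close> in \<open>L\<close>,
  and these are linear modulo \<open>B\<close> because relations go into \<open>B\<close>.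
  Subtracting the right multiplication supplied by the lift moves all values into \<open>B\<close>
  without changing the cochain, since \<open>d0 d1 = 0\<close>.\<close>

lemma lift_imp_rigid:
  assumes lift: "\<And>H. hom_mod_B H \<Longrightarrow> \<exists>z\<in>carrier L. \<forall>u\<in>B. H u \<ominus> u \<otimes> z \<in> B"
  shows "rigid C BM"
  unfolding rigid_def X.trivial_Ext1_iff
proof
  fix \<phi> assume \<phi>: "\<phi> \<in> ext1_cocycles C BM BM"
  interpret LM: left_module C LM by (rule left_module_LM)
  interpret P0: left_module C X.P0 by (rule X.res_left_module)
  obtain \<gamma> where \<gamma>L: "\<gamma> \<in> B \<rightarrow> carrier L"
    and \<phi>\<gamma>: "\<And>u. u \<in> carrier X.P1 \<Longrightarrow> \<phi> u = lin_ext C LM \<gamma> (X.d1 u)"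
    and GB: "\<And>\<kappa>. \<kappa> \<in> X.K0 \<Longrightarrow> lin_ext C LM \<gamma> \<kappa> \<in> B"
    using cocycle_extends[OF \<phi>] by blast
  let ?G = "lin_ext C LM \<gamma>" and ?\<delta> = "free_gen C :: 'l \<Rightarrow> _"
  have P0: "X.P0 = free_lmod C B" by (simp add: res0_def)
  have G: "lmod_map C X.P0 LM ?G" unfolding P0 by (rule LM.lin_ext_lmod_map) (use \<gamma>L in simp)
  have G\<delta>: "?G (?\<delta> m) = \<gamma> m" if "m \<in> B" for m by (rule LM.lin_ext_gen[OF that]) (use \<gamma>L in simp)
  have \<gamma>c: "\<gamma> m \<in> carrier L" if "m \<in> B" for m using \<gamma>L that by blast
  have \<delta>: "?\<delta> m \<in> carrier X.P0" "X.d0 (?\<delta> m) = m" if "m \<in> B" for m using X.gen0_closed X.d0_gen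
      that by auto
  let ?m = "\<ominus>\<^bsub>C\<^esub> \<one>\<^bsub>C\<^esub>"
  have lin3: "h (x \<oplus>\<^bsub>X.P0\<^esub> ?m \<odot>\<^bsub>X.P0\<^esub> y) = h x \<ominus> h y"
    if "lmod_map C X.P0 (sub_lmod L \<iota> S) h" "S \<subseteq> carrier L" "x \<in> carrier X.P0" "y \<in> carrier X.P0"
        for h x y S
  proof -
    have "h y \<in> carrier L" using that by (auto simp: lmod_map_def)
    then show ?thesis using that by (simp add: lmod_map_def a_minus_def S.l_minus)
  qed
  have add: "h (x \<oplus>\<^bsub>X.P0\<^esub> y) = h x \<oplus> h y"
    if "lmod_map C X.P0 (sub_lmod L \<iota> S) h" "x \<in> carrier X.P0" "y \<in> carrier X.P0" for h x y S
    using that by (simp add: lmod_map_def)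
  have smult: "h (a \<odot>\<^bsub>X.P0\<^esub> y) = \<iota> a \<otimes> h y"
    if "lmod_map C X.P0 (sub_lmod L \<iota> S) h" "a \<in> carrier C" "y \<in> carrier X.P0" for h a y S
    using that by (simp add: lmod_map_def)
  have BL: "B \<subseteq> carrier L" by (rule B.a_subset)
  have "hom_mod_B \<gamma>"
    unfolding hom_mod_B_def
  proof (intro conjI ballI \<gamma>L)
    fix u v assume u: "u \<in> B" and v: "v \<in> B"
    then have uv: "u \<oplus> v \<in> B" by simp
    let ?\<kappa> = "?\<delta> (u \<oplus> v) \<oplus>\<^bsub>X.P0\<^esub> ?m \<odot>\<^bsub>X.P0\<^esub> (?\<delta> u \<oplus>\<^bsub>X.P0\<^esub> ?\<delta> v)"
    have "X.d0 ?\<kappa> = (u \<oplus> v) \<ominus> (u \<oplus> v)"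
      by (simp only: lin3[OF X.d0_map BL \<delta>(1)[OF uv] P0.M.a_closed[OF \<delta>(1)[OF u] \<delta>(1)[OF v]]]
          add[OF X.d0_map \<delta>(1)[OF u] \<delta>(1)[OF v]] \<delta>(2)[OF u] \<delta>(2)[OF v] \<delta>(2)[OF uv])
    then have "?\<kappa> \<in> X.K0" using \<delta> u v uv B.a_Hcarr by (simp add: a_minus_def S.r_neg)
    then have "?G ?\<kappa> \<in> B" by (rule GB)
    then show "\<gamma> (u \<oplus> v) \<ominus> (\<gamma> u \<oplus> \<gamma> v) \<in> B"
      by (simp only: lin3[OF G subset_refl \<delta>(1)[OF uv] P0.M.a_closed[OF \<delta>(1)[OF u] \<delta>(1)[OF v]]]
          add[OF G \<delta>(1)[OF u] \<delta>(1)[OF v]] G\<delta>[OF u] G\<delta>[OF v] G\<delta>[OF uv])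
  next
    fix a u assume a: "a \<in> carrier C" and u: "u \<in> B"
    then have au: "\<iota> a \<otimes> u \<in> B" by (rule smult_B)
    let ?\<kappa> = "?\<delta> (\<iota> a \<otimes> u) \<oplus>\<^bsub>X.P0\<^esub> ?m \<odot>\<^bsub>X.P0\<^esub> (a \<odot>\<^bsub>X.P0\<^esub> ?\<delta> u)"
    have "X.d0 ?\<kappa> = (\<iota> a \<otimes> u) \<ominus> (\<iota> a \<otimes> u)"
      by (simp only: lin3[OF X.d0_map BL \<delta>(1)[OF au] P0.smult_closed[OF a \<delta>(1)[OF u]]]
          smult[OF X.d0_map a \<delta>(1)[OF u]] \<delta>(2)[OF u] \<delta>(2)[OF au])
    then have "?\<kappa> \<in> X.K0" using \<delta> a u au B.a_Hcarr by (simp add: a_minus_def S.r_neg)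
    then have "?G ?\<kappa> \<in> B" by (rule GB)
    then show "\<gamma> (\<iota> a \<otimes> u) \<ominus> \<iota> a \<otimes> \<gamma> u \<in> B"
      by (simp only: lin3[OF G subset_refl \<delta>(1)[OF au] P0.smult_closed[OF a \<delta>(1)[OF u]]]
          smult[OF G a \<delta>(1)[OF u]] G\<delta>[OF u] G\<delta>[OF au])
  qed
  then obtain z where z: "z \<in> carrier L" "\<And>u. u \<in> B \<Longrightarrow> \<gamma> u \<ominus> u \<otimes> z \<in> B" using lift by blast
  define g where "g = lin_ext C BM (\<lambda>m. \<gamma> m \<ominus> m \<otimes> z)"
  have g: "lmod_map C X.P0 BM g" unfolding g_def P0 by (rule left_module.lin_ext_lmod_map[OF
      left_module_BM]) (use z in simp)
  have g\<delta>: "g (?\<delta> m) = \<gamma> m \<ominus> m \<otimes> z" if "m \<in> B" for m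
    unfolding g_def by (rule left_module.lin_ext_gen[OF left_module_BM that]) (use z in simp)
  have geq: "g f = ?G f \<ominus> X.d0 f \<otimes> z" if f: "f \<in> carrier X.P0" for f
  proof -
    have "lmod_map C X.P0 LM (\<lambda>f. ?G f \<ominus> X.d0 f \<otimes> z)"
      unfolding lmod_map_def
    proof (intro conjI ballI)
      have Gc: "?G x \<in> carrier L" "X.d0 x \<in> carrier L" if "x \<in> carrier X.P0" for x
        using G X.d0_map that BL by (auto simp: lmod_map_def Pi_iff)
      show "(\<lambda>f. ?G f \<ominus> X.d0 f \<otimes> z) \<in> carrier X.P0 \<rightarrow> carrier LM" using Gc z by simp
      fix x assume x: "x \<in> carrier X.P0"
      { fix y assume y: "y \<in> carrier X.P0"
        have "?G x \<oplus> ?G y \<ominus> (X.d0 x \<oplus> X.d0 y) \<otimes> z =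
          (?G x \<ominus> X.d0 x \<otimes> z) \<oplus> (?G y \<ominus> X.d0 y \<otimes> z)"
          using Gc[OF x] Gc[OF y] z(1) by algebra
        then show "?G (x \<oplus>\<^bsub>X.P0\<^esub> y) \<ominus> X.d0 (x \<oplus>\<^bsub>X.P0\<^esub> y) \<otimes> z =
          (?G x \<ominus> X.d0 x \<otimes> z) \<oplus>\<^bsub>LM\<^esub> (?G y \<ominus> X.d0 y \<otimes> z)"
          using add[OF G x y] add[OF X.d0_map x y] by simp }
      fix a assume a: "a \<in> carrier C"
      then have "\<iota> a \<in> carrier L" by simp
      then have "\<iota> a \<otimes> ?G x \<ominus> (\<iota> a \<otimes> X.d0 x) \<otimes> z = \<iota> a \<otimes> (?G x \<ominus> X.d0 x \<otimes> z)"
        using Gc[OF x] z(1) by algebra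
      then show "?G (a \<odot>\<^bsub>X.P0\<^esub> x) \<ominus> X.d0 (a \<odot>\<^bsub>X.P0\<^esub> x) \<otimes> z = a \<odot>\<^bsub>LM\<^esub> (?G x \<ominus> X.d0 x \<otimes> z)"
        using smult[OF G a x] smult[OF X.d0_map a x] by simp
    qed
    then show ?thesis
      using LM.lmod_map_free_eqI[of B g "\<lambda>f. ?G f \<ominus> X.d0 f \<otimes> z" f] lmod_map_comp[OF g incl_map] f
          G\<delta> g\<delta> \<delta> by (simp add: P0)
  qed
  have "\<phi> = restrict (\<lambda>u. restrict g (carrier X.P0) (X.d1 u)) (carrier X.P1)"
  proof (rule lmod_hom_eqI[of \<phi> C X.P1 BM])
    show "\<phi> \<in> lmod_hom C X.P1 BM" using \<phi> unfolding X.cocycles_iff by blast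
    have rg: "lmod_map C X.P0 BM (restrict g (carrier X.P0))" by (rule lmod_homD[OF
        restrict_lmod_hom[OF X.res_left_module(1) g]])
    show "restrict (\<lambda>u. restrict g (carrier X.P0) (X.d1 u)) (carrier X.P1) \<in> lmod_hom C X.P1 BM"
      by (rule restrict_lmod_hom[OF X.res_left_module(2) lmod_map_comp[OF X.d1_map rg]])
    fix u assume u: "u \<in> carrier X.P1"
    then have du: "X.d1 u \<in> carrier X.P0" using X.d1_map by (auto simp: lmod_map_def)
    have "?G (X.d1 u) \<in> carrier L" using G du by (auto simp: lmod_map_def)
    \<comment> \<open>The term with \<open>z\<close> is evaluated at \<open>d0 (d1 u)\<close>, which
      is zero.\<close>
    then have "g (X.d1 u) = ?G (X.d1 u)" using geq[OF du] X.d0_d1[OF u] z(1) by (simp add: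
        a_minus_def)
    then show "\<phi> u = restrict (\<lambda>u. restrict g (carrier X.P0) (X.d1 u)) (carrier X.P1) u"
      using u du \<phi>\<gamma> by simp
  qed
  then show "\<phi> \<in> ext1_coboundaries C BM BM"
    unfolding ext1_coboundaries_def using restrict_lmod_hom[OF X.res_left_module(1) g] by blast
qed

end

section \<open>Path algebras\<close>

lemma path_end_Nil [simp]: "path_end Q (u, []) = u"
  by (simp add: path_end_def pre_digraph.awalk_verts.simps)

lemma path_end_Cons [simp]: "path_end Q (u, e # w) = path_end Q (head Q e, w)"
  by (cases w) (simp_all add: path_end_def pre_digraph.awalk_verts.simps)

lemma path_end_append: "path_end Q (u, a @ b) = path_end Q (path_end Q (u, a), b)"
  by (induction a arbitrary: u) simp_all

context wf_digraph
begin

lemma qpaths_Nil [simp]: "(u, []) \<in> qpaths G \<longleftrightarrow> u \<in> verts G"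
  by (simp add: qpaths_def awalk_def)

lemma qpaths_Cons: "(u, e # w) \<in> qpaths G \<longleftrightarrow> e \<in> arcs G \<and> u = tail G e \<and> (head G e, w) \<in> qpaths G"
  by (simp add: qpaths_def awalk_Cons_iff)

lemma qpaths_verts: "(u, w) \<in> qpaths G \<Longrightarrow> u \<in> verts G"
  by (simp add: qpaths_def awalk_def)

lemma qpaths_append: "(u, a @ b) \<in> qpaths G \<longleftrightarrow> (u, a) \<in> qpaths G \<and> (path_end G (u, a), b) \<in> qpaths G"
  by (induction a arbitrary: u) (use qpaths_verts in \<open>auto simp: qpaths_Cons\<close>)

lemma path_end_verts: "(u, w) \<in> qpaths G \<Longrightarrow> path_end G (u, w) \<in> verts G"
  using qpaths_append[of u w "[]"] by simp

end

lemma path_algebra_simps: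
  "f \<in> carrier (path_algebra Q) \<longleftrightarrow> finite {p. f p \<noteq> 0} \<and> {p. f p \<noteq> 0} \<subseteq> qpaths Q"
  "(f \<otimes>\<^bsub>path_algebra Q\<^esub> g) (u, w) =
     (\<Sum>j\<le>length w. f (path_end Q (u, take j w), drop j w) * g (u, take j w))"
  "\<one>\<^bsub>path_algebra Q\<^esub> (u, w) = (if u \<in> verts Q \<and> w = [] then 1 else 0)"
  "\<zero>\<^bsub>path_algebra Q\<^esub> = (\<lambda>_. 0)"
  "f \<oplus>\<^bsub>path_algebra Q\<^esub> g = (\<lambda>p. f p + g p)"
  by (simp_all add: path_algebra_def)

text \<open>Both sums run over pairs of cuts of a word of length \<open>N\<close>: on the left by
  the first cut and the distance to the second, on the right by the second cut and then the
  first.\<close>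

lemma sum_triangle_swap:
  fixes A :: "nat \<Rightarrow> nat \<Rightarrow> 'a::comm_monoid_add"
  shows "(\<Sum>j\<le>N. \<Sum>i\<le>N - j. A i j) = (\<Sum>m\<le>N. \<Sum>j\<le>m. A (m - j) j)"
proof -
  have "(\<Sum>j\<le>N. \<Sum>i\<le>N - j. A i j) = (\<Sum>(j, i)\<in>(SIGMA j:{..N}. {..N - j}). A i j)"
    by (simp add: sum.Sigma)
  also have "\<dots> = (\<Sum>(m, j)\<in>(SIGMA m:{..N}. {..m}). A (m - j) j)"
    by (rule sum.reindex_bij_witness[where i = "\<lambda>(m, j). (j, m - j)" and j = "\<lambda>(j, i). (i + j,
        j)"]) auto
  also have "\<dots> = (\<Sum>m\<le>N. \<Sum>j\<le>m. A (m - j) j)"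
    by (simp add: sum.Sigma)
  finally show ?thesis .
qed

text \<open>Both bracketings sum over all ways to cut a path twice. A path has finitely many cuts,
  so this holds for arbitrary coefficient functions; finite support matters only for
  closure.\<close>

lemma path_algebra_mult_assoc:
  "(f \<otimes>\<^bsub>path_algebra Q\<^esub> g) \<otimes>\<^bsub>path_algebra Q\<^esub> h = f \<otimes>\<^bsub>path_algebra Q\<^esub> (g \<otimes>\<^bsub>path_algebra Q\<^esub> h)"
    (is "?l = ?r")
proof (rule ext, clarify)
  fix u w
  let ?A = "\<lambda>i j. f (path_end Q (u, take (i + j) w), drop (i + j) w) *
      (g (path_end Q (u, take j w), take i (drop j w)) * h (u, take j w))"
  have "?l (u, w) = (\<Sum>j\<le>length w. \<Sum>i\<le>length w - j. ?A i j)"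
    by (auto simp: path_algebra_simps sum_distrib_right mult.assoc path_end_append[symmetric]
        add.commute
        take_add intro!: sum.cong)
  also have "\<dots> = (\<Sum>m\<le>length w. \<Sum>j\<le>m. ?A (m - j) j)" by (rule sum_triangle_swap)
  also have "\<dots> = ?r (u, w)"
    by (auto simp: path_algebra_simps sum_distrib_left min_absorb2 take_drop intro!: sum.cong)
  finally show "?l (u, w) = ?r (u, w)" .
qed

lemma path_algebra_mult_closed:
  fixes f g :: "('v, 'e) qpath \<Rightarrow> 'r::comm_ring_1"
  assumes "wf_digraph Q" and f: "f \<in> carrier (path_algebra Q)" and g: "g \<in> carrier (path_algebra Q)"
  shows "f \<otimes>\<^bsub>path_algebra Q\<^esub> g \<in> carrier (path_algebra Q)"
proof -
  interpret wf_digraph Q by fact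
  let ?S = "{(p, q). f p \<noteq> 0 \<and> g q \<noteq> 0 \<and> fst p = path_end Q q}"
  let ?c = "\<lambda>(p, q). (fst q, snd q @ snd p)"
  have "?S \<subseteq> {p. f p \<noteq> 0} \<times> {q. g q \<noteq> 0}" by auto
  then have "finite ?S" using f g by (simp add: path_algebra_simps finite_subset)
  moreover have "?c ` ?S \<subseteq> qpaths Q" using f g by (auto simp: path_algebra_simps qpaths_append)
  moreover have "{p. (f \<otimes>\<^bsub>path_algebra Q\<^esub> g) p \<noteq> 0} \<subseteq> ?c ` ?S"
  proof clarify
    fix u w assume "(f \<otimes>\<^bsub>path_algebra Q\<^esub> g) (u, w) \<noteq> 0"
    then obtain j where "f (path_end Q (u, take j w), drop j w) * g (u, take j w) \<noteq> 0"
      unfolding path_algebra_simps by (meson sum.neutral)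
    then have "((path_end Q (u, take j w), drop j w), (u, take j w)) \<in> ?S" by auto
    then show "(u, w) \<in> ?c ` ?S" by (rule rev_image_eqI) simp
  qed
  ultimately show ?thesis unfolding path_algebra_simps by (meson finite_imageI finite_subset
      subset_trans)
qed

lemma path_algebra_add_closed:
  fixes f g :: "('v, 'e) qpath \<Rightarrow> 'r::comm_ring_1"
  assumes f: "f \<in> carrier (path_algebra Q)" and g: "g \<in> carrier (path_algebra Q)"
  shows "(\<lambda>p. f p + g p) \<in> carrier (path_algebra Q)"
proof -
  have "{p. f p + g p \<noteq> 0} \<subseteq> {p. f p \<noteq> 0} \<union> {p. g p \<noteq> 0}" by auto
  moreover have "finite ({p. f p \<noteq> 0} \<union> {p. g p \<noteq> 0})" using f g by (simp add: path_algebra_simps)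
  ultimately show ?thesis using f g unfolding path_algebra_simps by (meson Un_least finite_subset
      subset_trans)
qed

lemma path_algebra_scale_closed:
  fixes f :: "('v, 'e) qpath \<Rightarrow> 'r::comm_ring_1"
  assumes f: "f \<in> carrier (path_algebra Q)"
  shows "(\<lambda>p. r * f p) \<in> carrier (path_algebra Q)"
proof -
  have "{p. r * f p \<noteq> 0} \<subseteq> {p. f p \<noteq> 0}" by auto
  then show ?thesis using f unfolding path_algebra_simps by (meson finite_subset subset_trans)
qed

lemma path_elem_closed: "p \<in> qpaths Q \<Longrightarrow> path_elem p \<in> carrier (path_algebra Q)"
  by (auto simp: path_algebra_simps path_elem_def intro: finite_subset[of _ "{p}"])

lemma path_algebra_one_closed:
  assumes "finite (verts Q)" "wf_digraph Q"
  shows "(\<one>\<^bsub>path_algebra Q\<^esub> :: ('v, 'e) qpath \<Rightarrow> 'r::comm_ring_1) \<in> carrier (path_algebra Q)"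
proof -
  have "{p. (\<one>\<^bsub>path_algebra Q\<^esub> :: ('v, 'e) qpath \<Rightarrow> 'r) p \<noteq> 0} \<subseteq> (\<lambda>u. (u, [])) ` verts Q"
    by (auto simp: path_algebra_simps split: if_splits)
  moreover have "(\<lambda>u. (u, [])) ` verts Q \<subseteq> qpaths Q" using wf_digraph.qpaths_Nil[OF assms(2)] by
      auto
  ultimately show ?thesis unfolding path_algebra_simps using assms(1) by (meson finite_imageI
      finite_subset subset_trans)
qed

lemma path_algebra_ring:
  assumes fin: "finite (verts Q)" and wf: "wf_digraph Q"
  shows "ring (path_algebra Q :: (('v, 'e) qpath \<Rightarrow> 'r::comm_ring_1) ring)" (is "ring ?P")
proof (rule ringI)
  show "abelian_group ?P"
  proof (rule abelian_groupI)
    fix f assume f: "f \<in> carrier ?P"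
    have "(\<lambda>p. - 1 * f p) \<oplus>\<^bsub>?P\<^esub> f = \<zero>\<^bsub>?P\<^esub>" by (simp add: path_algebra_simps)
    then show "\<exists>g\<in>carrier ?P. g \<oplus>\<^bsub>?P\<^esub> f = \<zero>\<^bsub>?P\<^esub>" using path_algebra_scale_closed[OF f] by blast
  qed (use path_algebra_add_closed in \<open>auto simp: path_algebra_simps(4,5) add.assoc add.commute\<close>,
      simp add: path_algebra_simps(1))
  show "monoid ?P"
  proof (rule monoidI)
    fix f assume f: "f \<in> carrier ?P"
    have 1: "(\<one>\<^bsub>?P\<^esub> \<otimes>\<^bsub>?P\<^esub> f) (u, w) = f (u, w)" for u w
    proof -
      have "(\<one>\<^bsub>?P\<^esub> \<otimes>\<^bsub>?P\<^esub> f) (u, w) = (\<Sum>j\<le>length w. if j = length w then (if path_end Q (u, w) \<in>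
          verts Q then f (u, w) else 0) else 0)"
        unfolding path_algebra_simps by (rule sum.cong) auto
      also have "\<dots> = f (u, w)"
        using f wf_digraph.path_end_verts[OF wf, of u w] by (auto simp: path_algebra_simps)
      finally show ?thesis .
    qed
    have 2: "(f \<otimes>\<^bsub>?P\<^esub> \<one>\<^bsub>?P\<^esub>) (u, w) = f (u, w)" for u w
    proof -
      have "(f \<otimes>\<^bsub>?P\<^esub> \<one>\<^bsub>?P\<^esub>) (u, w) = (\<Sum>j\<le>length w. if j = 0 then (if u \<in> verts Q then f (u, w)
          else 0) else 0)"
        unfolding path_algebra_simps by (rule sum.cong) auto
      also have "\<dots> = f (u, w)"
        using f wf_digraph.qpaths_verts[OF wf, of u w] by (auto simp: path_algebra_simps)
      finally show ?thesis .
    qed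
    show "\<one>\<^bsub>?P\<^esub> \<otimes>\<^bsub>?P\<^esub> f = f" "f \<otimes>\<^bsub>?P\<^esub> \<one>\<^bsub>?P\<^esub> = f" using 1 2 by auto
  qed (use path_algebra_mult_closed[OF wf] path_algebra_one_closed[OF fin wf]
      path_algebra_mult_assoc in auto)
qed (auto simp: path_algebra_simps fun_eq_iff algebra_simps sum.distrib)

text \<open>Only the cut after \<open>a\<close> can match both factors. The right factor is
  traversed first, so the word of the product is \<open>a @ b\<close>. The scalars are there so that
  inductions over sums of scaled paths can apply it directly.\<close>

lemma path_elem_mult:
  "(\<lambda>p. r * path_elem (v, b) p) \<otimes>\<^bsub>path_algebra Q\<^esub> (\<lambda>p. s * path_elem (u, a) p) =
     (if v = path_end Q (u, a) then (\<lambda>p. (r * s) * path_elem (u, a @ b) p) else (\<lambda>_. 0))"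
    (is "?l = ?r")
proof (rule ext, clarify)
  fix x w
  let ?c = "if x = u \<and> w = a @ b \<and> v = path_end Q (u, a) then r * s else 0"
  have "?l (x, w) = (\<Sum>j\<le>length w. if j = length a then ?c else 0)"
    unfolding path_algebra_simps
  proof (rule sum.cong)
    fix j assume j: "j \<in> {..length w}"
    have "take j w = a \<and> drop j w = b \<longleftrightarrow> j = length a \<and> w = a @ b"
      using j by (auto simp: min_absorb2)
    then show "r * path_elem (v, b) (path_end Q (x, take j w), drop j w) * (s * path_elem (u, a)
        (x, take j w)) =
        (if j = length a then ?c else 0)"
      by (cases "j = length a \<and> w = a @ b") (simp add: path_elem_def, force simp: path_elem_def)
  qed simp
  also have "\<dots> = ?r (x, w)" by (auto simp: path_elem_def)
  finally show "?l (x, w) = ?r (x, w)" .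
qed

lemma path_algebra_induct [consumes 1, case_names zero add elem]:
  fixes f :: "('v, 'e) qpath \<Rightarrow> 'r::comm_ring_1"
  assumes "f \<in> carrier (path_algebra Q)"
    and "P (\<lambda>_. 0)"
    and add: "\<And>f g. \<lbrakk>f \<in> carrier (path_algebra Q); g \<in> carrier (path_algebra Q); P f; P g\<rbrakk>
           \<Longrightarrow> P (\<lambda>p. f p + g p)"
    and elem: "\<And>r p. p \<in> qpaths Q \<Longrightarrow> P (\<lambda>q. r * path_elem p q)"
  shows "P f"
proof -
  have "finite F \<Longrightarrow> f \<in> carrier (path_algebra Q) \<Longrightarrow> {b. f b \<noteq> 0} \<subseteq> F \<Longrightarrow> P f" for F
  proof (induction F arbitrary: f rule: finite_induct)
    case empty
    then have "f = (\<lambda>_. 0)" by auto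
    then show ?case using assms(2) by simp
  next
    case (insert x F)
    show ?case
    proof (cases "f x = 0")
      case True
      then have "{b. f b \<noteq> 0} \<subseteq> F" using insert.prems(2) by auto
      then show ?thesis using insert.IH insert.prems(1) by blast
    next
      case False
      then have x: "x \<in> qpaths Q" using insert.prems(1) by (auto simp: path_algebra_simps)
      define g where "g = (\<lambda>b. if b = x then 0 else f b)"
      have g: "g \<in> carrier (path_algebra Q)" using insert.prems(1) unfolding path_algebra_simps
          g_def
        by (auto intro: finite_subset[of _ "{b. f b \<noteq> 0}"])
      have "P g" using g insert.prems(2) by (intro insert.IH) (auto simp: g_def)
      then have "P (\<lambda>b. g b + f x * path_elem x b)"
        using add g elem[OF x] path_algebra_scale_closed[OF path_elem_closed[OF x]] by blast
      moreover have "(\<lambda>b. g b + f x * path_elem x b) = f"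
        by (auto simp: g_def path_elem_def)
      ultimately show ?thesis by simp
    qed
  qed
  then show ?thesis using assms(1) path_algebra_simps(1) by blast
qed

section \<open>The circle quiver and rank one modules\<close>

text \<open>The exponent of \<open>t\<close> by which an arrow acts on the rank one module of
  \<open>J\<close>. Opposite arrows have total weight one, which is the relation
  \<open>xy = t = yx\<close>.\<close>

definition arrow_wt :: "nat set \<Rightarrow> arrow \<Rightarrow> nat" where
  "arrow_wt J a = (case a of Xarr i \<Rightarrow> (if i \<in> J then 0 else 1) | Yarr i \<Rightarrow> (if i \<in> J then 1 else 0))"

definition path_wt :: "nat set \<Rightarrow> arrow list \<Rightarrow> nat" where
  "path_wt J w = sum_list (map (arrow_wt J) w)"

lemma path_wt_simps [simp]:
  "path_wt J [] = 0" "path_wt J (a # w) = arrow_wt J a + path_wt J w"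
  "path_wt J (v @ w) = path_wt J v + path_wt J w"
  by (simp_all add: path_wt_def)

lemma fold_arrow_act: "fold (arrow_act J) w r = fps_X ^ path_wt J w * r"
proof (induction w arbitrary: r)
  case (Cons a w)
  have "arrow_act J a r = fps_X ^ arrow_wt J a * r"
    by (simp add: arrow_act_def arrow_wt_def split: arrow.split)
  then show ?case using Cons by (simp add: power_add mult.assoc mult.left_commute)
qed simp

lemma path_act_eq:
  "path_act n J p v i =
     (if i = path_end (circle_quiver n) p then fps_X ^ path_wt J (snd p) * v (fst p) else 0)"
  by (simp add: path_act_def fold_arrow_act)

lemma path_fun_act_superset:
  assumes "finite F" "{p. f p \<noteq> 0} \<subseteq> F"
  shows "path_fun_act n J f v i = (\<Sum>p\<in>F. f p * path_act n J p v i)"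
  unfolding path_fun_act_def by (rule sum.mono_neutral_left) (use assms in auto)

lemma path_fun_act_zero [simp]: "path_fun_act n J (\<lambda>_. 0) v = (\<lambda>_. 0)"
  by (simp add: path_fun_act_def)

lemma path_fun_act_zero_vec [simp]: "path_fun_act n J f (\<lambda>_. 0) = (\<lambda>_. 0)"
proof -
  have "path_act n J p (\<lambda>_. 0) i = 0" for p i by (auto simp: path_act_eq)
  then show ?thesis by (simp add: path_fun_act_def)
qed

lemma path_fun_act_add:
  assumes "finite {p. f p \<noteq> 0}" "finite {p. g p \<noteq> 0}"
  shows "path_fun_act n J (\<lambda>p. f p + g p) v = (\<lambda>i. path_fun_act n J f v i + path_fun_act n J g v i)"
proof
  fix i
  let ?F = "{p. f p \<noteq> 0} \<union> {p. g p \<noteq> 0}"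
  have F: "finite ?F" using assms by simp
  have "path_fun_act n J (\<lambda>p. f p + g p) v i = (\<Sum>p\<in>?F. (f p + g p) * path_act n J p v i)"
    by (rule path_fun_act_superset[OF F]) auto
  also have "\<dots> = (\<Sum>p\<in>?F. f p * path_act n J p v i) + (\<Sum>p\<in>?F. g p * path_act n J p v i)"
    by (simp add: distrib_right sum.distrib)
  also have "\<dots> = path_fun_act n J f v i + path_fun_act n J g v i"
    by (subst (1 2) path_fun_act_superset[OF F]) auto
  finally show "path_fun_act n J (\<lambda>p. f p + g p) v i = path_fun_act n J f v i + path_fun_act n J g
      v i" .
qed

lemma path_fun_act_elem:
  "path_fun_act n J (\<lambda>q. r * path_elem p q) v = (\<lambda>i. r * path_act n J p v i)"
proof
  fix i
  have "path_fun_act n J (\<lambda>q. r * path_elem p q) v i = (\<Sum>q\<in>{p}. r * path_elem p q * path_act n J q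
      v i)"
    by (rule path_fun_act_superset) (auto simp: path_elem_def)
  then show "path_fun_act n J (\<lambda>q. r * path_elem p q) v i = r * path_act n J p v i"
    by (simp add: path_elem_def)
qed

lemma path_fun_act_add_vec:
  "path_fun_act n J f (\<lambda>i. v i + w i) = (\<lambda>i. path_fun_act n J f v i + path_fun_act n J f w i)"
  by (auto simp: path_fun_act_def path_act_eq fun_eq_iff sum.distrib[symmetric] algebra_simps
      intro!: sum.cong)

text \<open>Both sides are additive in each factor, which leaves two paths: weights add under
  concatenation, and paths that do not compose give zero on both sides.\<close>

lemma path_fun_act_mult:
  assumes wf: "wf_digraph (circle_quiver n)"
    and f: "f \<in> carrier (circle_path_algebra n)" and g: "g \<in> carrier (circle_path_algebra n)"
  shows "path_fun_act n J (f \<otimes>\<^bsub>circle_path_algebra n\<^esub> g) v = path_fun_act n J f (path_fun_act n J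
      g v)"
proof -
  let ?P = "circle_path_algebra n"
  have fin: "finite {p. h p \<noteq> 0}" if "h \<in> carrier ?P" for h using that by (simp add:
      path_algebra_simps)
  have gadd: "h \<otimes>\<^bsub>?P\<^esub> (\<lambda>p. a p + b p) = (\<lambda>p. (h \<otimes>\<^bsub>?P\<^esub> a) p + (h \<otimes>\<^bsub>?P\<^esub> b) p)" for h a b :: path_fun
    by (auto simp: path_algebra_simps fun_eq_iff algebra_simps sum.distrib)
  have fadd: "(\<lambda>p. a p + b p) \<otimes>\<^bsub>?P\<^esub> h = (\<lambda>p. (a \<otimes>\<^bsub>?P\<^esub> h) p + (b \<otimes>\<^bsub>?P\<^esub> h) p)" for h a b :: path_fun
    by (auto simp: path_algebra_simps fun_eq_iff algebra_simps sum.distrib)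
  have z: "h \<otimes>\<^bsub>?P\<^esub> (\<lambda>_. 0) = (\<lambda>_. 0)" "(\<lambda>_. 0) \<otimes>\<^bsub>?P\<^esub> h = (\<lambda>_. 0)" for h :: path_fun
    by (auto simp: path_algebra_simps fun_eq_iff)
  show ?thesis using f
  proof (induction f rule: path_algebra_induct)
    case (add f1 f2)
    then show ?case
      by (simp add: fadd path_fun_act_add fin path_algebra_mult_closed[OF wf] g)
  next
    case (elem r p)
    let ?f = "\<lambda>q. r * path_elem p q"
    have fc: "?f \<in> carrier ?P" by (rule path_algebra_scale_closed[OF path_elem_closed[OF elem]])
    show ?case using g
    proof (induction g rule: path_algebra_induct)
      case (add g1 g2)
      then show ?case
        by (simp add: gadd path_fun_act_add path_fun_act_add_vec fin path_algebra_mult_closed[OF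
            wf] fc)
    next
      case (elem s q)
      obtain u a where q: "q = (u, a)" by (cases q)
      obtain v' b where p: "p = (v', b)" by (cases p)
      show ?case
        unfolding p q path_elem_mult path_fun_act_elem if_distrib[of "\<lambda>h. path_fun_act n J h v"]
          path_fun_act_zero path_act_eq
        by (auto simp: fun_eq_iff path_end_append power_add algebra_simps)
    qed (simp add: z)
  qed (simp add: z)
qed

section \<open>Walks on the cyclic set and the action of the relators\<close>

context
  fixes n :: nat
  assumes n: "0 < n"
begin

lemma csucc_range: "i \<in> {1..n} \<Longrightarrow> csucc n i \<in> {1..n}"
  and cpred_range: "i \<in> {1..n} \<Longrightarrow> cpred n i \<in> {1..n}"
  and cpred_csucc: "i \<in> {1..n} \<Longrightarrow> cpred n (csucc n i) = i"
  and csucc_cpred: "i \<in> {1..n} \<Longrightarrow> csucc n (cpred n i) = i"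
  using n by (auto simp: csucc_def cpred_def)

lemma csucc_pow_range: "i \<in> {1..n} \<Longrightarrow> (csucc n ^^ m) i \<in> {1..n}"
  by (induction m) (use csucc_range in auto)

lemma cpred_pow_range: "i \<in> {1..n} \<Longrightarrow> (cpred n ^^ m) i \<in> {1..n}"
  by (induction m) (use cpred_range in auto)

lemma csucc_pow: "i \<in> {1..n} \<Longrightarrow> (csucc n ^^ m) i = Suc ((i - 1 + m) mod n)"
proof (induction m)
  case (Suc m)
  define x where "x = i - 1 + m"
  have "(csucc n ^^ Suc m) i = csucc n (Suc (x mod n))" using Suc by (simp add: x_def)
  moreover have "i - 1 + Suc m = Suc x" by (simp add: x_def)
  ultimately show ?case by (simp only:) (simp add: csucc_def mod_Suc)
qed (use n in auto)

lemma csucc_pow_n: "i \<in> {1..n} \<Longrightarrow> (csucc n ^^ n) i = i"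
proof -
  assume i: "i \<in> {1..n}"
  have "(i - 1 + n) mod n = i - 1" using i unfolding mod_add_self2 by (intro mod_less) auto
  then show ?thesis using i by (simp only: csucc_pow) auto
qed

lemma cpred_pow: "i \<in> {1..n} \<Longrightarrow> m \<le> n \<Longrightarrow> (cpred n ^^ m) i = (csucc n ^^ (n - m)) i"
proof (induction m)
  case (Suc m)
  then have "n - m = Suc (n - Suc m)" by simp
  then have "(cpred n ^^ Suc m) i = cpred n (csucc n ((csucc n ^^ (n - Suc m)) i))" using Suc by
      simp
  then show ?case using cpred_csucc csucc_pow_range Suc.prems by simp
qed (simp add: csucc_pow_n)

text \<open>Exponents in a window of length \<open>n\<close> that are congruent modulo
  \<open>n\<close> are equal. The window starts at \<open>a\<close> rather than at zero because
  walks passing the starting vertex are compared later.\<close>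

lemma csucc_pow_inj:
  assumes i: "i \<in> {1..n}" and eq: "(csucc n ^^ a) i = (csucc n ^^ b) i" and ab: "a \<le> b" "b < a + n"
  shows "a = b"
proof -
  have "(i - 1 + a) mod n = (i - 1 + b) mod n" using eq i by (simp add: csucc_pow)
  then have "n dvd (i - 1 + b) - (i - 1 + a)" using ab mod_eq_dvd_iff_nat[of "i - 1 + a" "i - 1 +
      b" n] by simp
  then have "n dvd b - a" by simp
  then show ?thesis using ab by (metis add_diff_inverse_nat dvd_imp_le leD less_diff_conv2
      less_imp_le_nat linorder_neqE_nat not_less zero_less_diff add.commute)
qed

lemma csucc_pow_surj:
  assumes "i \<in> {1..n}" "j \<in> {1..n}"
  obtains m where "m < n" "(csucc n ^^ m) i = j"
proof
  \<comment> \<open>The distance from \<open>i\<close> to \<open>j\<close> modulo \<open>n\<close>;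
    adding \<open>n\<close> first keeps the natural subtraction from truncating.\<close>
  let ?m = "(j + n - i) mod n"
  show "?m < n" using n by simp
  have "(i - 1 + ?m) mod n = (i - 1 + (j + n - i)) mod n" by (simp add: mod_add_right_eq)
  also have "i - 1 + (j + n - i) = (j - 1) + n" using assms by auto
  also have "\<dots> mod n = j - 1" using assms unfolding mod_add_self2 by (intro mod_less) auto
  finally show "(csucc n ^^ ?m) i = j" unfolding csucc_pow[OF assms(1)] using assms by auto
qed

lemma bij_csucc_pow:
  assumes "i \<in> {1..n}"
  shows "bij_betw (\<lambda>m. (csucc n ^^ m) i) {1..n} {1..n}"
proof -
  have "inj_on (\<lambda>m. (csucc n ^^ m) i) {1..n}"
  proof (rule linorder_inj_onI)
    fix a b assume "a < b" "a \<in> {1..n}" "b \<in> {1..n}"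
    then show "(csucc n ^^ a) i \<noteq> (csucc n ^^ b) i" using csucc_pow_inj[OF assms, of a b] by auto
  qed (use linear in blast)
  moreover have "(\<lambda>m. (csucc n ^^ m) i) ` {1..n} \<subseteq> {1..n}" using csucc_pow_range[OF assms] by blast
  ultimately show ?thesis by (simp add: bij_betw_def endo_inj_surj)
qed

lemma circle_quiver_wf: "wf_digraph (circle_quiver n)"
  by unfold_locales (use cpred_range in \<open>auto simp: circle_quiver_def\<close>)

lemma circle_quiver_simps [simp]:
  "verts (circle_quiver n) = {1..n}"
  "arcs (circle_quiver n) = Xarr ` {1..n} \<union> Yarr ` {1..n}"
  "tail (circle_quiver n) (Xarr i) = cpred n i" "tail (circle_quiver n) (Yarr i) = i"
  "head (circle_quiver n) (Xarr i) = i" "head (circle_quiver n) (Yarr i) = cpred n i"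
  by (simp_all add: circle_quiver_def)

lemma circle_path_algebra_ring: "ring (circle_path_algebra n)"
  by (rule path_algebra_ring[OF _ circle_quiver_wf]) simp

lemma xpow_path:
  assumes "i \<in> {1..n}"
  shows "xpow n m i \<in> qpaths (circle_quiver n) \<and> path_end (circle_quiver n) (xpow n m i) = (csucc
      n ^^ m) i"
proof (induction m)
  case 0
  then show ?case using assms wf_digraph.qpaths_Nil[OF circle_quiver_wf] by (simp add: xpow_def)
next
  case (Suc m)
  have eq: "xpow n (Suc m) i = (i, snd (xpow n m i) @ [Xarr (csucc n ((csucc n ^^ m) i))])" by
      (simp add: xpow_def)
  have i: "(i, snd (xpow n m i)) = xpow n m i" by (simp add: xpow_def)
  show ?case
    unfolding eq wf_digraph.qpaths_append[OF circle_quiver_wf] path_end_append i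
    using Suc csucc_pow_range[OF assms, of m] csucc_range cpred_csucc
    by (simp add: wf_digraph.qpaths_Cons[OF circle_quiver_wf] wf_digraph.qpaths_Nil[OF
        circle_quiver_wf])
qed

lemma ypow_path:
  assumes "i \<in> {1..n}"
  shows "ypow n m i \<in> qpaths (circle_quiver n) \<and> path_end (circle_quiver n) (ypow n m i) = (cpred
      n ^^ m) i"
proof (induction m)
  case 0
  then show ?case using assms wf_digraph.qpaths_Nil[OF circle_quiver_wf] by (simp add: ypow_def)
next
  case (Suc m)
  have eq: "ypow n (Suc m) i = (i, snd (ypow n m i) @ [Yarr ((cpred n ^^ m) i)])" by (simp add:
      ypow_def)
  have i: "(i, snd (ypow n m i)) = ypow n m i" by (simp add: ypow_def)
  show ?case
    unfolding eq wf_digraph.qpaths_append[OF circle_quiver_wf] path_end_append i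
    using Suc cpred_pow_range[OF assms, of m] cpred_range
    by (simp add: wf_digraph.qpaths_Cons[OF circle_quiver_wf] wf_digraph.qpaths_Nil[OF
        circle_quiver_wf])
qed

text \<open>Each step of \<open>x^k\<close> into an element outside \<open>J\<close> costs one, so
  the weight is \<open>k\<close> minus the number of elements of \<open>J\<close> on that arc; for
  \<open>y^(n-k)\<close> it is the number of elements of \<open>J\<close> on the complementary arc.
  They agree because \<open>J\<close> has \<open>k\<close> elements.\<close>

lemma path_wt_xpow_ypow:
  assumes J: "J \<subseteq> {1..n}" "card J = k" and k: "k \<le> n" and i: "i \<in> {1..n}"
  shows "path_wt J (snd (xpow n k i)) = path_wt J (snd (ypow n (n - k) i))"
proof -
  let ?s = "\<lambda>m. (csucc n ^^ m) i"
  let ?c = "\<lambda>m. if ?s m \<in> J then 1 else 0 :: nat"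
  have "path_wt J (snd (xpow n k i)) = (\<Sum>j=0..<k. if ?s (Suc j) \<in> J then 0 else 1)"
    unfolding path_wt_def xpow_def by (simp add: interv_sum_list_conv_sum_set_nat comp_def
        arrow_wt_def)
  also have "\<dots> = (\<Sum>m\<in>{1..k}. 1 - ?c m)"
    by (rule sum.reindex_bij_witness[where i = "\<lambda>m. m - 1" and j = Suc]) auto
  finally have x: "path_wt J (snd (xpow n k i)) + sum ?c {1..k} = k"
    by (simp add: sum.distrib[symmetric])
  have "path_wt J (snd (ypow n (n - k) i)) = (\<Sum>j=0..<n - k. if (cpred n ^^ j) i \<in> J then 1 else 0)"
    unfolding path_wt_def ypow_def by (simp add: interv_sum_list_conv_sum_set_nat comp_def
        arrow_wt_def)
  \<comment> \<open>The backward step numbered \<open>j\<close> uses the arrow at offset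
    \<open>n - j\<close> from \<open>i\<close>, so \<open>j < n - k\<close> ranges over the offsets
    above \<open>k\<close>.\<close>
  also have "\<dots> = (\<Sum>m\<in>{k<..n}. ?c m)"
    by (rule sum.reindex_bij_witness[where i = "\<lambda>m. n - m" and j = "\<lambda>j. n - j"]) (auto simp:
        cpred_pow[OF i])
  finally have y: "path_wt J (snd (ypow n (n - k) i)) = sum ?c {k<..n}" .
  have "{1..n} = {1..k} \<union> {k<..n}" using k by auto
  then have "sum ?c {1..k} + sum ?c {k<..n} = sum ?c {1..n}"
    by (simp only:) (intro sum.union_disjoint[symmetric]; auto)
  also have "\<dots> = (\<Sum>j\<in>{1..n}. if j \<in> J then 1 else 0)"
    by (rule sum.reindex_bij_betw[OF bij_csucc_pow[OF i]])
  also have "\<dots> = k" using J by (simp add: sum.If_cases Int_absorb1)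
  finally show ?thesis using x y by simp
qed

lemma circle_relators_closed:
  "circle_relators k n \<subseteq> carrier (circle_path_algebra n)"
proof -
  have diff: "(\<lambda>p. f p - g p) \<in> carrier (circle_path_algebra n)"
    if "f \<in> carrier (circle_path_algebra n)" "g \<in> carrier (circle_path_algebra n)" for f g
    using path_algebra_add_closed[OF that(1) path_algebra_scale_closed[OF that(2), of "-1"]] by simp
  show ?thesis unfolding circle_relators_def
    using csucc_range cpred_range cpred_csucc xpow_path ypow_path
    by (auto intro!: diff path_elem_closed path_algebra_scale_closed
        simp: wf_digraph.qpaths_Cons[OF circle_quiver_wf] wf_digraph.qpaths_Nil[OF
            circle_quiver_wf])
qed

lemma path_fun_act_relators:
  assumes J: "J \<subseteq> {1..n}" "card J = k" and k: "k \<le> n" and f: "f \<in> circle_relators k n"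
  shows "path_fun_act n J f v = (\<lambda>_. 0)"
proof -
  have diff: "path_fun_act n J (\<lambda>q. path_elem p q - r * path_elem p' q) v =
      (\<lambda>i. path_act n J p v i - r * path_act n J p' v i)" for p p' r
  proof -
    have fin: "finite {q. c * path_elem a q \<noteq> 0}" for c :: "complex fps" and a
      by (rule finite_subset[of _ "{a}"]) (auto simp: path_elem_def)
    have "path_fun_act n J (\<lambda>q. 1 * path_elem p q + (- r) * path_elem p' q) v =
      (\<lambda>i. 1 * path_act n J p v i + (- r) * path_act n J p' v i)"
      unfolding path_fun_act_add[OF fin fin] path_fun_act_elem ..
    then show ?thesis by simp
  qed
  from f consider
      (a) i where "i \<in> {1..n}" "f = (\<lambda>p. path_elem (i, [Yarr i, Xarr i]) p - fps_X * path_elem (i,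
          []) p)"
    | (b) i where "i \<in> {1..n}" "f = (\<lambda>p. path_elem (i, [Xarr (csucc n i), Yarr (csucc n i)]) p -
        fps_X * path_elem (i, []) p)"
    | (c) i where "i \<in> {1..n}" "f = (\<lambda>p. path_elem (xpow n k i) p - path_elem (ypow n (n - k) i) p)"
    unfolding circle_relators_def by blast
  then show ?thesis
  proof cases
    case a
    have w: "path_wt J [Yarr i, Xarr i] = 1" by (simp add: arrow_wt_def)
    show ?thesis unfolding a(2) diff path_act_eq fst_conv snd_conv w power_one_right
      by (auto simp: fun_eq_iff)
  next
    case b
    have w: "path_wt J [Xarr (csucc n i), Yarr (csucc n i)] = 1" by (simp add: arrow_wt_def)
    show ?thesis unfolding b(2) diff path_act_eq fst_conv snd_conv w power_one_right
      using cpred_csucc[OF b(1)] by (auto simp: fun_eq_iff)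
  next
    case c
    have e: "path_end (circle_quiver n) (ypow n (n - k) i) = (csucc n ^^ k) i"
      using ypow_path[OF c(1), of "n - k"] cpred_pow[OF c(1), of "n - k"] k by simp
    have s: "fst (xpow n k i) = fst (ypow n (n - k) i)" by (simp add: xpow_def ypow_def)
    have x: "path_end (circle_quiver n) (xpow n k i) = (csucc n ^^ k) i"
      using xpow_path[OF c(1)] by blast
    have f: "f = (\<lambda>p. path_elem (xpow n k i) p - 1 * path_elem (ypow n (n - k) i) p)"
      using c(2) by simp
    show ?thesis unfolding f diff path_act_eq e s x path_wt_xpow_ypow[OF J k c(1)] by simp
  qed
qed

lemma circle_ideal_ideal: "ideal (circle_ideal k n) (circle_path_algebra n)"
  unfolding circle_ideal_def
  by (rule ring.genideal_ideal[OF circle_path_algebra_ring circle_relators_closed])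

text \<open>Elements acting as zero form a two-sided ideal, and it contains the relators.\<close>

lemma path_fun_act_ideal:
  assumes J: "J \<subseteq> {1..n}" "card J = k" and k: "k \<le> n" and f: "f \<in> circle_ideal k n"
  shows "path_fun_act n J f v = (\<lambda>_. 0)"
proof -
  let ?P = "circle_path_algebra n"
  interpret P: ring ?P by (rule circle_path_algebra_ring)
  \<comment> \<open>The annihilator is taken for all vectors at once; that of a single vector would
    be only a left ideal.\<close>
  let ?K = "{f \<in> carrier ?P. \<forall>v. path_fun_act n J f v = (\<lambda>_. 0)}"
  have fin: "finite {p. h p \<noteq> 0}" if "h \<in> carrier ?P" for h using that by (simp add:
      path_algebra_simps)
  have "ideal ?K ?P"
  proof (rule idealI)
    show "ring ?P" by (rule circle_path_algebra_ring)
    show "subgroup ?K (add_monoid ?P)"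
    proof (rule P.add.subgroupI)
      show "?K \<subseteq> carrier ?P" by auto
      have "\<zero>\<^bsub>?P\<^esub> \<in> ?K" using P.zero_closed by (simp add: path_algebra_simps(4))
      then show "?K \<noteq> {}" by blast
      fix f g assume f: "f \<in> ?K"
      { assume g: "g \<in> ?K"
        show "f \<oplus>\<^bsub>?P\<^esub> g \<in> ?K"
          using f g P.a_closed[of f g] by (simp add: path_algebra_simps(5) path_fun_act_add fin) }
      have fc: "f \<in> carrier ?P" using f by simp
      have m: "(\<lambda>p. - 1 * f p) \<in> carrier ?P" by (rule path_algebra_scale_closed[OF fc])
      have inv: "\<ominus>\<^bsub>?P\<^esub> f = (\<lambda>p. - 1 * f p)"
        by (rule P.minus_equality[OF _ fc m]) (simp add: path_algebra_simps(4,5))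
      have "path_fun_act n J (\<lambda>p. f p + - 1 * f p) v = (\<lambda>i. path_fun_act n J f v i + path_fun_act
          n J (\<lambda>p. - 1 * f p) v i)" for v
        by (rule path_fun_act_add[OF fin[OF fc] fin[OF m]])
      then show "\<ominus>\<^bsub>?P\<^esub> f \<in> ?K" using f m unfolding inv by (auto simp: fun_eq_iff)
    qed
    fix f g assume f: "f \<in> ?K" and g: "g \<in> carrier ?P"
    then show "g \<otimes>\<^bsub>?P\<^esub> f \<in> ?K" "f \<otimes>\<^bsub>?P\<^esub> g \<in> ?K"
      using path_fun_act_mult[OF circle_quiver_wf] by auto
  qed
  then have "circle_ideal k n \<subseteq> ?K" unfolding circle_ideal_def
    using circle_relators_closed path_fun_act_relators[OF J k] by (intro P.genideal_minimal) auto
  then show ?thesis using f by blast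
qed

lemma path_fun_act_one:
  assumes "\<And>i. i \<notin> {1..n} \<Longrightarrow> v i = 0"
  shows "path_fun_act n J \<one>\<^bsub>circle_path_algebra n\<^esub> v = v"
proof
  fix i
  have "path_fun_act n J \<one>\<^bsub>circle_path_algebra n\<^esub> v i =
      (\<Sum>p\<in>(\<lambda>u. (u, [])) ` {1..n}. \<one>\<^bsub>circle_path_algebra n\<^esub> p * path_act n J p v i)"
    by (rule path_fun_act_superset) (auto simp: path_algebra_simps(3) split: if_splits)
  also have "\<dots> = (\<Sum>u\<in>{1..n}. if i = u then v u else 0)"
    by (subst sum.reindex) (auto simp: inj_on_def path_algebra_simps(3) path_act_eq intro!:
        sum.cong)
  also have "\<dots> = v i" using assms[of i] by (auto simp: sum.delta)
  finally show "path_fun_act n J \<one>\<^bsub>circle_path_algebra n\<^esub> v i = v i" .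
qed

lemma path_fun_act_range:
  assumes "f \<in> carrier (circle_path_algebra n)" "i \<notin> {1..n}"
  shows "path_fun_act n J f v i = 0"
proof -
  have "path_act n J p v i = 0" if "f p \<noteq> 0" for p
    using wf_digraph.path_end_verts[OF circle_quiver_wf, of "fst p" "snd p"] that assms
    by (auto simp: path_act_eq path_algebra_simps(1))
  then show ?thesis by (simp add: path_fun_act_def)
qed

end

section \<open>The algebra C(k,n), its generators and its matrix representations\<close>

locale circle =
  fixes k n :: nat
  assumes k_pos: "0 < k" and k_less: "k < n"
begin

lemma n_pos: "0 < n" using k_pos k_less by simp

abbreviation "PA \<equiv> circle_path_algebra n"
abbreviation "CA \<equiv> circle_algebra k n"
abbreviation "cls \<equiv> circle_class k n"
abbreviation "Qv \<equiv> circle_quiver n"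

sublocale cls: ring_hom_ring PA CA cls
proof -
  have "ring_hom_ring PA (PA Quot circle_ideal k n) (a_r_coset PA (circle_ideal k n))"
    by (rule ideal.rcos_ring_hom_ring[OF circle_ideal_ideal[OF n_pos]])
  moreover have "cls = a_r_coset PA (circle_ideal k n)" by (simp add: circle_class_def fun_eq_iff)
  ultimately show "ring_hom_ring PA CA cls" by (simp add: circle_algebra_def)
qed

lemma CA_cases:
  assumes "c \<in> carrier CA"
  obtains f where "f \<in> carrier PA" "c = cls f"
  using assms by (auto simp: circle_algebra_def circle_class_def FactRing_def A_RCOSETS_def'
      a_r_coset_def)

lemma cls_eqI:
  assumes "f \<in> carrier PA" "g \<in> carrier PA" "(\<lambda>p. f p - g p) \<in> circle_ideal k n"
  shows "cls f = cls g"
proof -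
  interpret I: ideal "circle_ideal k n" PA by (rule circle_ideal_ideal[OF n_pos])
  let ?d = "\<lambda>p. f p - g p"
  have d: "?d \<in> carrier PA" using assms(3) I.a_Hcarr by blast
  have "f = ?d \<oplus>\<^bsub>PA\<^esub> g" by (simp add: path_algebra_simps)
  then have "cls f = cls ?d \<oplus>\<^bsub>CA\<^esub> cls g" using cls.hom_add[OF d assms(2)] by simp
  moreover have "cls ?d = \<zero>\<^bsub>CA\<^esub>"
    using I.a_rcos_const[OF assms(3)] by (simp add: circle_class_def circle_algebra_def
        FactRing_def)
  ultimately show ?thesis using assms(2) by simp
qed

lemmas qpaths_simps = wf_digraph.qpaths_Nil[OF circle_quiver_wf[OF n_pos]]
  wf_digraph.qpaths_Cons[OF circle_quiver_wf[OF n_pos]]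

definition xc :: "nat \<Rightarrow> path_fun set" where "xc i = cls (path_elem (cpred n i, [Xarr i]))"
definition yc :: "nat \<Rightarrow> path_fun set" where "yc i = cls (path_elem (i, [Yarr i]))"
abbreviation ec :: "nat \<Rightarrow> path_fun set" where "ec \<equiv> idem k n"
abbreviation sc :: "complex fps \<Rightarrow> path_fun set" where "sc \<equiv> scalar k n"
definition pc :: "(nat, arrow) qpath \<Rightarrow> path_fun set" where "pc p = cls (path_elem p)"

lemma xc_pc: "xc i = pc (cpred n i, [Xarr i])" and yc_pc: "yc i = pc (i, [Yarr i])"
  and ec_pc: "ec i = pc (i, [])"
  by (simp_all add: xc_def yc_def pc_def idem_def)

lemma pc_closed [simp]: "p \<in> qpaths Qv \<Longrightarrow> pc p \<in> carrier CA"
  unfolding pc_def by (intro cls.hom_closed path_elem_closed)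

lemma arrow_paths:
  "i \<in> {1..n} \<Longrightarrow> (cpred n i, [Xarr i]) \<in> qpaths Qv" "i \<in> {1..n} \<Longrightarrow> (i, [Yarr i]) \<in> qpaths Qv"
  "i \<in> {1..n} \<Longrightarrow> (i, []) \<in> qpaths Qv"
  using cpred_range[OF n_pos] by (auto simp: qpaths_simps n_pos)

lemma gen_closed [simp]:
  "i \<in> {1..n} \<Longrightarrow> xc i \<in> carrier CA" "i \<in> {1..n} \<Longrightarrow> yc i \<in> carrier CA" "i \<in> {1..n} \<Longrightarrow> ec i \<in> carrier CA"
  unfolding xc_pc yc_pc ec_pc by (intro pc_closed arrow_paths; assumption)+

lemma one_scale_closed: "(\<lambda>p. r * \<one>\<^bsub>PA\<^esub> p) \<in> carrier PA"
  by (rule path_algebra_scale_closed) simp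

lemma sc_closed [simp]: "sc r \<in> carrier CA"
  unfolding scalar_def by (intro cls.hom_closed one_scale_closed)

lemma PA_scale_mult:
  "(\<lambda>p. r * f p) \<otimes>\<^bsub>PA\<^esub> g = (\<lambda>p. r * (f \<otimes>\<^bsub>PA\<^esub> g) p)"
  "f \<otimes>\<^bsub>PA\<^esub> (\<lambda>p. r * g p) = (\<lambda>p. r * (f \<otimes>\<^bsub>PA\<^esub> g) p)"
  by (auto simp: fun_eq_iff path_algebra_simps sum_distrib_left algebra_simps)

lemma sc_cls:
  assumes "f \<in> carrier PA"
  shows "sc r \<otimes>\<^bsub>CA\<^esub> cls f = cls (\<lambda>p. r * f p)" "cls f \<otimes>\<^bsub>CA\<^esub> sc r = cls (\<lambda>p. r * f p)"
proof -
  have "sc r \<otimes>\<^bsub>CA\<^esub> cls f = cls ((\<lambda>p. r * \<one>\<^bsub>PA\<^esub> p) \<otimes>\<^bsub>PA\<^esub> f)"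
    unfolding scalar_def by (rule cls.hom_mult[symmetric, OF one_scale_closed assms])
  then show "sc r \<otimes>\<^bsub>CA\<^esub> cls f = cls (\<lambda>p. r * f p)" using assms by (simp add: PA_scale_mult)
  have "cls f \<otimes>\<^bsub>CA\<^esub> sc r = cls (f \<otimes>\<^bsub>PA\<^esub> (\<lambda>p. r * \<one>\<^bsub>PA\<^esub> p))"
    unfolding scalar_def by (rule cls.hom_mult[symmetric, OF assms one_scale_closed])
  then show "cls f \<otimes>\<^bsub>CA\<^esub> sc r = cls (\<lambda>p. r * f p)" using assms by (simp add: PA_scale_mult)
qed

lemma sc_central: "c \<in> carrier CA \<Longrightarrow> sc r \<otimes>\<^bsub>CA\<^esub> c = c \<otimes>\<^bsub>CA\<^esub> sc r"
  using sc_cls by (elim CA_cases) simp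

lemma sc_mult: "sc r \<otimes>\<^bsub>CA\<^esub> sc q = sc (r * q)"
  using sc_cls(1)[OF one_scale_closed, of r q] by (simp add: scalar_def mult.assoc)

lemma sc_add: "sc r \<oplus>\<^bsub>CA\<^esub> sc q = sc (r + q)"
  unfolding scalar_def cls.hom_add[symmetric, OF one_scale_closed one_scale_closed]
  by (simp add: path_algebra_simps(5) distrib_right)

lemma sc_one: "sc 1 = \<one>\<^bsub>CA\<^esub>" by (simp add: scalar_def)

lemma sc_zero: "sc 0 = \<zero>\<^bsub>CA\<^esub>"
  using cls.hom_zero by (simp add: scalar_def path_algebra_simps(4))

lemma pc_mult:
  assumes "(u, a) \<in> qpaths Qv" "(v, b) \<in> qpaths Qv"
  shows "pc (v, b) \<otimes>\<^bsub>CA\<^esub> pc (u, a) = (if v = path_end Qv (u, a) then pc (u, a @ b) else \<zero>\<^bsub>CA\<^esub>)"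
proof -
  have "pc (v, b) \<otimes>\<^bsub>CA\<^esub> pc (u, a) = cls (path_elem (v, b) \<otimes>\<^bsub>PA\<^esub> path_elem (u, a))"
    unfolding pc_def by (rule cls.hom_mult[symmetric]) (intro path_elem_closed assms)+
  then show ?thesis
    using path_elem_mult[where r = "1 :: complex fps" and s = 1 and Q = Qv, of v b u a]
        cls.hom_zero by (simp add: pc_def path_algebra_simps(4))
qed

text \<open>Scalars, arrows and idempotents generate the algebra; statements on matrices and
  commutators are checked on them and propagated through sums and products.\<close>

lemma CA_induct [consumes 1, case_names sc xc yc ec add mult]:
  assumes c: "c \<in> carrier CA"
    and "\<And>r. P (sc r)" and x: "\<And>i. i \<in> {1..n} \<Longrightarrow> P (xc i)" and y: "\<And>i. i \<in> {1..n} \<Longrightarrow> P (yc i)"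
    and e: "\<And>i. i \<in> {1..n} \<Longrightarrow> P (ec i)"
    and add: "\<And>c d. \<lbrakk>c \<in> carrier CA; d \<in> carrier CA; P c; P d\<rbrakk> \<Longrightarrow> P (c \<oplus>\<^bsub>CA\<^esub> d)"
    and mult: "\<And>c d. \<lbrakk>c \<in> carrier CA; d \<in> carrier CA; P c; P d\<rbrakk> \<Longrightarrow> P (c \<otimes>\<^bsub>CA\<^esub> d)"
  shows "P c"
proof -
  have path: "P (pc (u, w))" if "(u, w) \<in> qpaths Qv" for u w
    using that
  \<comment> \<open>The last arrow of a path is the leftmost factor of the product, so words grow at
    their end.\<close>
  proof (induction w rule: rev_induct)
    case Nil
    then show ?case using e[of u] n_pos by (simp add: ec_pc qpaths_simps)
  next
    case (snoc a w)
    note ap = wf_digraph.qpaths_append[OF circle_quiver_wf[OF n_pos], of u w "[a]"]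
    have 1: "(u, w) \<in> qpaths Qv" "(path_end Qv (u, w), [a]) \<in> qpaths Qv" using snoc.prems ap by auto
    have "P (pc (path_end Qv (u, w), [a]))"
    proof (cases a)
      case (Xarr i)
      then have "i \<in> {1..n}" "path_end Qv (u, w) = cpred n i" using 1(2) by (auto simp:
          qpaths_simps n_pos)
      then show ?thesis using x[of i] Xarr by (simp add: xc_pc)
    next
      case (Yarr i)
      then have "i \<in> {1..n}" "path_end Qv (u, w) = i" using 1(2) by (auto simp: qpaths_simps n_pos)
      then show ?thesis using y[of i] Yarr by (simp add: yc_pc)
    qed
    then have "P (pc (path_end Qv (u, w), [a]) \<otimes>\<^bsub>CA\<^esub> pc (u, w))"
      using mult snoc.IH 1 pc_closed by blast
    then show ?case using pc_mult[OF 1] by simp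
  qed
  obtain f where f: "f \<in> carrier PA" "c = cls f" using CA_cases[OF c] .
  from f(1) have "P (cls f)"
  proof (induction f rule: path_algebra_induct)
    case zero
    show ?case using assms(2)[of 0] sc_zero cls.hom_zero by (simp add: path_algebra_simps(4))
  next
    case (add f g)
    have "cls (\<lambda>p. f p + g p) = cls f \<oplus>\<^bsub>CA\<^esub> cls g"
      using cls.hom_add[OF add(1,2)] unfolding path_algebra_simps(5) .
    then show ?case using assms(6)[of "cls f" "cls g"] add by simp
  next
    case (elem r p)
    have "P (sc r \<otimes>\<^bsub>CA\<^esub> pc p)" using mult[OF sc_closed pc_closed[OF elem] assms(2)] path[of "fst
        p" "snd p"] elem by simp
    then show ?case using sc_cls(1)[OF path_elem_closed[OF elem]] by (simp add: pc_def)
  qed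
  then show ?thesis using f by simp
qed

definition k_set :: "nat set \<Rightarrow> bool" where "k_set J \<longleftrightarrow> J \<subseteq> {1..n} \<and> card J = k"

text \<open>The action of a class is \<open>the_elem\<close> over its representatives; they act
  alike because the ideal acts as zero. The cardinality in \<open>k_set J\<close> enters through the
  relator \<open>x^k - y^(n-k)\<close>.\<close>

lemma rank_one_smult:
  assumes J: "k_set J" and f: "f \<in> carrier PA"
  shows "cls f \<odot>\<^bsub>rank_one_module n J\<^esub> v = path_fun_act n J f v"
proof -
  interpret I: ideal "circle_ideal k n" PA by (rule circle_ideal_ideal[OF n_pos])
  have fin: "finite {p. h p \<noteq> 0}" if "h \<in> carrier PA" for h using that by (simp add:
      path_algebra_simps)
  have "path_fun_act n J g v = path_fun_act n J f v" if g: "g \<in> cls f" for g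
  proof -
    obtain h where h: "h \<in> circle_ideal k n" "g = h \<oplus>\<^bsub>PA\<^esub> f"
      using g by (auto simp: circle_class_def a_r_coset_def r_coset_def)
    have "path_fun_act n J g v = (\<lambda>i. path_fun_act n J h v i + path_fun_act n J f v i)"
      unfolding h(2) path_algebra_simps(5) by (rule path_fun_act_add[OF fin[OF I.a_Hcarr[OF h(1)]]
          fin[OF f]])
    then show ?thesis
      using path_fun_act_ideal[OF n_pos _ _ _ h(1), of J] J k_less by (simp add: k_set_def)
  qed
  moreover have "f \<in> cls f" using I.a_rcos_self[OF f] by (simp add: circle_class_def)
  ultimately have "(\<lambda>g. path_fun_act n J g v) ` cls f = {path_fun_act n J f v}" by blast
  then show ?thesis by (simp add: rank_one_module_def)
qed

definition unit_vec :: "nat \<Rightarrow> nat \<Rightarrow> complex fps" where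
  "unit_vec j = (\<lambda>i. if i = j then 1 else 0)"

text \<open>Column \<open>j\<close> is the image of the unit vector at vertex \<open>j\<close>; this
  is the representation of \<open>C\<close> by matrices over \<open>R\<close> that comes from the
  rank one module of \<open>J\<close>.\<close>

definition mat :: "nat set \<Rightarrow> path_fun set \<Rightarrow> nat \<Rightarrow> nat \<Rightarrow> complex fps" where
  "mat J c i j = (c \<odot>\<^bsub>rank_one_module n J\<^esub> unit_vec j) i"

lemma path_fun_act_expand:
  assumes f: "f \<in> carrier PA"
  shows "path_fun_act n J f v i = (\<Sum>p\<in>{1..n}. path_fun_act n J f (unit_vec p) i * v p)"
proof -
  have "path_act n J q v i = (\<Sum>p\<in>{1..n}. path_act n J q (unit_vec p) i * v p)" if "f q \<noteq> 0" for q
  proof -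
    have "fst q \<in> {1..n}" using wf_digraph.qpaths_verts[OF circle_quiver_wf[OF n_pos], of "fst q"
        "snd q"] that f n_pos
      by (auto simp: path_algebra_simps(1))
    then have "(\<Sum>p\<in>{1..n}. path_act n J q (unit_vec p) i * v p) = (\<Sum>p\<in>{1..n}. if p = fst q then
        path_act n J q v i else 0)"
      by (intro sum.cong) (auto simp: path_act_eq unit_vec_def)
    then show ?thesis using \<open>fst q \<in> {1..n}\<close> by simp
  qed
  then have "path_fun_act n J f v i = (\<Sum>q | f q \<noteq> 0. \<Sum>p\<in>{1..n}. f q * (path_act n J q (unit_vec p)
      i * v p))"
    unfolding path_fun_act_def sum_distrib_left[symmetric] by (intro sum.cong) auto
  also have "\<dots> = (\<Sum>p\<in>{1..n}. path_fun_act n J f (unit_vec p) i * v p)"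
    unfolding path_fun_act_def by (subst sum.swap) (simp add: sum_distrib_right mult.assoc)
  finally show ?thesis .
qed

lemma rank_one_smult_mat:
  assumes "k_set J" "c \<in> carrier CA"
  shows "(c \<odot>\<^bsub>rank_one_module n J\<^esub> v) i = (\<Sum>p\<in>{1..n}. mat J c i p * v p)"
  using assms(2)
proof (rule CA_cases)
  fix f assume f: "f \<in> carrier PA" "c = cls f"
  show ?thesis unfolding f(2) mat_def rank_one_smult[OF assms(1) f(1)] by (rule
      path_fun_act_expand[OF f(1)])
qed

lemma mat_add:
  assumes "k_set J" "c \<in> carrier CA" "d \<in> carrier CA"
  shows "mat J (c \<oplus>\<^bsub>CA\<^esub> d) i j = mat J c i j + mat J d i j"
proof -
  obtain f g where fg: "f \<in> carrier PA" "c = cls f" "g \<in> carrier PA" "d = cls g"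
    using assms by (metis CA_cases)
  have "c \<oplus>\<^bsub>CA\<^esub> d = cls (\<lambda>p. f p + g p)" "(\<lambda>p. f p + g p) \<in> carrier PA"
    using fg cls.hom_add[OF fg(1,3)] path_algebra_add_closed[OF fg(1,3)] by (auto simp:
        path_algebra_simps(5))
  then show ?thesis using fg unfolding mat_def
    by (simp add: rank_one_smult[OF assms(1)] path_fun_act_add path_algebra_simps(1))
qed

lemma mat_mult:
  assumes "k_set J" "c \<in> carrier CA" "d \<in> carrier CA"
  shows "mat J (c \<otimes>\<^bsub>CA\<^esub> d) i j = (\<Sum>p\<in>{1..n}. mat J c i p * mat J d p j)"
proof -
  obtain f g where fg: "f \<in> carrier PA" "c = cls f" "g \<in> carrier PA" "d = cls g"
    using assms by (metis CA_cases)
  have eq: "c \<otimes>\<^bsub>CA\<^esub> d = cls (f \<otimes>\<^bsub>PA\<^esub> g)" and m: "f \<otimes>\<^bsub>PA\<^esub> g \<in> carrier PA" using fg by auto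
  show ?thesis
    unfolding mat_def eq rank_one_smult[OF assms(1) m] path_fun_act_mult[OF circle_quiver_wf[OF
        n_pos] fg(1,3)]
      path_fun_act_expand[OF fg(1), of J "path_fun_act n J g (unit_vec j)"]
    by (simp add: fg rank_one_smult[OF assms(1)])
qed

lemma mat_range:
  assumes "k_set J" "c \<in> carrier CA" "i \<notin> {1..n}"
  shows "mat J c i j = 0"
  using assms(2)
proof (rule CA_cases)
  fix f assume f: "f \<in> carrier PA" "c = cls f"
  show ?thesis unfolding f(2) mat_def rank_one_smult[OF assms(1) f(1)]
    by (rule path_fun_act_range[OF n_pos f(1) assms(3)])
qed

lemma mat_sc_cls:
  assumes "k_set J" "c \<in> carrier CA"
  shows "mat J (sc r \<otimes>\<^bsub>CA\<^esub> c) i j = r * mat J c i j"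
  using assms(2)
proof (rule CA_cases)
  fix f assume f: "f \<in> carrier PA" "c = cls f"
  have fin: "finite {p. f p \<noteq> 0}" using f by (simp add: path_algebra_simps)
  have "path_fun_act n J (\<lambda>p. r * f p) (unit_vec j) i = r * path_fun_act n J f (unit_vec j) i"
    by (subst (1 2) path_fun_act_superset[OF fin]) (auto simp: sum_distrib_left mult.assoc)
  then show ?thesis unfolding f(2) sc_cls(1)[OF f(1)]  mat_def
    by (simp add: rank_one_smult[OF assms(1)] f(1) path_algebra_scale_closed[OF f(1)])
qed

lemma mat_one:
  assumes "k_set J" "j \<in> {1..n}"
  shows "mat J \<one>\<^bsub>CA\<^esub> i j = (if i = j then 1 else 0)"
proof -
  have "mat J (cls \<one>\<^bsub>PA\<^esub>) i j = unit_vec j i"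
    unfolding mat_def rank_one_smult[OF assms(1) cls.R.one_closed]
    by (subst path_fun_act_one[OF n_pos]) (use assms in \<open>auto simp: unit_vec_def\<close>)
  then show ?thesis by (simp add: unit_vec_def)
qed

lemma mat_sc:
  assumes "k_set J" "j \<in> {1..n}"
  shows "mat J (sc r) i j = (if i = j then r else 0)"
  using mat_sc_cls[OF assms(1), of "\<one>\<^bsub>CA\<^esub>" r i j] mat_one[OF assms] by simp

lemma mat_pc:
  assumes "k_set J" "p \<in> qpaths Qv"
  shows "mat J (pc p) i j = (if i = path_end Qv p \<and> j = fst p then fps_X ^ path_wt J (snd p) else
      0)"
  using path_fun_act_elem[of n J 1 p]
  by (auto simp: mat_def pc_def rank_one_smult[OF assms(1) path_elem_closed[OF assms(2)]]
      path_act_eq unit_vec_def)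

lemma mat_gens:
  assumes "k_set J" "i \<in> {1..n}"
  shows "mat J (xc i) a b = (if a = i \<and> b = cpred n i then fps_X ^ (if i \<in> J then 0 else 1) else 0)"
    "mat J (yc i) a b = (if a = cpred n i \<and> b = i then fps_X ^ (if i \<in> J then 1 else 0) else 0)"
    "mat J (ec i) a b = (if a = i \<and> b = i then 1 else 0)"
  unfolding xc_pc yc_pc ec_pc using assms(2) arrow_paths[OF assms(2)]
  by (auto simp: mat_pc[OF assms(1)] n_pos arrow_wt_def)

lemma yc_xc:
  assumes i: "i \<in> {1..n}"
  shows "yc i \<otimes>\<^bsub>CA\<^esub> xc i = sc fps_X \<otimes>\<^bsub>CA\<^esub> ec (cpred n i)"
proof -
  interpret I: ideal "circle_ideal k n" PA by (rule circle_ideal_ideal[OF n_pos])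
  \<comment> \<open>The path of \<open>y_i x_i\<close> starts at \<open>i - 1\<close>, so the
    relator is the one indexed by the predecessor, whose successor is \<open>i\<close>.\<close>
  let ?j = "cpred n i"
  have j: "?j \<in> {1..n}" "csucc n ?j = i" using i cpred_range[OF n_pos] csucc_cpred[OF n_pos] by auto
  have "yc i \<otimes>\<^bsub>CA\<^esub> xc i = pc (?j, [Xarr i, Yarr i])"
    unfolding xc_pc yc_pc using pc_mult[OF arrow_paths(1)[OF i] arrow_paths(2)[OF i]] n_pos by simp
  also have "\<dots> = cls (\<lambda>p. fps_X * path_elem (?j, []) p)"
    unfolding pc_def
  proof (rule cls_eqI)
    have "(\<lambda>p. path_elem (?j, [Xarr (csucc n ?j), Yarr (csucc n ?j)]) p - fps_X * path_elem (?j,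
        []) p) \<in> circle_relators k n"
      unfolding circle_relators_def using j by blast
    then show "(\<lambda>p. path_elem (?j, [Xarr i, Yarr i]) p - fps_X * path_elem (?j, []) p) \<in>
        circle_ideal k n"
      unfolding j(2) circle_ideal_def using cls.R.genideal_self[OF circle_relators_closed[OF
          n_pos]] by blast
  qed (use j i n_pos in \<open>auto intro!: path_elem_closed path_algebra_scale_closed simp:
      qpaths_simps\<close>)
  also have "\<dots> = sc fps_X \<otimes>\<^bsub>CA\<^esub> ec ?j"
    unfolding ec_pc pc_def by (rule sc_cls(1)[symmetric]) (intro path_elem_closed arrow_paths j)
  finally show ?thesis .
qed

lemma xc_yc:
  assumes i: "i \<in> {1..n}"
  shows "xc i \<otimes>\<^bsub>CA\<^esub> yc i = sc fps_X \<otimes>\<^bsub>CA\<^esub> ec i"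
proof -
  have j: "cpred n i \<in> {1..n}" using i cpred_range[OF n_pos] by auto
  have "xc i \<otimes>\<^bsub>CA\<^esub> yc i = pc (i, [Yarr i, Xarr i])"
    unfolding xc_pc yc_pc using pc_mult[OF arrow_paths(2)[OF i] arrow_paths(1)[OF i]] n_pos by simp
  also have "\<dots> = cls (\<lambda>p. fps_X * path_elem (i, []) p)"
    unfolding pc_def
  proof (rule cls_eqI)
    have "(\<lambda>p. path_elem (i, [Yarr i, Xarr i]) p - fps_X * path_elem (i, []) p) \<in> circle_relators
        k n"
      unfolding circle_relators_def using i by blast
    then show "(\<lambda>p. path_elem (i, [Yarr i, Xarr i]) p - fps_X * path_elem (i, []) p) \<in>
        circle_ideal k n"
      unfolding circle_ideal_def using cls.R.genideal_self[OF circle_relators_closed[OF n_pos]] by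
          blast
  qed (use j i n_pos in \<open>auto intro!: path_elem_closed path_algebra_scale_closed simp:
      qpaths_simps\<close>)
  also have "\<dots> = sc fps_X \<otimes>\<^bsub>CA\<^esub> ec i"
    unfolding ec_pc pc_def by (rule sc_cls(1)[symmetric]) (intro path_elem_closed arrow_paths i)
  finally show ?thesis .
qed

section \<open>Powers of the arrows and the full cycle\<close>

lemma pc_xpow_ypow:
  assumes i: "i \<in> {1..n}"
  shows "pc (xpow n k i) = pc (ypow n (n - k) i)"
  unfolding pc_def
proof (rule cls_eqI)
  have "(\<lambda>p. path_elem (xpow n k i) p - path_elem (ypow n (n - k) i) p) \<in> circle_relators k n"
    unfolding circle_relators_def using i by blast
  then show "(\<lambda>p. path_elem (xpow n k i) p - path_elem (ypow n (n - k) i) p) \<in> circle_ideal k n"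
    unfolding circle_ideal_def using cls.R.genideal_self[OF circle_relators_closed[OF n_pos]] by
        blast
qed (use xpow_path[OF n_pos i] ypow_path[OF n_pos i] in \<open>auto intro!: path_elem_closed\<close>)

lemma pc_xpow_Suc:
  assumes i: "i \<in> {1..n}"
  shows "pc (xpow n (Suc m) i) = xc ((csucc n ^^ Suc m) i) \<otimes>\<^bsub>CA\<^esub> pc (xpow n m i)"
proof -
  let ?j = "(csucc n ^^ Suc m) i"
  have j: "?j \<in> {1..n}" "cpred n ?j = (csucc n ^^ m) i"
    using csucc_pow_range[OF n_pos i] cpred_csucc[OF n_pos] by (auto simp del: funpow.simps(2))
        (simp add: csucc_pow_range[OF n_pos i] cpred_csucc[OF n_pos])
  have x: "xpow n m i = (i, snd (xpow n m i))" by (simp add: xpow_def)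
  have "xpow n (Suc m) i = (i, snd (xpow n m i) @ [Xarr ?j])" by (simp add: xpow_def)
  moreover have "(i, snd (xpow n m i)) \<in> qpaths Qv" "path_end Qv (i, snd (xpow n m i)) = cpred n ?j"
    using xpow_path[OF n_pos i, of m] x j by auto
  ultimately show ?thesis
    using pc_mult[OF _ arrow_paths(1)[OF j(1)], of i "snd (xpow n m i)"] x by (simp add: xc_pc)
qed

lemma pc_xpow_add:
  assumes i: "i \<in> {1..n}"
  shows "pc (xpow n (a + b) i) = pc (xpow n b ((csucc n ^^ a) i)) \<otimes>\<^bsub>CA\<^esub> pc (xpow n a i)"
proof -
  let ?j = "(csucc n ^^ a) i"
  have j: "?j \<in> {1..n}" using csucc_pow_range[OF n_pos i] by auto
  have "snd (xpow n (a + b) i) = snd (xpow n a i) @ snd (xpow n b ?j)"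
  proof (induction b)
    case (Suc b)
    have "(csucc n ^^ Suc (a + b)) i = (csucc n ^^ Suc b) ((csucc n ^^ a) i)"
      by (metis add_Suc_right comp_apply funpow_add add.commute)
    then show ?case using Suc by (simp add: xpow_def del: funpow.simps)
  qed (simp add: xpow_def)
  then have "xpow n (a + b) i = (i, snd (xpow n a i) @ snd (xpow n b ?j))" by (simp add: xpow_def)
  moreover have "xpow n a i = (i, snd (xpow n a i))" "xpow n b ?j = (?j, snd (xpow n b ?j))" by
      (simp_all add: xpow_def)
  ultimately show ?thesis
    using pc_mult[of i "snd (xpow n a i)" ?j "snd (xpow n b ?j)"] xpow_path[OF n_pos i, of a]
        xpow_path[OF n_pos j, of b]
    by simp
qed

text \<open>The innermost factors \<open>x y\<close> collapse to \<open>t\<close>, which is central,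
  so the pairs cancel one after another from the inside.\<close>

lemma pc_xpow_cpred_ypow:
  assumes i: "i \<in> {1..n}"
  shows "pc (xpow n m ((cpred n ^^ m) i)) \<otimes>\<^bsub>CA\<^esub> pc (ypow n m i) = sc (fps_X ^ m) \<otimes>\<^bsub>CA\<^esub> ec i"
proof (induction m)
  case 0
  have "ec i \<otimes>\<^bsub>CA\<^esub> ec i = ec i" unfolding ec_pc using pc_mult[OF arrow_paths(3)[OF i]
      arrow_paths(3)[OF i]] by simp
  then show ?case using arrow_paths(3)[OF i] by (simp add: xpow_def ypow_def sc_one ec_pc)
next
  case (Suc m)
  let ?j = "(cpred n ^^ m) i"
  have j: "?j \<in> {1..n}" "cpred n ?j \<in> {1..n}" using cpred_pow_range[OF n_pos i] cpred_range[OF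
      n_pos] by auto
  have yp: "ypow n m i = (i, snd (ypow n m i))" by (simp add: ypow_def)
  have yq: "(i, snd (ypow n m i)) \<in> qpaths Qv" "path_end Qv (i, snd (ypow n m i)) = ?j"
    using ypow_path[OF n_pos i, of m] yp by auto
  have "ypow n (Suc m) i = (i, snd (ypow n m i) @ [Yarr ?j])" by (simp add: ypow_def)
  then have 1: "pc (ypow n (Suc m) i) = yc ?j \<otimes>\<^bsub>CA\<^esub> pc (ypow n m i)"
    using pc_mult[OF yq(1) arrow_paths(2)[OF j(1)]] yq yp by (simp add: yc_pc)
  have "(csucc n ^^ 1) (cpred n ?j) = ?j" using csucc_cpred[OF n_pos j(1)] by simp
  moreover have "pc (xpow n 1 (cpred n ?j)) = xc ?j" using csucc_cpred[OF n_pos j(1)] by (simp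
      add: xpow_def xc_pc)
  ultimately have 2: "pc (xpow n (Suc m) (cpred n ?j)) = pc (xpow n m ?j) \<otimes>\<^bsub>CA\<^esub> xc ?j"
    using pc_xpow_add[OF j(2), of 1 m] by simp
  have c: "pc (xpow n m ?j) \<in> carrier CA" "pc (ypow n m i) \<in> carrier CA"
    using xpow_path[OF n_pos j(1), of m] ypow_path[OF n_pos i, of m] by auto
  have ey: "ec ?j \<otimes>\<^bsub>CA\<^esub> pc (ypow n m i) = pc (ypow n m i)"
    unfolding ec_pc using pc_mult[OF yq(1) arrow_paths(3)[OF j(1)]] yq yp by simp
  have "pc (xpow n (Suc m) (cpred n ?j)) \<otimes>\<^bsub>CA\<^esub> pc (ypow n (Suc m) i) =
      pc (xpow n m ?j) \<otimes>\<^bsub>CA\<^esub> ((xc ?j \<otimes>\<^bsub>CA\<^esub> yc ?j) \<otimes>\<^bsub>CA\<^esub> pc (ypow n m i))"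
    unfolding 1 2 using c j by (simp add: cls.S.m_assoc)
  also have "\<dots> = pc (xpow n m ?j) \<otimes>\<^bsub>CA\<^esub> (sc fps_X \<otimes>\<^bsub>CA\<^esub> pc (ypow n m i))"
    unfolding xc_yc[OF j(1)] using c j ey by (simp add: cls.S.m_assoc)
  also have "\<dots> = sc fps_X \<otimes>\<^bsub>CA\<^esub> (pc (xpow n m ?j) \<otimes>\<^bsub>CA\<^esub> pc (ypow n m i))"
    using c sc_central[OF c(1), of fps_X] by (metis cls.S.m_assoc sc_closed)
  also have "\<dots> = sc (fps_X ^ Suc m) \<otimes>\<^bsub>CA\<^esub> ec i"
    unfolding Suc.IH using i by (simp add: cls.S.m_assoc[symmetric] sc_mult)
  finally show ?case by simp
qed

text \<open>\<open>x^n = x^(n-k) x^k = x^(n-k) y^(n-k) = t^(n-k)\<close>: the last relation replaces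
  \<open>k\<close> forward steps by \<open>n - k\<close> backward ones.\<close>

lemma pc_full_cycle:
  assumes i: "i \<in> {1..n}"
  shows "pc (xpow n n i) = sc (fps_X ^ (n - k)) \<otimes>\<^bsub>CA\<^esub> ec i"
proof -
  have "pc (xpow n n i) = pc (xpow n (n - k) ((csucc n ^^ k) i)) \<otimes>\<^bsub>CA\<^esub> pc (xpow n k i)"
    using pc_xpow_add[OF i, of k "n - k"] k_less by simp
  also have "(csucc n ^^ k) i = (cpred n ^^ (n - k)) i" using cpred_pow[OF n_pos i, of "n - k"]
      k_less by simp
  finally show ?thesis using pc_xpow_ypow[OF i] pc_xpow_cpred_ypow[OF i, of "n - k"] by simp
qed

end

section \<open>The localization as a matrix ring\<close>

lemma fps_to_fls_sum: "fps_to_fls (sum f A) = (\<Sum>x\<in>A. fps_to_fls (f x))"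
  by (induction A rule: infinite_finite_induct) auto

section \<open>Scalars and Laurent matrices on the localization\<close>

locale circle_loc = circle k n
  for k n :: nat and L :: "('l, 'y) ring_scheme" (structure) and \<iota> :: "path_fun set \<Rightarrow> 'l" +
  assumes loc_circle: "is_central_localization (circle_algebra k n) (scalar k n fps_X) L \<iota>"
begin

sublocale loc: central_localization CA L \<iota> "sc fps_X"
proof -
  have "ring CA" "ring L" "\<iota> \<in> ring_hom CA L"
    using loc_circle by (simp_all add: is_central_localization_def)
  then have "ring_hom_ring CA L \<iota>" by (rule ring_hom_ringI2)
  then show "central_localization CA L \<iota> (sc fps_X)"
    using loc_circle by (simp add: central_localization_def central_localization_axioms_def)
qed

lemma sc_pow: "sc r [^]\<^bsub>CA\<^esub> (m::nat) = sc (r ^ m)"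
  by (induction m) (simp_all add: sc_one sc_mult mult.commute)

definition \<sigma> :: "complex fps \<Rightarrow> 'l" where "\<sigma> r = \<iota> (sc r)"
abbreviation T :: "nat \<Rightarrow> 'l" where "T m \<equiv> \<sigma> (fps_X ^ m)"

lemma \<sigma>_closed [simp]: "\<sigma> r \<in> carrier L" by (simp add: \<sigma>_def)

lemma T_eq: "T m = \<iota> (sc fps_X [^]\<^bsub>CA\<^esub> m)" by (simp add: \<sigma>_def sc_pow)

lemma T_cancel: "\<lbrakk>x \<in> carrier L; y \<in> carrier L; T m \<otimes> x = T m \<otimes> y\<rbrakk> \<Longrightarrow> x = y"
  unfolding T_eq by (rule loc.s_pow_cancel)

lemma T_denominator:
  assumes "x \<in> carrier L"
  obtains m c where "c \<in> carrier CA" "T m \<otimes> x = \<iota> c"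
  using loc.denominator[OF assms] unfolding T_eq by blast

lemma T_inverse: "\<exists>u\<in>carrier L. T m \<otimes> u = \<one>"
  using loc.s_pow_unit[of m] unfolding T_eq Units_def by blast

lemma \<sigma>_mult: "\<sigma> r \<otimes> \<sigma> q = \<sigma> (r * q)"
  unfolding \<sigma>_def sc_mult[symmetric] by simp

lemma \<sigma>_one: "\<sigma> 1 = \<one>" and \<sigma>_zero: "\<sigma> 0 = \<zero>"
  by (simp_all add: \<sigma>_def sc_one sc_zero)

lemma \<sigma>_add: "\<sigma> r \<oplus> \<sigma> q = \<sigma> (r + q)"
  unfolding \<sigma>_def sc_add[symmetric] by simp

lemma \<sigma>_iota_central: "c \<in> carrier CA \<Longrightarrow> \<sigma> r \<otimes> \<iota> c = \<iota> c \<otimes> \<sigma> r"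
  using sc_central[of c r] unfolding \<sigma>_def by (metis loc.hom_mult sc_closed)

lemma \<sigma>_central:
  assumes x: "x \<in> carrier L"
  shows "\<sigma> r \<otimes> x = x \<otimes> \<sigma> r"
proof -
  obtain m c where c: "c \<in> carrier CA" "T m \<otimes> x = \<iota> c" using T_denominator[OF x] .
  have "T m \<otimes> (\<sigma> r \<otimes> x) = \<sigma> r \<otimes> (T m \<otimes> x)"
    using x by (simp add: loc.S.m_assoc[symmetric] \<sigma>_mult mult.commute)
  also have "\<dots> = T m \<otimes> (x \<otimes> \<sigma> r)"
    unfolding c(2) \<sigma>_iota_central[OF c(1)] using x by (simp add: c(2)[symmetric] loc.S.m_assoc)
  finally show ?thesis by (rule T_cancel[rotated 2]) (use x in simp_all)
qed

text \<open>Any \<open>k\<close>-set would do here: it only fixes the basis in which elements of \<open>L\<close> become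
  matrices.\<close>

definition J0 :: "nat set" where "J0 = {1..k}"

lemma k_set_J0: "k_set J0" using k_less by (simp add: k_set_def J0_def)

abbreviation mat0 :: "path_fun set \<Rightarrow> nat \<Rightarrow> nat \<Rightarrow> complex fps" where "mat0 \<equiv> mat J0"

text \<open>The kernel of \<iota> consists of \<open>t\<close>-torsion, while matrix entries are
  power series, where a power of \<open>t\<close> can be cancelled.\<close>

lemma mat_iota_zero:
  assumes J: "k_set J" and c: "c \<in> carrier CA" "\<iota> c = \<zero>"
  shows "mat J c i j = 0"
proof -
  obtain m :: nat where "sc fps_X [^]\<^bsub>CA\<^esub> m \<otimes>\<^bsub>CA\<^esub> c = \<zero>\<^bsub>CA\<^esub>" using loc.kernel_torsion[OF c] by blast
  then have "sc (fps_X ^ m) \<otimes>\<^bsub>CA\<^esub> c = sc 0 \<otimes>\<^bsub>CA\<^esub> c" using c by (simp add: sc_pow sc_zero)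
  then have "fps_X ^ m * mat J c i j = 0 * mat J c i j"
    using mat_sc_cls[OF J c(1), of "fps_X ^ m" i j] mat_sc_cls[OF J c(1), of 0 i j] by simp
  then show ?thesis by simp
qed

lemma mat_iota_eq:
  assumes J: "k_set J" and c: "c \<in> carrier CA" "d \<in> carrier CA" "\<iota> c = \<iota> d"
  shows "mat J c i j = mat J d i j"
proof -
  let ?e = "c \<oplus>\<^bsub>CA\<^esub> sc (-1) \<otimes>\<^bsub>CA\<^esub> d"
  have e: "?e \<in> carrier CA" using c by simp
  have "\<iota> ?e = \<sigma> 1 \<otimes> \<iota> d \<oplus> \<sigma> (-1) \<otimes> \<iota> d" using c by (simp add: \<sigma>_def sc_one)
  also have "\<dots> = \<zero>" using c by (simp add: loc.S.l_distr[symmetric] \<sigma>_add \<sigma>_zero)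
  finally have "mat J ?e i j = 0" by (rule mat_iota_zero[OF J e])
  then show ?thesis using c J by (simp add: mat_add mat_sc_cls)
qed

text \<open>The matrix of a fraction \<open>t^(-m) c\<close>. The pair of \<open>m\<close> and
  \<open>c\<close> is not unique; \<open>\<rho>_eq\<close> shows that the choice is
  harmless.\<close>

definition \<rho> :: "'l \<Rightarrow> nat \<Rightarrow> nat \<Rightarrow> complex fls" where
  "\<rho> l = (SOME M. \<exists>m. \<exists>c\<in>carrier CA. T m \<otimes> l = \<iota> c \<and> M = (\<lambda>i j. fps_to_fls (mat0 c i j) / fls_X ^
      m))"

text \<open>Two fractions for \<open>l\<close> are cross-multiplied in \<open>L\<close>. The
  equation is known only after applying \<iota>, so \<open>mat_iota_eq\<close> is what carries it to
  matrices.\<close>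

lemma \<rho>_eq:
  assumes "l \<in> carrier L" "c \<in> carrier CA" "T m \<otimes> l = \<iota> c"
  shows "fls_X ^ m * \<rho> l i j = fps_to_fls (mat0 c i j)"
proof -
  have "\<exists>M m. \<exists>c\<in>carrier CA. T m \<otimes> l = \<iota> c \<and> M = (\<lambda>i j. fps_to_fls (mat0 c i j) / fls_X ^ m)"
    using assms by blast
  from someI_ex[OF this] obtain q d where d: "d \<in> carrier CA" "T q \<otimes> l = \<iota> d"
    "\<rho> l = (\<lambda>i j. fps_to_fls (mat0 d i j) / fls_X ^ q)"
    unfolding \<rho>_def by blast
  have "T q \<otimes> \<iota> c = T m \<otimes> \<iota> d"
    unfolding assms(3)[symmetric] d(2)[symmetric] using assms(1)
    by (simp add: loc.S.m_assoc[symmetric] \<sigma>_mult mult.commute)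
  then have "\<iota> (sc (fps_X ^ q) \<otimes>\<^bsub>CA\<^esub> c) = \<iota> (sc (fps_X ^ m) \<otimes>\<^bsub>CA\<^esub> d)"
    using assms(2) d(1) by (simp add: \<sigma>_def)
  then have "mat0 (sc (fps_X ^ q) \<otimes>\<^bsub>CA\<^esub> c) i j = mat0 (sc (fps_X ^ m) \<otimes>\<^bsub>CA\<^esub> d) i j"
    using assms(2) d(1) by (intro mat_iota_eq[OF k_set_J0]) auto
  then have "fps_X ^ q * mat0 c i j = fps_X ^ m * mat0 d i j"
    using assms(2) d(1) by (simp add: mat_sc_cls[OF k_set_J0])
  then have "fps_to_fls (fps_X ^ q * mat0 c i j) = fps_to_fls (fps_X ^ m * mat0 d i j)" by simp
  then have "fls_X ^ q * fps_to_fls (mat0 c i j) = fls_X ^ m * fps_to_fls (mat0 d i j)"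
    by (simp add: fls_times_fps_to_fls fps_to_fls_power)
  moreover have "(fls_X :: complex fls) ^ q \<noteq> 0" by simp
  ultimately show ?thesis unfolding d(3)
    by (metis mult.commute nonzero_eq_divide_eq times_divide_eq_right)
qed

lemma fls_X_pow_cancel: "fls_X ^ m * (f::complex fls) = fls_X ^ m * g \<longleftrightarrow> f = g"
  by simp

lemma \<rho>_iota: "c \<in> carrier CA \<Longrightarrow> \<rho> (\<iota> c) i j = fps_to_fls (mat0 c i j)"
  using \<rho>_eq[of "\<iota> c" c 0 i j] by (simp add: \<sigma>_one)

lemma \<rho>_add:
  assumes x: "x \<in> carrier L" and y: "y \<in> carrier L"
  shows "\<rho> (x \<oplus> y) i j = \<rho> x i j + \<rho> y i j"
proof -
  obtain m c where c: "c \<in> carrier CA" "T m \<otimes> x = \<iota> c" using T_denominator[OF x] .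
  obtain q d where d: "d \<in> carrier CA" "T q \<otimes> y = \<iota> d" using T_denominator[OF y] .
  let ?e = "sc (fps_X ^ q) \<otimes>\<^bsub>CA\<^esub> c \<oplus>\<^bsub>CA\<^esub> sc (fps_X ^ m) \<otimes>\<^bsub>CA\<^esub> d"
  have "\<iota> ?e = T q \<otimes> \<iota> c \<oplus> T m \<otimes> \<iota> d"
    using c(1) d(1) by (simp add: \<sigma>_def)
  also have "\<dots> = T (m + q) \<otimes> (x \<oplus> y)"
    unfolding c(2)[symmetric] d(2)[symmetric]
    using x y by (simp add: loc.S.m_assoc[symmetric] \<sigma>_mult power_add mult.commute loc.S.r_distr)
  finally have eq: "T (m + q) \<otimes> (x \<oplus> y) = \<iota> ?e" by simp
  have e: "?e \<in> carrier CA" using c d by simp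
  have "fls_X ^ (m + q) * \<rho> (x \<oplus> y) i j = fps_to_fls (mat0 ?e i j)"
    by (rule \<rho>_eq[OF _ e eq]) (use x y in simp)
  also have "\<dots> = fls_X ^ q * fps_to_fls (mat0 c i j) + fls_X ^ m * fps_to_fls (mat0 d i j)"
    using c d by (simp add: mat_add[OF k_set_J0] mat_sc_cls[OF k_set_J0] fls_times_fps_to_fls
        fps_to_fls_power)
  also have "\<dots> = fls_X ^ (m + q) * (\<rho> x i j + \<rho> y i j)"
    unfolding \<rho>_eq[OF x c, symmetric] \<rho>_eq[OF y d, symmetric] by (simp add: power_add algebra_simps)
  finally show ?thesis unfolding fls_X_pow_cancel .
qed

lemma \<rho>_mult:
  assumes x: "x \<in> carrier L" and y: "y \<in> carrier L"
  shows "\<rho> (x \<otimes> y) i j = (\<Sum>p\<in>{1..n}. \<rho> x i p * \<rho> y p j)"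
proof -
  obtain m c where c: "c \<in> carrier CA" "T m \<otimes> x = \<iota> c" using T_denominator[OF x] .
  obtain q d where d: "d \<in> carrier CA" "T q \<otimes> y = \<iota> d" using T_denominator[OF y] .
  have "\<iota> (c \<otimes>\<^bsub>CA\<^esub> d) = (T m \<otimes> x) \<otimes> (T q \<otimes> y)"
    unfolding c(2) d(2) using c d by simp
  also have "\<dots> = T m \<otimes> ((x \<otimes> T q) \<otimes> y)" using x y by (simp add: loc.S.m_assoc)
  also have "\<dots> = T (m + q) \<otimes> (x \<otimes> y)"
    unfolding \<sigma>_central[OF x, symmetric] using x y
    by (simp add: loc.S.m_assoc[symmetric] \<sigma>_mult power_add)
  finally have eq: "T (m + q) \<otimes> (x \<otimes> y) = \<iota> (c \<otimes>\<^bsub>CA\<^esub> d)" by simp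
  have "fls_X ^ (m + q) * \<rho> (x \<otimes> y) i j = fps_to_fls (mat0 (c \<otimes>\<^bsub>CA\<^esub> d) i j)"
    by (rule \<rho>_eq[OF _ _ eq]) (use x y c d in simp_all)
  also have "\<dots> = (\<Sum>p\<in>{1..n}. fps_to_fls (mat0 c i p) * fps_to_fls (mat0 d p j))"
    using c d by (simp add: mat_mult[OF k_set_J0] fls_times_fps_to_fls fps_to_fls_sum)
  also have "\<dots> = fls_X ^ (m + q) * (\<Sum>p\<in>{1..n}. \<rho> x i p * \<rho> y p j)"
    unfolding \<rho>_eq[OF x c, symmetric] \<rho>_eq[OF y d, symmetric] sum_distrib_left
    by (intro sum.cong) (simp_all add: power_add algebra_simps)
  finally show ?thesis unfolding fls_X_pow_cancel .
qed

lemma \<rho>_scale: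
  assumes x: "x \<in> carrier L"
  shows "\<rho> (\<sigma> r \<otimes> x) i j = fps_to_fls r * \<rho> x i j"
proof -
  obtain m c where c: "c \<in> carrier CA" "T m \<otimes> x = \<iota> c" using T_denominator[OF x] .
  have "T m \<otimes> (\<sigma> r \<otimes> x) = \<sigma> r \<otimes> (T m \<otimes> x)"
    using x by (simp add: loc.S.m_assoc[symmetric] \<sigma>_mult mult.commute)
  also have "\<dots> = \<iota> (sc r \<otimes>\<^bsub>CA\<^esub> c)" using c by (simp add: \<sigma>_def)
  finally have eq: "T m \<otimes> (\<sigma> r \<otimes> x) = \<iota> (sc r \<otimes>\<^bsub>CA\<^esub> c)" .
  have "fls_X ^ m * \<rho> (\<sigma> r \<otimes> x) i j = fps_to_fls (mat0 (sc r \<otimes>\<^bsub>CA\<^esub> c) i j)"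
    by (rule \<rho>_eq[OF _ _ eq]) (use x c in simp_all)
  also have "\<dots> = fls_X ^ m * (fps_to_fls r * \<rho> x i j)"
    using c by (simp add: mat_sc_cls[OF k_set_J0] fls_times_fps_to_fls \<rho>_eq[OF x c, symmetric]
        mult.left_commute)
  finally show ?thesis unfolding fls_X_pow_cancel .
qed

lemma \<rho>_minus:
  assumes x: "x \<in> carrier L" and y: "y \<in> carrier L"
  shows "\<rho> (x \<ominus> y) i j = \<rho> x i j - \<rho> y i j"
proof -
  have "x = (x \<ominus> y) \<oplus> y" using x y by algebra
  then have "\<rho> x i j = \<rho> (x \<ominus> y) i j + \<rho> y i j" using \<rho>_add[of "x \<ominus> y" y i j] x y by simp
  then show ?thesis by simp
qed

section \<open>Matrix units and faithfulness of the matrix representation\<close>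

definition stp :: "nat \<Rightarrow> nat \<Rightarrow> nat" where
  "stp i j = (LEAST m. (csucc n ^^ m) j = i)"

lemma stp:
  assumes "i \<in> {1..n}" "j \<in> {1..n}"
  shows "stp i j < n" "(csucc n ^^ stp i j) j = i"
proof -
  obtain m where m: "m < n" "(csucc n ^^ m) j = i" using csucc_pow_surj[OF n_pos assms(2,1)] .
  then show "(csucc n ^^ stp i j) j = i" unfolding stp_def by (intro LeastI)
  have "stp i j \<le> m" unfolding stp_def by (rule Least_le) (rule m)
  then show "stp i j < n" using m by simp
qed

lemma stp_eqI:
  assumes "j \<in> {1..n}" "m < n" "(csucc n ^^ m) j = i"
  shows "stp i j = m"
proof -
  have "stp i j \<le> m" unfolding stp_def by (rule Least_le) (rule assms)
  moreover have "(csucc n ^^ stp i j) j = i" unfolding stp_def by (rule LeastI) (rule assms)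
  ultimately show ?thesis using csucc_pow_inj[OF n_pos assms(1), of "stp i j" m] assms by simp
qed

abbreviation cyc_path :: "nat \<Rightarrow> nat \<Rightarrow> (nat, arrow) qpath" where
  "cyc_path i j \<equiv> xpow n (stp i j) j"

lemma cyc_path:
  assumes "i \<in> {1..n}" "j \<in> {1..n}"
  shows "cyc_path i j \<in> qpaths Qv" "path_end Qv (cyc_path i j) = i" "fst (cyc_path i j) = j"
  using xpow_path[OF n_pos assms(2), of "stp i j"] stp[OF assms] by (auto simp: xpow_def)

abbreviation wt :: "(nat, arrow) qpath \<Rightarrow> nat" where "wt p \<equiv> path_wt J0 (snd p)"

text \<open>The matrix unit \<open>E\<^sub>i\<^sub>j\<close>: any path from \<open>j\<close> to \<open>i\<close>, divided by the power of \<open>t\<close> by which it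
  acts.\<close>

definition G :: "nat \<Rightarrow> nat \<Rightarrow> 'l" where
  "G i j = (SOME g. g \<in> carrier L \<and> T (wt (cyc_path i j)) \<otimes> g = \<iota> (pc (cyc_path i j)))"

lemma G:
  assumes "i \<in> {1..n}" "j \<in> {1..n}"
  shows "G i j \<in> carrier L" "T (wt (cyc_path i j)) \<otimes> G i j = \<iota> (pc (cyc_path i j))"
proof -
  obtain u where u: "u \<in> carrier L" "T (wt (cyc_path i j)) \<otimes> u = \<one>" using T_inverse by blast
  let ?q = "\<iota> (pc (cyc_path i j))"
  have q: "?q \<in> carrier L" using cyc_path[OF assms] by simp
  have "\<exists>g. g \<in> carrier L \<and> T (wt (cyc_path i j)) \<otimes> g = ?q"
    using u q by (intro exI[of _ "u \<otimes> ?q"]) (simp add: loc.S.m_assoc[symmetric])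
  from someI_ex[OF this] show "G i j \<in> carrier L" "T (wt (cyc_path i j)) \<otimes> G i j = \<iota> (pc (cyc_path
      i j))"
    unfolding G_def by blast+
qed

lemma fps_X_pow_inj: "(fps_X :: complex fps) ^ a = fps_X ^ b \<Longrightarrow> a = b"
  by (drule arg_cong[where f = subdegree]) simp

text \<open>The full cycle is the scalar \<open>t^(n-k)\<close>, and its diagonal matrix entry is
  \<open>t\<close> to the weight; comparing exponents saves a count.\<close>

lemma wt_full_cycle:
  assumes i: "i \<in> {1..n}"
  shows "wt (xpow n n i) = n - k"
proof -
  have e: "path_end Qv (xpow n n i) = i" "xpow n n i \<in> qpaths Qv" "fst (xpow n n i) = i"
    using xpow_path[OF n_pos i, of n] csucc_pow_n[OF n_pos i] by (auto simp: xpow_def)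
  have "mat0 (pc (xpow n n i)) i i = fps_X ^ wt (xpow n n i)" using mat_pc[OF k_set_J0 e(2)] e by
      simp
  moreover have "mat0 (pc (xpow n n i)) i i = fps_X ^ (n - k)"
    unfolding pc_full_cycle[OF i] using i by (simp add: mat_sc_cls[OF k_set_J0] mat_gens(3)[OF
        k_set_J0])
  ultimately show ?thesis using fps_X_pow_inj by metis
qed

lemma T_add: "x \<in> carrier L \<Longrightarrow> T a \<otimes> (T b \<otimes> x) = T (a + b) \<otimes> x"
  by (simp add: loc.S.m_assoc[symmetric] \<sigma>_mult power_add)

lemma T_comm:
  assumes x: "x \<in> carrier L" and y: "y \<in> carrier L"
  shows "T a \<otimes> (x \<otimes> y) = x \<otimes> (T a \<otimes> y)"
proof -
  have "T a \<otimes> (x \<otimes> y) = (x \<otimes> T a) \<otimes> y"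
    using x y by (simp add: loc.S.m_assoc[symmetric] \<sigma>_central)
  then show ?thesis using x y by (simp add: loc.S.m_assoc)
qed

lemma G_self:
  assumes j: "j \<in> {1..n}"
  shows "G j j = \<iota> (ec j)"
proof -
  have "stp j j = 0" by (rule stp_eqI[OF j]) (simp_all add: n_pos)
  then have "cyc_path j j = (j, [])" by (simp add: xpow_def)
  then show ?thesis using G[OF j j] by (simp add: \<sigma>_one ec_pc)
qed

text \<open>Appending \<open>x\<close> to the chosen path gives the chosen path to the next vertex,
  except when the circle closes: there the chosen path is trivial, and the full cycle is absorbed by
  the scalar \<open>t^(n-k)\<close>.\<close>

lemma G_x:
  assumes i: "i \<in> {1..n}" and j: "j \<in> {1..n}"
  shows "\<iota> (xc (csucc n i)) \<otimes> G i j = T (arrow_wt J0 (Xarr (csucc n i))) \<otimes> G (csucc n i) j"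
proof -
  let ?m = "stp i j" and ?i = "csucc n i"
  let ?a = "arrow_wt J0 (Xarr ?i)" and ?W = "wt (cyc_path i j)"
  have si: "?i \<in> {1..n}" using csucc_range[OF n_pos i] .
  have suc: "(csucc n ^^ Suc ?m) j = ?i" using stp(2)[OF i j] by simp
  have wS: "wt (xpow n (Suc ?m) j) = ?W + ?a" using stp(2)[OF i j] by (simp add: xpow_def)
  have "T ?W \<otimes> (\<iota> (xc ?i) \<otimes> G i j) = \<iota> (xc ?i) \<otimes> \<iota> (pc (cyc_path i j))"
    unfolding G(2)[OF i j, symmetric] using si G(1)[OF i j] by (intro T_comm) auto
  also have "\<dots> = \<iota> (pc (xpow n (Suc ?m) j))"
    unfolding pc_xpow_Suc[OF j] suc using si cyc_path(1)[OF i j] by simp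
  also have "\<dots> = T (?W + ?a) \<otimes> G ?i j"
  proof (cases "Suc ?m < n")
    case True
    have "stp ?i j = Suc ?m" by (rule stp_eqI[OF j True suc])
    then show ?thesis using G(2)[OF si j] wS by simp
  next
    case False
    then have sn: "Suc ?m = n" using stp(1)[OF i j] by simp
    then have "?i = j" using suc csucc_pow_n[OF n_pos j] by simp
    then have "?W + ?a = n - k" using wS wt_full_cycle[OF j] sn by simp
    then show ?thesis unfolding sn pc_full_cycle[OF j] \<open>?i = j\<close> G_self[OF j]
      using j by (simp add: \<sigma>_def)
  qed
  also have "\<dots> = T ?W \<otimes> (T ?a \<otimes> G ?i j)" by (rule T_add[symmetric]) (rule G(1)[OF si j])
  finally show ?thesis by (rule T_cancel[rotated 2]) (use si G(1)[OF i j] G(1)[OF si j] in auto)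
qed

lemma G_e:
  assumes i: "i \<in> {1..n}" and j: "j \<in> {1..n}"
  shows "\<iota> (ec i) \<otimes> G i j = G i j"
proof -
  let ?W = "wt (cyc_path i j)" and ?q = "cyc_path i j"
  have "T ?W \<otimes> (\<iota> (ec i) \<otimes> G i j) = \<iota> (ec i) \<otimes> \<iota> (pc ?q)"
    unfolding G(2)[OF i j, symmetric] using i G(1)[OF i j] by (intro T_comm) auto
  also have "\<dots> = \<iota> (ec i \<otimes>\<^bsub>CA\<^esub> pc ?q)" using i cyc_path(1)[OF i j] by simp
  also have "ec i \<otimes>\<^bsub>CA\<^esub> pc ?q = pc ?q"
    using pc_mult[of j "snd ?q" i "[]"] cyc_path[OF i j] arrow_paths(3)[OF i] by (simp add: ec_pc
        xpow_def)
  finally have "T ?W \<otimes> (\<iota> (ec i) \<otimes> G i j) = T ?W \<otimes> G i j" using G(2)[OF i j] by simp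
  then show ?thesis by (rule T_cancel[rotated 2]) (use i G(1)[OF i j] in auto)
qed

text \<open>Derived from the rule for \<open>x\<close>: multiply by the power of \<open>t\<close>
  belonging to \<open>x_i\<close>, rewrite as \<open>y_i x_i\<close> times the previous matrix unit,
  and use \<open>y_i x_i = t\<close>.\<close>

lemma G_y:
  assumes i: "i \<in> {1..n}" and j: "j \<in> {1..n}"
  shows "\<iota> (yc i) \<otimes> G i j = T (arrow_wt J0 (Yarr i)) \<otimes> G (cpred n i) j"
proof -
  let ?p = "cpred n i" and ?a = "arrow_wt J0 (Xarr i)" and ?b = "arrow_wt J0 (Yarr i)"
  have p: "?p \<in> {1..n}" "csucc n ?p = i" using cpred_range[OF n_pos i] csucc_cpred[OF n_pos i] by
      auto
  have ab: "?a + ?b = 1" by (simp add: arrow_wt_def)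
  have "T ?a \<otimes> (\<iota> (yc i) \<otimes> G i j) = \<iota> (yc i) \<otimes> (T ?a \<otimes> G i j)"
    using i G(1)[OF i j] by (intro T_comm) auto
  also have "\<dots> = \<iota> (yc i \<otimes>\<^bsub>CA\<^esub> xc i) \<otimes> G ?p j"
    using G_x[OF p(1) j] i G(1)[OF p(1) j] by (simp add: p(2) loc.S.m_assoc)
  also have "\<dots> = T 1 \<otimes> (\<iota> (ec ?p) \<otimes> G ?p j)"
    unfolding yc_xc[OF i] using p G(1)[OF p(1) j] by (simp add: \<sigma>_def loc.S.m_assoc)
  also have "\<dots> = T ?a \<otimes> (T ?b \<otimes> G ?p j)"
    unfolding G_e[OF p(1) j] T_add[OF G(1)[OF p(1) j]] ab ..
  finally show ?thesis by (rule T_cancel[rotated 2]) (use i G(1)[OF i j] G(1)[OF p(1) j] in auto)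
qed

text \<open>Here all paths between two vertices become proportional, although the chosen one uses
  only arrows \<open>x\<close>.\<close>

lemma iota_path:
  assumes "(u, w) \<in> qpaths Qv"
  shows "\<iota> (pc (u, w)) = T (path_wt J0 w) \<otimes> G (path_end Qv (u, w)) u"
  using assms
proof (induction w rule: rev_induct)
  case Nil
  then have "u \<in> {1..n}" using n_pos by (simp add: qpaths_simps)
  then show ?case using G_self[of u] by (simp add: ec_pc[symmetric] \<sigma>_one)
next
  case (snoc a w)
  note ap = wf_digraph.qpaths_append[OF circle_quiver_wf[OF n_pos], of u w "[a]"]
  have 1: "(u, w) \<in> qpaths Qv" "(path_end Qv (u, w), [a]) \<in> qpaths Qv" using snoc.prems ap by auto
  let ?v = "path_end Qv (u, w)"
  have u: "u \<in> {1..n}" using wf_digraph.qpaths_verts[OF circle_quiver_wf[OF n_pos] 1(1)] n_pos by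
      simp
  have v: "?v \<in> {1..n}" using wf_digraph.path_end_verts[OF circle_quiver_wf[OF n_pos] 1(1)] n_pos
      by simp
  have end': "path_end Qv (u, w @ [a]) = head Qv a" by (simp add: path_end_append)
  have step: "\<iota> (pc (?v, [a])) \<otimes> G ?v u = T (arrow_wt J0 a) \<otimes> G (head Qv a) u \<and> head Qv a \<in> {1..n}"
  proof (cases a)
    case (Xarr i)
    then have i: "i \<in> {1..n}" "?v = cpred n i" using 1(2) by (auto simp: qpaths_simps n_pos)
    then show ?thesis using G_x[OF v u] Xarr csucc_cpred[OF n_pos i(1)] n_pos by (simp add: xc_pc)
  next
    case (Yarr i)
    then have i: "i \<in> {1..n}" "?v = i" using 1(2) by (auto simp: qpaths_simps n_pos)
    then show ?thesis using G_y[OF v u] Yarr cpred_range[OF n_pos i(1)] n_pos by (simp add: yc_pc)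
  qed
  have Gv: "G ?v u \<in> carrier L" "G (head Qv a) u \<in> carrier L" using G(1) u v step by auto
  have "\<iota> (pc (u, w @ [a])) = \<iota> (pc (?v, [a])) \<otimes> \<iota> (pc (u, w))"
    using pc_mult[OF 1] loc.hom_mult[OF pc_closed[OF 1(2)] pc_closed[OF 1(1)]] by simp
  also have "\<dots> = T (path_wt J0 w) \<otimes> (\<iota> (pc (?v, [a])) \<otimes> G ?v u)"
    unfolding snoc.IH[OF 1(1)] using 1 Gv by (intro T_comm[symmetric]) auto
  also have "\<dots> = T (path_wt J0 (w @ [a])) \<otimes> G (head Qv a) u"
    using step T_add[OF Gv(2)] by simp
  finally show ?case unfolding end' .
qed

text \<open>Compression by idempotents leaves only paths from \<open>j\<close> to \<open>i\<close>,
  all of them multiples of \<open>G i j\<close>. It follows that the matrix of \<open>c\<close>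
  determines \<open>\<iota> c\<close>.\<close>

lemma iota_entry:
  assumes c: "c \<in> carrier CA" and i: "i \<in> {1..n}" and j: "j \<in> {1..n}"
  shows "\<iota> (ec i \<otimes>\<^bsub>CA\<^esub> c \<otimes>\<^bsub>CA\<^esub> ec j) = \<sigma> (mat0 c i j) \<otimes> G i j"
proof -
  obtain f where f: "f \<in> carrier PA" "c = cls f" using CA_cases[OF c] .
  note Gc = G(1)[OF i j]
  have e: "ec i \<in> carrier CA" "ec j \<in> carrier CA" using i j by auto
  from f(1) have "\<iota> (ec i \<otimes>\<^bsub>CA\<^esub> cls f \<otimes>\<^bsub>CA\<^esub> ec j) = \<sigma> (mat0 (cls f) i j) \<otimes> G i j"
  proof (induction f rule: path_algebra_induct)
    case zero
    have "cls (\<lambda>_. 0) = sc 0" using cls.hom_zero by (simp add: path_algebra_simps(4) sc_zero)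
    then show ?case using mat_sc[OF k_set_J0 j, of 0 i] e Gc by (simp add: sc_zero \<sigma>_zero)
  next
    case (add f g)
    have eq: "cls (\<lambda>p. f p + g p) = cls f \<oplus>\<^bsub>CA\<^esub> cls g"
      using cls.hom_add[OF add(1,2)] unfolding path_algebra_simps(5) .
    have "\<iota> (ec i \<otimes>\<^bsub>CA\<^esub> (cls f \<oplus>\<^bsub>CA\<^esub> cls g) \<otimes>\<^bsub>CA\<^esub> ec j) =
        \<iota> (ec i \<otimes>\<^bsub>CA\<^esub> cls f \<otimes>\<^bsub>CA\<^esub> ec j) \<oplus> \<iota> (ec i \<otimes>\<^bsub>CA\<^esub> cls g \<otimes>\<^bsub>CA\<^esub> ec j)"
      using e add(1,2) by (simp add: cls.S.l_distr cls.S.r_distr loc.S.l_distr loc.S.r_distr)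
    then show ?case unfolding eq using add e Gc
      by (simp only: mat_add[OF k_set_J0 cls.hom_closed[OF add(1)] cls.hom_closed[OF add(2)]]
          \<sigma>_add[symmetric]
          loc.S.l_distr[OF \<sigma>_closed \<sigma>_closed Gc])
  next
    case (elem r p)
    obtain u w where p: "p = (u, w)" by (cases p)
    have pq: "(u, w) \<in> qpaths Qv" using elem p by simp
    have pcc: "pc (u, w) \<in> carrier CA" using pq by simp
    have eq: "cls (\<lambda>q. r * path_elem p q) = sc r \<otimes>\<^bsub>CA\<^esub> pc (u, w)"
      using sc_cls(1)[OF path_elem_closed[OF elem]] by (simp add: pc_def p)
    have left: "ec i \<otimes>\<^bsub>CA\<^esub> pc (u, w) = (if i = path_end Qv (u, w) then pc (u, w) else \<zero>\<^bsub>CA\<^esub>)"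
      using pc_mult[OF pq arrow_paths(3)[OF i]] by (simp add: ec_pc)
    have right: "pc (u, w) \<otimes>\<^bsub>CA\<^esub> ec j = (if u = j then pc (u, w) else \<zero>\<^bsub>CA\<^esub>)"
      using pc_mult[OF arrow_paths(3)[OF j] pq] by (auto simp: ec_pc)
    have "ec i \<otimes>\<^bsub>CA\<^esub> (sc r \<otimes>\<^bsub>CA\<^esub> pc (u, w)) \<otimes>\<^bsub>CA\<^esub> ec j = sc r \<otimes>\<^bsub>CA\<^esub> ((ec i \<otimes>\<^bsub>CA\<^esub> pc (u, w)) \<otimes>\<^bsub>CA\<^esub>
        ec j)"
    proof -
      have "ec i \<otimes>\<^bsub>CA\<^esub> (sc r \<otimes>\<^bsub>CA\<^esub> pc (u, w)) = (sc r \<otimes>\<^bsub>CA\<^esub> ec i) \<otimes>\<^bsub>CA\<^esub> pc (u, w)"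
        unfolding sc_central[OF e(1)] using e pcc by (simp add: cls.S.m_assoc)
      then show ?thesis using e pcc by (simp add: cls.S.m_assoc)
    qed
    also have "\<dots> = (if i = path_end Qv (u, w) \<and> u = j then sc r \<otimes>\<^bsub>CA\<^esub> pc (u, w) else \<zero>\<^bsub>CA\<^esub>)"
      unfolding left using right e by auto
    finally have L: "ec i \<otimes>\<^bsub>CA\<^esub> (sc r \<otimes>\<^bsub>CA\<^esub> pc (u, w)) \<otimes>\<^bsub>CA\<^esub> ec j =
        (if i = path_end Qv (u, w) \<and> u = j then sc r \<otimes>\<^bsub>CA\<^esub> pc (u, w) else \<zero>\<^bsub>CA\<^esub>)" .
    have M: "mat0 (sc r \<otimes>\<^bsub>CA\<^esub> pc (u, w)) i j = (if i = path_end Qv (u, w) \<and> u = j then r * fps_X ^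
        path_wt J0 w else 0)"
      using mat_sc_cls[OF k_set_J0 pcc] mat_pc[OF k_set_J0 pq] by auto
    show ?case unfolding eq L M
    proof (cases "i = path_end Qv (u, w) \<and> u = j")
      case True
      then show "\<iota> (if i = path_end Qv (u, w) \<and> u = j then sc r \<otimes>\<^bsub>CA\<^esub> pc (u, w) else \<zero>\<^bsub>CA\<^esub>) =
        \<sigma> (if i = path_end Qv (u, w) \<and> u = j then r * fps_X ^ path_wt J0 w else 0) \<otimes> G i j"
        using iota_path[OF pq] pcc Gc by (simp add: \<sigma>_def[symmetric] \<sigma>_mult[symmetric]
            loc.S.m_assoc)
    next
      case False
      show "\<iota> (if i = path_end Qv (u, w) \<and> u = j then sc r \<otimes>\<^bsub>CA\<^esub> pc (u, w) else \<zero>\<^bsub>CA\<^esub>) =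
        \<sigma> (if i = path_end Qv (u, w) \<and> u = j then r * fps_X ^ path_wt J0 w else 0) \<otimes> G i j"
        unfolding if_not_P[OF False] using Gc by (simp add: \<sigma>_zero)
    qed
  qed
  then show ?thesis using f by simp
qed

text \<open>Stands for the decomposition of the unit into vertex idempotents; as an induction rule
  it avoids finite sums in the quotient ring.\<close>

lemma one_idem_induct:
  assumes "P \<zero>\<^bsub>CA\<^esub>" "\<And>i. i \<in> {1..n} \<Longrightarrow> P (ec i)"
    "\<And>c d. \<lbrakk>c \<in> carrier CA; d \<in> carrier CA; P c; P d\<rbrakk> \<Longrightarrow> P (c \<oplus>\<^bsub>CA\<^esub> d)"
  shows "P \<one>\<^bsub>CA\<^esub>"
proof -
  let ?u = "\<lambda>F (v, w). if v \<in> F \<and> w = [] then 1 else 0 :: complex fps"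
  have "F \<subseteq> {1..n} \<Longrightarrow> ?u F \<in> carrier PA \<and> P (cls (?u F))" if "finite F" for F
    using that
  proof (induction F rule: finite_induct)
    case empty
    have "?u {} = \<zero>\<^bsub>PA\<^esub>" by (auto simp: path_algebra_simps(4))
    then show ?case using assms(1) by (simp only:) simp
  next
    case (insert x F)
    then have IH: "?u F \<in> carrier PA" "P (cls (?u F))" and x: "x \<in> {1..n}" by auto
    have xe: "path_elem (x, []) \<in> carrier PA" using arrow_paths(3)[OF x] by (rule path_elem_closed)
    have eq: "?u (insert x F) = ?u F \<oplus>\<^bsub>PA\<^esub> path_elem (x, [])"
      using insert.hyps by (auto simp: path_algebra_simps(5) path_elem_def fun_eq_iff)
    have "cls (?u F \<oplus>\<^bsub>PA\<^esub> path_elem (x, [])) = cls (?u F) \<oplus>\<^bsub>CA\<^esub> ec x"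
      using cls.hom_add[OF IH(1) xe] by (simp add: idem_def)
    then show ?case unfolding eq using assms(3)[OF _ _ IH(2) assms(2)[OF x]] IH(1) x xe by simp
  qed
  then have "P (cls (?u {1..n}))" by blast
  moreover have "?u {1..n} = \<one>\<^bsub>PA\<^esub>" using n_pos by (auto simp: path_algebra_simps(3) fun_eq_iff)
  ultimately show ?thesis by simp
qed

text \<open>The unit is inserted on both sides as a sum of idempotents, and each resulting corner
  vanishes by \<open>iota_entry\<close>.\<close>

lemma iota_zero_of_mat:
  assumes c: "c \<in> carrier CA" and z: "\<And>i j. \<lbrakk>i \<in> {1..n}; j \<in> {1..n}\<rbrakk> \<Longrightarrow> mat0 c i j = 0"
  shows "\<iota> c = \<zero>"
proof -
  have 1: "\<iota> (ec i \<otimes>\<^bsub>CA\<^esub> c \<otimes>\<^bsub>CA\<^esub> ec j) = \<zero>" if "i \<in> {1..n}" "j \<in> {1..n}" for i j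
    using iota_entry[OF c that] z[OF that] G(1)[OF that] by (simp add: \<sigma>_zero)
  have 2: "\<iota> (ec i \<otimes>\<^bsub>CA\<^esub> c \<otimes>\<^bsub>CA\<^esub> \<one>\<^bsub>CA\<^esub>) = \<zero>" if i: "i \<in> {1..n}" for i
  proof (rule one_idem_induct[where P = "\<lambda>d. \<iota> (ec i \<otimes>\<^bsub>CA\<^esub> c \<otimes>\<^bsub>CA\<^esub> d) = \<zero>"])
    fix a b assume "a \<in> carrier CA" "b \<in> carrier CA" "\<iota> (ec i \<otimes>\<^bsub>CA\<^esub> c \<otimes>\<^bsub>CA\<^esub> a) = \<zero>" "\<iota> (ec i \<otimes>\<^bsub>CA\<^esub>
        c \<otimes>\<^bsub>CA\<^esub> b) = \<zero>"
    then show "\<iota> (ec i \<otimes>\<^bsub>CA\<^esub> c \<otimes>\<^bsub>CA\<^esub> (a \<oplus>\<^bsub>CA\<^esub> b)) = \<zero>"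
      using i c by (simp add: loc.S.r_distr)
  qed (use 1 i c in auto)
  have "\<iota> (\<one>\<^bsub>CA\<^esub> \<otimes>\<^bsub>CA\<^esub> c) = \<zero>"
  proof (rule one_idem_induct[where P = "\<lambda>d. \<iota> (d \<otimes>\<^bsub>CA\<^esub> c) = \<zero>"])
    fix i assume "i \<in> {1..n}"
    then show "\<iota> (ec i \<otimes>\<^bsub>CA\<^esub> c) = \<zero>" using 2[of i] c by simp
  next
    fix a b assume "a \<in> carrier CA" "b \<in> carrier CA" "\<iota> (a \<otimes>\<^bsub>CA\<^esub> c) = \<zero>" "\<iota> (b \<otimes>\<^bsub>CA\<^esub> c) = \<zero>"
    then show "\<iota> ((a \<oplus>\<^bsub>CA\<^esub> b) \<otimes>\<^bsub>CA\<^esub> c) = \<zero>" using c by (simp add: loc.S.l_distr)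
  qed (use c in auto)
  then show ?thesis using c by simp
qed

lemma \<rho>_inj:
  assumes x: "x \<in> carrier L" and y: "y \<in> carrier L"
    and eq: "\<And>i j. \<lbrakk>i \<in> {1..n}; j \<in> {1..n}\<rbrakk> \<Longrightarrow> \<rho> x i j = \<rho> y i j"
  shows "x = y"
proof -
  have d: "x \<ominus> y \<in> carrier L" using x y by simp
  obtain m c where c: "c \<in> carrier CA" "T m \<otimes> (x \<ominus> y) = \<iota> c" using T_denominator[OF d] .
  have "\<iota> c = \<zero>"
  proof (rule iota_zero_of_mat[OF c(1)])
    fix i j assume ij: "i \<in> {1..n}" "j \<in> {1..n}"
    have "fps_to_fls (mat0 c i j) = 0"
      using \<rho>_eq[OF d c, of i j] \<rho>_minus[OF x y, of i j] eq[OF ij] by simp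
    then show "mat0 c i j = 0" by simp
  qed
  then have "T m \<otimes> (x \<ominus> y) = T m \<otimes> \<zero>" using c by simp
  then have "x \<ominus> y = \<zero>" by (rule T_cancel[rotated 2]) (use d in auto)
  then show ?thesis using x y by simp
qed

lemma \<rho>_G:
  assumes i: "i \<in> {1..n}" and j: "j \<in> {1..n}"
  shows "\<rho> (G i j) a b = (if a = i \<and> b = j then 1 else 0)"
proof -
  let ?W = "wt (cyc_path i j)"
  have "fls_X ^ ?W * \<rho> (G i j) a b = fps_to_fls (mat0 (pc (cyc_path i j)) a b)"
    by (rule \<rho>_eq[OF G(1)[OF i j] _ G(2)[OF i j]]) (use cyc_path[OF i j] in simp)
  also have "\<dots> = fls_X ^ ?W * (if a = i \<and> b = j then 1 else 0)"
    using mat_pc[OF k_set_J0 cyc_path(1)[OF i j]] cyc_path[OF i j] by (auto simp: fps_to_fls_power)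
  finally show ?thesis unfolding fls_X_pow_cancel .
qed

lemma fls_denominator: "\<exists>m r. fls_X ^ m * (f :: complex fls) = fps_to_fls r"
proof -
  let ?m = "nat (- fls_subdegree f)"
  have "0 \<le> fls_subdegree (fls_X ^ ?m * f)"
    by (cases "f = 0") (simp_all add: fls_subdegree_pow)
  then have "fls_X ^ ?m * f = fps_to_fls (fls_regpart (fls_X ^ ?m * f))" by simp
  then show ?thesis by blast
qed

definition elem :: "nat \<Rightarrow> nat \<Rightarrow> complex fls \<Rightarrow> 'l" where
  "elem i j f = (SOME x. x \<in> carrier L \<and> (\<forall>a b. \<rho> x a b = (if a = i \<and> b = j then f else 0)))"

lemma elem:
  assumes i: "i \<in> {1..n}" and j: "j \<in> {1..n}"
  shows "elem i j f \<in> carrier L" "\<rho> (elem i j f) a b = (if a = i \<and> b = j then f else 0)"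
proof -
  obtain m r where f: "fls_X ^ m * f = fps_to_fls r" using fls_denominator by blast
  obtain u where u: "u \<in> carrier L" "T m \<otimes> u = \<one>" using T_inverse by blast
  let ?x = "u \<otimes> (\<sigma> r \<otimes> G i j)"
  have x: "?x \<in> carrier L" using u G(1)[OF i j] by simp
  have "T m \<otimes> ?x = \<sigma> r \<otimes> G i j" using u G(1)[OF i j] by (simp add: loc.S.m_assoc[symmetric])
  then have "fls_X ^ m * \<rho> ?x a b = fps_to_fls r * \<rho> (G i j) a b" for a b
    using \<rho>_scale[OF x, of "fps_X ^ m" a b] \<rho>_scale[OF G(1)[OF i j], of r a b] by (simp add:
        fps_to_fls_power)
  then have "fls_X ^ m * \<rho> ?x a b = fls_X ^ m * (if a = i \<and> b = j then f else 0)" for a b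
    unfolding \<rho>_G[OF i j] f[symmetric] by simp
  then have "\<exists>x. x \<in> carrier L \<and> (\<forall>a b. \<rho> x a b = (if a = i \<and> b = j then f else 0))"
    unfolding fls_X_pow_cancel using x by blast
  from someI_ex[OF this] show "elem i j f \<in> carrier L" "\<rho> (elem i j f) a b = (if a = i \<and> b = j
      then f else 0)"
    unfolding elem_def by blast+
qed

end

section \<open>Orders as valuation lattices\<close>

definition vge :: "int \<Rightarrow> complex fls \<Rightarrow> bool" where
  "vge a f \<longleftrightarrow> f = 0 \<or> a \<le> fls_subdegree f"

definition Xp :: "int \<Rightarrow> complex fls" where "Xp a = fls_shift (- a) 1"

lemma Xp_simps [simp]: "Xp a \<noteq> 0" "fls_subdegree (Xp a) = a" "Xp 0 = 1"
  by (simp_all add: Xp_def)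

lemma Xp_mult: "Xp a * Xp b = Xp (a + b)"
  unfolding Xp_def by (rule fls_X_intpow_times_fls_X_intpow)

lemma Xp_power: "fls_X ^ m = Xp (int m)"
  by (simp add: Xp_def fls_X_power_conv_shift_1)

lemma vge_zero [simp]: "vge a 0" by (simp add: vge_def)

lemma vge_add: "\<lbrakk>vge a f; vge a g\<rbrakk> \<Longrightarrow> vge a (f + g)"
  using fls_plus_subdegree[of f g] unfolding vge_def by (cases "f = 0"; cases "g = 0"; cases "f +
      g = 0") auto

lemma vge_diff: "\<lbrakk>vge a f; vge a g\<rbrakk> \<Longrightarrow> vge a (f - g)"
  using fls_subdegree_minus[of f g] unfolding vge_def by (cases "f = 0"; cases "g = 0"; cases "f =
      g") auto

text \<open>Series congruent modulo \<open>t^a R\<close> satisfy the bound together; maps that are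
  linear only modulo \<open>B\<close> are followed by this rule.\<close>

lemma vge_diff_iff: "vge a (f - g) \<Longrightarrow> vge a f \<longleftrightarrow> vge a g"
  using vge_diff[of a f "f - g"] vge_add[of a "f - g" g] by auto

lemma vge_mono: "\<lbrakk>vge a f; b \<le> a\<rbrakk> \<Longrightarrow> vge b f" by (auto simp: vge_def)

lemma vge_mult: "\<lbrakk>vge a f; vge b g\<rbrakk> \<Longrightarrow> vge (a + b) (f * g)"
  by (cases "f = 0"; cases "g = 0") (auto simp: vge_def)

lemma vge_Xp [simp]: "vge a (Xp b) \<longleftrightarrow> a \<le> b" by (simp add: vge_def)

lemma vge_one [simp]: "vge a 1 \<longleftrightarrow> a \<le> 0" by (simp add: vge_def)

lemma vge_Xp_mult: "vge a (Xp b * f) \<longleftrightarrow> vge (a - b) f"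
  by (cases "f = 0") (auto simp: vge_def)

lemma vge_fps [simp]: "vge 0 (fps_to_fls r)"
  by (simp add: vge_def fls_subdegree_fls_to_fps_gt0)

lemma vge_fps_mult: "vge a f \<Longrightarrow> vge a (fps_to_fls r * f)"
  using vge_mult[OF vge_fps[of r], of a f] by simp

lemma vge_0_fps: "vge 0 f \<Longrightarrow> fps_to_fls (fls_regpart f) = f"
  by (auto simp: vge_def)

lemma vge_Xp_fps:
  assumes "vge a f"
  shows "f = fps_to_fls (fls_regpart (Xp (- a) * f)) * Xp a"
proof -
  have "vge 0 (Xp (- a) * f)" using assms by (simp add: vge_Xp_mult)
  then have "fps_to_fls (fls_regpart (Xp (- a) * f)) * Xp a = Xp (- a) * Xp a * f"
    using vge_0_fps by (simp add: mult_ac)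
  then show ?thesis by (simp add: Xp_mult)
qed

text \<open>The base factor of \<open>f\<close> has nonzero constant term, so it is a unit of
  \<open>R\<close>, and its inverse strips \<open>f\<close> to a pure power of
  \<open>t\<close>.\<close>

lemma fls_unit_normalize:
  assumes "f \<noteq> (0 :: complex fls)"
  obtains u where "fps_to_fls u * f = Xp (fls_subdegree f)"
proof
  let ?u = "fls_base_factor_to_fps f"
  have "f = Xp (fls_subdegree f) * fps_to_fls ?u"
    using fls_conv_base_factor_to_fps_shift_subdegree[of f]
    by (simp add: Xp_def fls_X_intpow_times_conv_shift)
  then have "fps_to_fls (inverse ?u) * f = Xp (fls_subdegree f) * fps_to_fls (inverse ?u * ?u)"
    unfolding fls_times_fps_to_fls by (metis mult.left_commute)
  then show "fps_to_fls (inverse ?u) * f = Xp (fls_subdegree f)"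
    using inverse_mult_eq_1[of ?u] fls_base_factor_to_fps_base[OF assms] by simp
qed

section \<open>Elementary matrices in the localization\<close>

context circle_loc
begin

text \<open>The exponent with which \<open>x_i\<close> acts in the reference basis;
  \<open>y_i\<close> acts with \<open>1 - \<epsilon> i\<close>.\<close>

definition \<epsilon> :: "nat \<Rightarrow> int" where "\<epsilon> i = (if i \<in> J0 then 0 else 1)"

lemma \<rho>_zero: "\<rho> \<zero> a b = 0"
  using \<rho>_scale[of "\<zero>" 0 a b] by simp

lemma \<rho>_elem_mult:
  assumes "i \<in> {1..n}" "j \<in> {1..n}" "x \<in> carrier L"
  shows "\<rho> (elem i j f \<otimes> x) a b = (if a = i then f * \<rho> x j b else 0)"
proof -
  have "\<rho> (elem i j f \<otimes> x) a b = (\<Sum>p\<in>{1..n}. if p = j then (if a = i then f * \<rho> x j b else 0) else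
      0)"
    unfolding \<rho>_mult[OF elem(1)[OF assms(1,2)] assms(3)] elem(2)[OF assms(1,2)]
    by (intro sum.cong) auto
  then show ?thesis using assms(2) by simp
qed

lemma \<rho>_mult_elem:
  assumes "i \<in> {1..n}" "j \<in> {1..n}" "x \<in> carrier L"
  shows "\<rho> (x \<otimes> elem i j f) a b = (if b = j then \<rho> x a i * f else 0)"
proof -
  have "\<rho> (x \<otimes> elem i j f) a b = (\<Sum>p\<in>{1..n}. if p = i then (if b = j then \<rho> x a i * f else 0) else
      0)"
    unfolding \<rho>_mult[OF assms(3) elem(1)[OF assms(1,2)]] elem(2)[OF assms(1,2)]
    by (intro sum.cong) auto
  then show ?thesis using assms(1) by simp
qed

lemma iota_gens:
  assumes i: "i \<in> {1..n}"
  shows "\<iota> (xc i) = elem i (cpred n i) (Xp (\<epsilon> i))" "\<iota> (yc i) = elem (cpred n i) i (Xp (1 - \<epsilon> i))"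
    "\<iota> (ec i) = elem i i 1"
proof -
  have p: "cpred n i \<in> {1..n}" using cpred_range[OF n_pos i] .
  show "\<iota> (xc i) = elem i (cpred n i) (Xp (\<epsilon> i))"
    by (rule \<rho>_inj) (use i p in \<open>auto simp: elem \<rho>_iota mat_gens[OF k_set_J0 i] \<epsilon>_def Xp_power[of
        1, simplified]\<close>)
  show "\<iota> (yc i) = elem (cpred n i) i (Xp (1 - \<epsilon> i))"
    by (rule \<rho>_inj) (use i p in \<open>auto simp: elem \<rho>_iota mat_gens[OF k_set_J0 i] \<epsilon>_def Xp_power[of
        1, simplified]\<close>)
  show "\<iota> (ec i) = elem i i 1"
    by (rule \<rho>_inj) (use i p in \<open>auto simp: elem \<rho>_iota mat_gens[OF k_set_J0 i]\<close>)
qed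

lemma elem_mult:
  assumes "i \<in> {1..n}" "j \<in> {1..n}" "l \<in> {1..n}"
  shows "elem i j f \<otimes> elem j l g = elem i l (f * g)"
  by (rule \<rho>_inj) (use assms in \<open>auto simp: elem \<rho>_elem_mult\<close>)

lemma \<sigma>_elem:
  assumes "i \<in> {1..n}" "j \<in> {1..n}"
  shows "\<sigma> r \<otimes> elem i j f = elem i j (fps_to_fls r * f)"
  by (rule \<rho>_inj) (use assms in \<open>auto simp: elem \<rho>_scale\<close>)

lemma e_mult_e:
  assumes "i \<in> {1..n}" "j \<in> {1..n}" "x \<in> carrier L"
  shows "\<iota> (ec i) \<otimes> x \<otimes> \<iota> (ec j) = elem i j (\<rho> x i j)"
  by (rule \<rho>_inj) (use assms in \<open>auto simp: elem iota_gens \<rho>_elem_mult \<rho>_mult_elem\<close>)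

text \<open>A partial sum over a set of positions is characterised by its matrix and recognised as
  \<open>x\<close> at the end by injectivity of \<rho>.\<close>

lemma elem_decomp:
  assumes x: "x \<in> carrier L" and P: "\<And>i j. \<lbrakk>i \<in> {1..n}; j \<in> {1..n}\<rbrakk> \<Longrightarrow> P (elem i j (\<rho> x i j))"
    and zero: "P \<zero>" and add: "\<And>y z. \<lbrakk>y \<in> carrier L; z \<in> carrier L; P y; P z\<rbrakk> \<Longrightarrow> P (y \<oplus> z)"
  shows "P x"
proof -
  have "F \<subseteq> {1..n} \<times> {1..n} \<Longrightarrow> \<exists>y\<in>carrier L. P y \<and> (\<forall>i\<in>{1..n}. \<forall>j\<in>{1..n}. \<rho> y i j = (if (i, j) \<in> F
      then \<rho> x i j else 0))"
    if "finite F" for F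
    using that
  proof (induction F rule: finite_induct)
    case empty
    then show ?case using zero \<rho>_zero by (intro bexI[of _ "\<zero>"]) auto
  next
    case (insert q F)
    obtain a b where q: "q = (a, b)" "a \<in> {1..n}" "b \<in> {1..n}" using insert.prems by (cases q) auto
    obtain y where y: "y \<in> carrier L" "P y" "\<forall>i\<in>{1..n}. \<forall>j\<in>{1..n}. \<rho> y i j = (if (i, j) \<in> F then \<rho>
        x i j else 0)"
      using insert by auto
    let ?e = "elem a b (\<rho> x a b)"
    have e: "?e \<in> carrier L" using elem q by blast
    have "P (y \<oplus> ?e)" using add[OF y(1) e y(2)] P q by blast
    moreover have "\<forall>i\<in>{1..n}. \<forall>j\<in>{1..n}. \<rho> (y \<oplus> ?e) i j = (if (i, j) \<in> insert q F then \<rho> x i j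
        else 0)"
      using y insert.hyps q by (auto simp: \<rho>_add[OF y(1) e] elem)
    ultimately show ?case using y(1) e by (intro bexI[of _ "y \<oplus> ?e"]) auto
  qed
  from this[of "{1..n} \<times> {1..n}"] obtain y where
    y: "y \<in> carrier L" "P y" "\<forall>i\<in>{1..n}. \<forall>j\<in>{1..n}. \<rho> y i j = \<rho> x i j" by auto
  then have "y = x" using \<rho>_inj[OF y(1) x] by blast
  then show ?thesis using y by simp
qed

lemma \<rho>_surj:
  obtains x where "x \<in> carrier L" "\<And>i j. \<lbrakk>i \<in> {1..n}; j \<in> {1..n}\<rbrakk> \<Longrightarrow> \<rho> x i j = M i j"
proof -
  have "F \<subseteq> {1..n} \<times> {1..n} \<Longrightarrow> \<exists>y\<in>carrier L. \<forall>i\<in>{1..n}. \<forall>j\<in>{1..n}. \<rho> y i j = (if (i, j) \<in> F then M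
      i j else 0)"
    if "finite F" for F
    using that
  proof (induction F rule: finite_induct)
    case empty
    then show ?case using \<rho>_zero by (intro bexI[of _ "\<zero>"]) auto
  next
    case (insert q F)
    obtain a b where q: "q = (a, b)" "a \<in> {1..n}" "b \<in> {1..n}" using insert.prems by (cases q) auto
    obtain y where y: "y \<in> carrier L" "\<forall>i\<in>{1..n}. \<forall>j\<in>{1..n}. \<rho> y i j = (if (i, j) \<in> F then M i j
        else 0)"
      using insert by auto
    let ?e = "elem a b (M a b)"
    have e: "?e \<in> carrier L" using elem q by blast
    have "\<forall>i\<in>{1..n}. \<forall>j\<in>{1..n}. \<rho> (y \<oplus> ?e) i j = (if (i, j) \<in> insert q F then M i j else 0)"
      using y insert.hyps q by (auto simp: \<rho>_add[OF y(1) e] elem)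
    then show ?case using y(1) e by (intro bexI[of _ "y \<oplus> ?e"]) auto
  qed
  from this[of "{1..n} \<times> {1..n}"] that show thesis by auto
qed

end

section \<open>The exponents of an order and the labels of its columns\<close>

locale circle_order = circle_loc k n L \<iota>
  for k n :: nat and L :: "('l, 'y) ring_scheme" (structure) and \<iota> :: "path_fun set \<Rightarrow> 'l" +
  fixes B :: "'l set"
  assumes order: "is_R_order k n L \<iota> B" and C_subset: "\<iota> ` carrier (circle_algebra k n) \<subseteq> B"
begin

lemma subring_B: "subring B L" using order by (simp add: is_R_order_def)

lemma B_L: "b \<in> B \<Longrightarrow> b \<in> carrier L"
  and B_add: "\<lbrakk>b \<in> B; c \<in> B\<rbrakk> \<Longrightarrow> b \<oplus> c \<in> B"
  and B_mult: "\<lbrakk>b \<in> B; c \<in> B\<rbrakk> \<Longrightarrow> b \<otimes> c \<in> B"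
  and B_zero: "\<zero> \<in> B" and B_one: "\<one> \<in> B"
  by (use subringE(1)[OF subring_B] in blast, rule subringE(7)[OF subring_B], assumption+,
      rule subringE(6)[OF subring_B], assumption+, rule subringE(2)[OF subring_B], rule
          subringE(3)[OF subring_B])

lemma iota_B: "c \<in> carrier CA \<Longrightarrow> \<iota> c \<in> B"
  using C_subset by blast

lemma \<sigma>_B: "\<sigma> r \<in> B" unfolding \<sigma>_def by (intro iota_B) simp

sublocale U: unital_submodule CA L \<iota> "sc fps_X" B
proof (intro unital_submodule.intro unital_submodule_axioms.intro)
  show "central_localization CA L \<iota> (sc fps_X)" by (rule loc.central_localization_axioms)
  show "additive_subgroup B L"
    using subring.axioms(1)[OF subring_B] by (simp add: additive_subgroup_def)
  show "\<iota> c \<otimes> b \<in> B" if "c \<in> carrier CA" "b \<in> B" for c b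
    by (rule B_mult[OF iota_B[OF that(1)] that(2)])
  show "\<one> \<in> B" by (rule B_one)
qed

lemma entry_B:
  assumes "i \<in> {1..n}" "j \<in> {1..n}" "b \<in> B"
  shows "elem i j (\<rho> b i j) \<in> B"
  using e_mult_e[OF assms(1,2) B_L[OF assms(3)]] B_mult[OF B_mult[OF iota_B assms(3)] iota_B] assms
  by (metis gen_closed(3))

text \<open>Finitely many generators have finitely many entries, so their poles are bounded in
  common, and scalars from \<open>R\<close> do not make poles worse. This is where finite generation
  enters.\<close>

lemma bounded_span:
  "set bs \<subseteq> carrier L \<Longrightarrow> \<exists>N. \<forall>b\<in>loc.S.Span (range \<sigma>) bs. b \<in> carrier L \<and> (\<forall>i\<in>{1..n}. \<forall>j\<in>{1..n}. vge
      N (\<rho> b i j))"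
proof (induction bs)
  case Nil
  then show ?case by (auto simp: \<rho>_zero)
next
  case (Cons x xs)
  then obtain N where N: "\<And>b. b \<in> loc.S.Span (range \<sigma>) xs \<Longrightarrow> b \<in> carrier L \<and> (\<forall>i\<in>{1..n}. \<forall>j\<in>{1..n}.
      vge N (\<rho> b i j))"
    by auto
  have x: "x \<in> carrier L" using Cons.prems by simp
  let ?D = "(\<lambda>(i, j). fls_subdegree (\<rho> x i j)) ` ({1..n} \<times> {1..n})"
  define N' where "N' = min N (Min ?D)"
  have xN: "vge N' (\<rho> x i j)" if "i \<in> {1..n}" "j \<in> {1..n}" for i j
  proof -
    have "Min ?D \<le> fls_subdegree (\<rho> x i j)" by (rule Min_le) (use that in auto)
    then show ?thesis by (auto simp: vge_def N'_def)
  qed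
  have "b \<in> carrier L \<and> (\<forall>i\<in>{1..n}. \<forall>j\<in>{1..n}. vge N' (\<rho> b i j))" if b: "b \<in> loc.S.Span (range \<sigma>)
      (x # xs)" for b
  proof -
    obtain r v where v: "v \<in> loc.S.Span (range \<sigma>) xs" "b = \<sigma> r \<otimes> x \<oplus> v"
      using b by (auto simp: loc.S.line_extension_mem_iff)
    have vL: "v \<in> carrier L" using N[OF v(1)] by blast
    have "vge N' (\<rho> b i j)" if ij: "i \<in> {1..n}" "j \<in> {1..n}" for i j
    proof -
      have "vge N' (\<rho> v i j)" using N[OF v(1)] ij vge_mono[of N _ N'] by (auto simp: N'_def)
      then show ?thesis unfolding v(2) using xN[OF ij] x vL
        by (simp add: \<rho>_add \<rho>_scale vge_add vge_fps_mult)
    qed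
    then show ?thesis using v(2) x vL by simp
  qed
  then show ?case by blast
qed

lemma bounded_B: "\<exists>N. \<forall>b\<in>B. \<forall>i\<in>{1..n}. \<forall>j\<in>{1..n}. vge N (\<rho> b i j)"
proof -
  have "range \<sigma> = range (\<lambda>r. \<iota> (scalar k n r))" by (simp add: \<sigma>_def)
  then obtain bs where bs: "set bs \<subseteq> B" "B = loc.S.Span (range \<sigma>) bs"
    using order unfolding is_R_order_def by auto
  have "set bs \<subseteq> carrier L" using bs(1) B_L by blast
  from bounded_span[OF this] show ?thesis using bs(2) by blast
qed

text \<open>The corner \<open>e_i B e_j\<close> is a fractional ideal of \<open>R\<close> in the
  line of the matrix unit; this is its exponent.\<close>

definition \<beta> :: "nat \<Rightarrow> nat \<Rightarrow> int" where
  "\<beta> i j = (SOME z. elem i j (Xp z) \<in> B \<and> (\<forall>b\<in>B. vge z (\<rho> b i j)))"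

text \<open>Exponents of nonzero entries are bounded below, and a nonzero entry exists since a path
  from \<open>j\<close> to \<open>i\<close> lies in \<open>B\<close>. A minimal one is cut out by
  idempotents and scaled by a unit to a pure power.\<close>

lemma \<beta>:
  assumes i: "i \<in> {1..n}" and j: "j \<in> {1..n}"
  shows "elem i j (Xp (\<beta> i j)) \<in> B" "b \<in> B \<Longrightarrow> vge (\<beta> i j) (\<rho> b i j)"
proof -
  obtain N where N: "\<And>b. b \<in> B \<Longrightarrow> vge N (\<rho> b i j)" using bounded_B i j by blast
  let ?P = "\<lambda>b. b \<in> B \<and> \<rho> b i j \<noteq> 0"
  let ?p = "pc (cyc_path i j)"
  have "\<rho> (\<iota> ?p) i j = fps_to_fls (fps_X ^ wt (cyc_path i j))"
    using cyc_path[OF i j] by (simp add: \<rho>_iota mat_pc[OF k_set_J0])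
  then have "?P (\<iota> ?p)" using iota_B cyc_path(1)[OF i j] by simp
  \<comment> \<open>Subtracting the bound \<open>N\<close> turns exponents into natural numbers,
    where a least one exists; \<open>nat\<close> loses nothing because these differences are
    nonnegative.\<close>
  then obtain b where b: "?P b" "\<And>c. ?P c \<Longrightarrow> nat (fls_subdegree (\<rho> b i j) - N) \<le> nat (fls_subdegree
      (\<rho> c i j) - N)"
    using ex_has_least_nat[of ?P "\<iota> ?p" "\<lambda>b. nat (fls_subdegree (\<rho> b i j) - N)"] by blast
  let ?z = "fls_subdegree (\<rho> b i j)"
  have "vge ?z (\<rho> c i j)" if c: "c \<in> B" for c
  proof (cases "\<rho> c i j = 0")
    case False
    then have "N \<le> fls_subdegree (\<rho> c i j)" using N[OF c] by (simp add: vge_def)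
    then show ?thesis using b(2)[of c] c False by (simp add: vge_def)
  qed simp
  moreover have "elem i j (Xp ?z) \<in> B"
  proof -
    obtain u where u: "fps_to_fls u * \<rho> b i j = Xp ?z" using fls_unit_normalize b(1) by blast
    have "\<sigma> u \<otimes> elem i j (\<rho> b i j) \<in> B" using B_mult[OF \<sigma>_B entry_B[OF i j]] b(1) by blast
    then show ?thesis unfolding \<sigma>_elem[OF i j] u .
  qed
  ultimately have "\<exists>z. elem i j (Xp z) \<in> B \<and> (\<forall>b\<in>B. vge z (\<rho> b i j))" by blast
  from someI_ex[OF this] show "elem i j (Xp (\<beta> i j)) \<in> B" "b \<in> B \<Longrightarrow> vge (\<beta> i j) (\<rho> b i j)" for b
    unfolding \<beta>_def by blast+
qed

lemma elem_B_iff: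
  assumes i: "i \<in> {1..n}" and j: "j \<in> {1..n}"
  shows "elem i j f \<in> B \<longleftrightarrow> vge (\<beta> i j) f"
proof
  assume "elem i j f \<in> B"
  from \<beta>(2)[OF i j this] show "vge (\<beta> i j) f" by (simp add: elem(2)[OF i j])
next
  assume "vge (\<beta> i j) f"
  from vge_Xp_fps[OF this] obtain r where f: "f = fps_to_fls r * Xp (\<beta> i j)" by blast
  show "elem i j f \<in> B" unfolding f \<sigma>_elem[OF i j, symmetric] by (intro B_mult \<sigma>_B \<beta> i j)
qed

lemma mem_B_iff:
  assumes "x \<in> carrier L"
  shows "x \<in> B \<longleftrightarrow> (\<forall>i\<in>{1..n}. \<forall>j\<in>{1..n}. vge (\<beta> i j) (\<rho> x i j))"
proof
  assume "\<forall>i\<in>{1..n}. \<forall>j\<in>{1..n}. vge (\<beta> i j) (\<rho> x i j)"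
  then show "x \<in> B" by (intro elem_decomp[where P = "\<lambda>x. x \<in> B", OF assms]) (auto simp: elem_B_iff
      B_zero B_add)
qed (use \<beta>(2) in blast)

lemma \<beta>_triangle:
  assumes "i \<in> {1..n}" "j \<in> {1..n}" "l \<in> {1..n}"
  shows "\<beta> i l \<le> \<beta> i j + \<beta> j l"
proof -
  have "elem i j (Xp (\<beta> i j)) \<otimes> elem j l (Xp (\<beta> j l)) \<in> B" by (intro B_mult \<beta> assms)
  then show ?thesis using assms by (simp add: elem_mult elem_B_iff Xp_mult)
qed

text \<open>The triangle inequality \<open>\<beta> i i \<le> 2 \<beta> i i\<close> excludes negative
  values, and \<open>e_i\<close> in \<open>B\<close> excludes positive ones.\<close>

lemma \<beta>_diag: "i \<in> {1..n} \<Longrightarrow> \<beta> i i = 0"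
  using \<beta>_triangle[of i i i] iota_B[OF gen_closed(3)[of i]] by (simp add: iota_gens elem_B_iff)

lemma \<beta>_gens:
  assumes "i \<in> {1..n}"
  shows "\<beta> i (cpred n i) \<le> \<epsilon> i" "\<beta> (cpred n i) i \<le> 1 - \<epsilon> i"
  using iota_B[OF gen_closed(1)[OF assms]] iota_B[OF gen_closed(2)[OF assms]]
  unfolding iota_gens(1,2)[OF assms] elem_B_iff[OF assms cpred_range[OF n_pos assms]]
    elem_B_iff[OF cpred_range[OF n_pos assms] assms] vge_Xp by blast+

text \<open>In the basis of \<open>B e\<^sub>l\<close> given by the powers \<open>t\<^bsup>\<beta> i l\<^esup>\<close>, the arrow \<open>x\<^sub>i\<close> acts by \<open>t\<^bsup>\<delta> i
  l\<^esup>\<close>.\<close>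

definition \<delta> :: "nat \<Rightarrow> nat \<Rightarrow> int" where "\<delta> i l = \<beta> (cpred n i) l + \<epsilon> i - \<beta> i l"

text \<open>Both arrows at \<open>i\<close> lie in \<open>B\<close>; their exponents
  \<open>\<epsilon> i\<close> and \<open>1 - \<epsilon> i\<close> bound the change of \<beta> from
  either side and leave a window of length one.\<close>

lemma \<delta>_range:
  assumes "i \<in> {1..n}" "l \<in> {1..n}"
  shows "0 \<le> \<delta> i l" "\<delta> i l \<le> 1" "\<delta> i l \<noteq> 0 \<Longrightarrow> \<delta> i l = 1"
proof -
  have p: "cpred n i \<in> {1..n}" using cpred_range[OF n_pos assms(1)] .
  show "0 \<le> \<delta> i l" "\<delta> i l \<le> 1"
    using \<beta>_gens[OF assms(1)] \<beta>_triangle[OF assms(1) p assms(2)] \<beta>_triangle[OF p assms(1) assms(2)]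
    by (simp_all add: \<delta>_def)
  then show "\<delta> i l \<noteq> 0 \<Longrightarrow> \<delta> i l = 1" by simp
qed

text \<open>\<open>B e\<^sub>l\<close> is isomorphic to \<open>M\<^sub>J\<close> for \<open>J = Jc l\<close>, so \<open>Jc l\<close> is the member \<open>I\<^sub>l\<^sub>+\<^sub>1\<close> of the
  necklace.\<close>

definition Jc :: "nat \<Rightarrow> nat set" where "Jc l = {i \<in> {1..n}. \<delta> i l = 0}"

lemma bij_cpred: "bij_betw (cpred n) {1..n} {1..n}"
  by (rule bij_betw_byWitness[where f' = "csucc n"])
    (use cpred_csucc[OF n_pos] csucc_cpred[OF n_pos] cpred_range[OF n_pos] csucc_range[OF n_pos]
        in auto)

text \<open>Around the circle the differences of \<beta> telescope, so \<open>\<delta> i l\<close>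
  and \<open>\<epsilon> i\<close> have the same sum, and the label has as many elements as
  \<open>J0\<close>.\<close>

lemma k_set_Jc:
  assumes l: "l \<in> {1..n}"
  shows "k_set (Jc l)"
proof -
  have "(\<Sum>i\<in>{1..n}. \<delta> i l) = (\<Sum>i\<in>{1..n}. \<beta> (cpred n i) l) + (\<Sum>i\<in>{1..n}. \<epsilon> i) - (\<Sum>i\<in>{1..n}. \<beta> i l)"
    by (simp add: \<delta>_def sum.distrib sum_subtractf)
  also have "(\<Sum>i\<in>{1..n}. \<beta> (cpred n i) l) = (\<Sum>i\<in>{1..n}. \<beta> i l)"
    by (rule sum.reindex_bij_betw[OF bij_cpred])
  finally have s: "(\<Sum>i\<in>{1..n}. \<delta> i l) = (\<Sum>i\<in>{1..n}. \<epsilon> i)" by simp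
  have "(\<Sum>i\<in>{1..n}. 1 - \<delta> i l) = (\<Sum>i\<in>{1..n}. if i \<in> Jc l then 1 else 0)"
    by (rule sum.cong) (use \<delta>_range(3)[OF _ l] in \<open>auto simp: Jc_def\<close>)
  also have "\<dots> = int (card (Jc l))" by (simp add: sum.If_cases Jc_def Int_def)
  finally have 1: "int n - (\<Sum>i\<in>{1..n}. \<delta> i l) = int (card (Jc l))" by (simp add: sum_subtractf)
  have "(\<Sum>i\<in>{1..n}. 1 - \<epsilon> i) = (\<Sum>i\<in>{1..n}. if i \<in> J0 then 1 else 0)"
    by (rule sum.cong) (auto simp: \<epsilon>_def)
  also have "\<dots> = int (card ({1..n} \<inter> J0))" by (simp add: sum.If_cases Int_def)
  also have "{1..n} \<inter> J0 = J0" using k_less by (auto simp: J0_def)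
  finally have 2: "int n - (\<Sum>i\<in>{1..n}. \<epsilon> i) = int k" by (simp add: sum_subtractf J0_def)
  show ?thesis using 1 2 s by (auto simp: k_set_def Jc_def)
qed

end

section \<open>Rigidity and the necklace condition\<close>

context circle_order
begin

lemma pred_succ:
  assumes "i \<in> {1..n}"
  shows "cpred n i \<in> {1..n}" "csucc n (cpred n i) = i" "cpred n (csucc n i) = i" "csucc n i \<in>
      {1..n}"
  using cpred_range[OF n_pos assms] csucc_cpred[OF n_pos assms] cpred_csucc[OF n_pos assms]
    csucc_range[OF n_pos assms] by auto

text \<open>The label of column \<open>i\<close> is the necklace member at \<open>i + 1\<close>, so
  the member at \<open>i\<close> appears as \<open>Jc (cpred n i)\<close>.\<close>

definition necklace_cond :: bool where
  "necklace_cond \<longleftrightarrow> (\<forall>i\<in>{1..n}. Jc (cpred n i) - {i} \<subseteq> Jc i)"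

text \<open>Walking around the circle from \<open>j\<close> to \<open>l\<close>, an element can leave the label only at the step
  into itself; so \<open>Jc j - Jc l\<close> and \<open>Jc l - Jc j\<close> lie on complementary arcs.\<close>

lemma necklace_walk:
  assumes N: necklace_cond and j: "j \<in> {1..n}" and ab: "a \<le> b" "b < m" "m \<le> a + n"
    and mem: "(csucc n ^^ m) j \<in> Jc ((csucc n ^^ a) j)"
  shows "(csucc n ^^ m) j \<in> Jc ((csucc n ^^ b) j)"
  using ab
proof (induction b rule: dec_induct)
  case base
  show ?case by (rule mem)
next
  case (step b)
  let ?i = "(csucc n ^^ Suc b) j"
  have i: "?i \<in> {1..n}" using csucc_pow_range[OF n_pos j] .
  have p: "cpred n ?i = (csucc n ^^ b) j"
    using pred_succ(3)[OF csucc_pow_range[OF n_pos j, of b]] by simp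
  \<comment> \<open>Position \<open>m\<close> lies beyond \<open>Suc b\<close> by less than
    \<open>n\<close>, so its element is not the one that may be dropped at this step.\<close>
  have "(csucc n ^^ m) j \<noteq> ?i"
    using csucc_pow_inj[OF n_pos j, of "Suc b" m] step by auto
  moreover have "(csucc n ^^ m) j \<in> Jc (cpred n ?i)" unfolding p using step by simp
  ultimately show ?case using N i unfolding necklace_cond_def by blast
qed

text \<open>Right multiplications are exactly linear, so both defects are unchanged. This normalises
  a map to have value zero at the unit.\<close>

lemma hom_mod_sub_right_mult:
  assumes H: "U.hom_mod_B H" and z: "z \<in> carrier L"
  shows "U.hom_mod_B (\<lambda>u. H u \<ominus> u \<otimes> z)"
proof -
  have HL: "H u \<in> carrier L" if "u \<in> B" for u using H that by (auto simp: U.hom_mod_B_def)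
  show ?thesis unfolding U.hom_mod_B_def
  proof (intro conjI ballI)
    show "(\<lambda>u. H u \<ominus> u \<otimes> z) \<in> B \<rightarrow> carrier L" using HL B_L z by auto
  next
    fix u v assume uv: "u \<in> B" "v \<in> B"
    have c: "H u \<in> carrier L" "H v \<in> carrier L" "H (u \<oplus> v) \<in> carrier L" "u \<in> carrier L" "v \<in>
        carrier L"
      using HL B_L B_add uv by auto
    have "H (u \<oplus> v) \<ominus> (H u \<oplus> H v) \<in> B" using H uv by (simp add: U.hom_mod_B_def)
    moreover have "H (u \<oplus> v) \<ominus> (u \<oplus> v) \<otimes> z \<ominus> (H u \<ominus> u \<otimes> z \<oplus> (H v \<ominus> v \<otimes> z)) =
       H (u \<oplus> v) \<ominus> (H u \<oplus> H v)"
      using c z by algebra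
    ultimately show "H (u \<oplus> v) \<ominus> (u \<oplus> v) \<otimes> z \<ominus> (H u \<ominus> u \<otimes> z \<oplus> (H v \<ominus> v \<otimes> z)) \<in> B"
      by simp
  next
    fix a u assume a: "a \<in> carrier CA" and u: "u \<in> B"
    have c: "H u \<in> carrier L" "\<iota> a \<in> carrier L" "H (\<iota> a \<otimes> u) \<in> carrier L" "u \<in> carrier L"
      using HL B_L B_mult iota_B u a by auto
    have "H (\<iota> a \<otimes> u) \<ominus> \<iota> a \<otimes> H u \<in> B" using H u a by (simp add: U.hom_mod_B_def)
    moreover have "H (\<iota> a \<otimes> u) \<ominus> (\<iota> a \<otimes> u) \<otimes> z \<ominus> \<iota> a \<otimes> (H u \<ominus> u \<otimes> z) =
       H (\<iota> a \<otimes> u) \<ominus> \<iota> a \<otimes> H u"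
      using c z by algebra
    ultimately show "H (\<iota> a \<otimes> u) \<ominus> (\<iota> a \<otimes> u) \<otimes> z \<ominus> \<iota> a \<otimes> (H u \<ominus> u \<otimes> z) \<in> B"
      by simp
  qed
qed

lemma hom_mod_entry:
  assumes D: "U.hom_mod_B D" and a: "a \<in> carrier CA" and u: "u \<in> B" and i: "i \<in> {1..n}" and l: "l
      \<in> {1..n}"
  shows "vge (\<beta> i l) (\<rho> (D (\<iota> a \<otimes> u)) i l - \<rho> (\<iota> a \<otimes> D u) i l)"
proof -
  have "D (\<iota> a \<otimes> u) \<ominus> \<iota> a \<otimes> D u \<in> B" using D a u by (simp add: U.hom_mod_B_def)
  from \<beta>(2)[OF i l this] show ?thesis
    using D a u B_mult[OF iota_B[OF a] u] by (subst (asm) \<rho>_minus) (auto simp: U.hom_mod_B_def)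
qed

section \<open>Sufficiency: following a normalised map along the arcs\<close>

context
  fixes D
  assumes D: "U.hom_mod_B D" and D1: "D \<one> \<in> B"
begin

lemma D_closed: "u \<in> B \<Longrightarrow> D u \<in> carrier L"
  using D by (auto simp: U.hom_mod_B_def)

lemma D_add: "\<lbrakk>u \<in> B; v \<in> B; D u \<in> B; D v \<in> B\<rbrakk> \<Longrightarrow> D (u \<oplus> v) \<in> B"
proof -
  assume uv: "u \<in> B" "v \<in> B" "D u \<in> B" "D v \<in> B"
  have "D (u \<oplus> v) \<ominus> (D u \<oplus> D v) \<in> B" using D uv by (simp add: U.hom_mod_B_def)
  then have "(D (u \<oplus> v) \<ominus> (D u \<oplus> D v)) \<oplus> (D u \<oplus> D v) \<in> B" using uv B_add by blast
  moreover have "(D (u \<oplus> v) \<ominus> (D u \<oplus> D v)) \<oplus> (D u \<oplus> D v) = D (u \<oplus> v)"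
  proof -
    have "D (u \<oplus> v) \<in> carrier L" "D u \<in> carrier L" "D v \<in> carrier L" using D_closed uv B_add by auto
    then show ?thesis by algebra
  qed
  ultimately show ?thesis by simp
qed

lemma D_smult: "\<lbrakk>a \<in> carrier CA; u \<in> B; D u \<in> B\<rbrakk> \<Longrightarrow> D (\<iota> a \<otimes> u) \<in> B"
proof -
  assume a: "a \<in> carrier CA" and u: "u \<in> B" "D u \<in> B"
  have "D (\<iota> a \<otimes> u) \<ominus> \<iota> a \<otimes> D u \<in> B" using D a u by (simp add: U.hom_mod_B_def)
  then have "(D (\<iota> a \<otimes> u) \<ominus> \<iota> a \<otimes> D u) \<oplus> \<iota> a \<otimes> D u \<in> B"
    using B_add B_mult[OF iota_B[OF a] u(2)] by blast
  moreover have "(D (\<iota> a \<otimes> u) \<ominus> \<iota> a \<otimes> D u) \<oplus> \<iota> a \<otimes> D u = D (\<iota> a \<otimes> u)"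
  proof -
    have "D (\<iota> a \<otimes> u) \<in> carrier L" "\<iota> a \<in> carrier L" "D u \<in> carrier L"
      using D_closed u a B_mult[OF iota_B[OF a] u(1)] by auto
    then show ?thesis by algebra
  qed
  ultimately show ?thesis by simp
qed

lemma D_iota: "a \<in> carrier CA \<Longrightarrow> D (\<iota> a) \<in> B"
  using D_smult[OF _ B_one D1, of a] by simp

definition bas :: "nat \<Rightarrow> nat \<Rightarrow> 'l" where "bas i j = elem i j (Xp (\<beta> i j))"

text \<open>The bound at row \<open>i\<close> and column \<open>l\<close> for the image of the
  generator of \<open>e_i B e_j\<close>; it is carried around the circle with \<open>j\<close> and
  \<open>l\<close> fixed and \<open>i\<close> moving.\<close>

definition good :: "nat \<Rightarrow> nat \<Rightarrow> nat \<Rightarrow> bool" where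
  "good i j l \<longleftrightarrow> vge (\<beta> i l) (\<rho> (D (bas i j)) i l)"

lemma bas_B: "\<lbrakk>i \<in> {1..n}; j \<in> {1..n}\<rbrakk> \<Longrightarrow> bas i j \<in> B"
  unfolding bas_def by (rule \<beta>(1))

lemma good_diag:
  assumes j: "j \<in> {1..n}" and l: "l \<in> {1..n}"
  shows "good j j l"
proof -
  have "bas j j = \<iota> (ec j)" using j by (simp add: bas_def \<beta>_diag iota_gens)
  then have "D (bas j j) \<in> B" using D_iota j by simp
  then show ?thesis unfolding good_def using \<beta>(2)[OF j l] by blast
qed

text \<open>For \<open>\<delta> i j = 0\<close> the arrow \<open>x_i\<close> sends the generator of
  column \<open>j\<close> at \<open>i - 1\<close> exactly to the one at \<open>i\<close>, so modulo
  \<open>B\<close> their images under \<open>D\<close> are linked by \<open>x_i\<close> too. For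
  \<open>\<delta> i j = 1\<close> it is \<open>y_i\<close> that links them, backwards.\<close>

lemma good_x:
  assumes i: "i \<in> {1..n}" and j: "j \<in> {1..n}" and l: "l \<in> {1..n}" and d: "\<delta> i j = 0"
  shows "good i j l \<longleftrightarrow> vge (\<beta> i l - \<epsilon> i) (\<rho> (D (bas (cpred n i) j)) (cpred n i) l)"
proof -
  let ?p = "cpred n i"
  have p: "?p \<in> {1..n}" using pred_succ(1)[OF i] .
  have eq: "\<iota> (xc i) \<otimes> bas ?p j = bas i j"
    using d i j p by (simp add: bas_def iota_gens elem_mult Xp_mult \<delta>_def algebra_simps)
  have "\<rho> (\<iota> (xc i) \<otimes> D (bas ?p j)) i l = Xp (\<epsilon> i) * \<rho> (D (bas ?p j)) ?p l"
    using i p D_closed[OF bas_B[OF p j]] by (simp add: iota_gens \<rho>_elem_mult)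
  then have "vge (\<beta> i l) (\<rho> (D (bas i j)) i l - Xp (\<epsilon> i) * \<rho> (D (bas ?p j)) ?p l)"
    using hom_mod_entry[OF D gen_closed(1)[OF i] bas_B[OF p j] i l] by (simp add: eq)
  from vge_diff_iff[OF this] show ?thesis by (simp add: good_def vge_Xp_mult)
qed

lemma good_y:
  assumes i: "i \<in> {1..n}" and j: "j \<in> {1..n}" and l: "l \<in> {1..n}" and d: "\<delta> i j = 1"
  shows "good (cpred n i) j l \<longleftrightarrow> vge (\<beta> (cpred n i) l - (1 - \<epsilon> i)) (\<rho> (D (bas i j)) i l)"
proof -
  let ?p = "cpred n i"
  have p: "?p \<in> {1..n}" using pred_succ(1)[OF i] .
  have "\<beta> ?p j = 1 - \<epsilon> i + \<beta> i j" using d by (simp add: \<delta>_def)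
  then have eq: "\<iota> (yc i) \<otimes> bas i j = bas ?p j"
    using i j p by (simp add: bas_def iota_gens elem_mult Xp_mult)
  have "\<rho> (\<iota> (yc i) \<otimes> D (bas i j)) ?p l = Xp (1 - \<epsilon> i) * \<rho> (D (bas i j)) i l"
    using i p D_closed[OF bas_B[OF i j]] by (simp add: iota_gens \<rho>_elem_mult)
  then have "vge (\<beta> ?p l) (\<rho> (D (bas ?p j)) ?p l - Xp (1 - \<epsilon> i) * \<rho> (D (bas i j)) i l)"
    using hom_mod_entry[OF D gen_closed(2)[OF i] bas_B[OF i j] p l] by (simp add: eq)
  from vge_diff_iff[OF this] show ?thesis by (simp add: good_def vge_Xp_mult)
qed

text \<open>If \<open>x_i\<close> links the generators of column \<open>j\<close>, the bound in
  column \<open>l\<close> can only weaken, as \<open>\<delta> i l \<ge> 0\<close>. Otherwise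
  \<open>i\<close> misses \<open>Jc j\<close>, hence \<open>Jc l\<close>, so \<open>y_i\<close>
  links the generators in both columns and the bound transfers unchanged.\<close>

lemma good_forward:
  assumes i: "i \<in> {1..n}" and j: "j \<in> {1..n}" and l: "l \<in> {1..n}"
    and J: "i \<in> Jc l \<Longrightarrow> i \<in> Jc j" and g: "good (cpred n i) j l"
  shows "good i j l"
proof (cases "\<delta> i j = 0")
  case True
  show ?thesis unfolding good_x[OF i j l True]
    by (rule vge_mono[OF g[unfolded good_def]]) (use \<delta>_range(1)[OF i l] in \<open>simp add: \<delta>_def\<close>)
next
  case False
  then have d: "\<delta> i j = 1" "\<delta> i l = 1" using J \<delta>_range(3)[OF i j] \<delta>_range(3)[OF i l] i by (auto
      simp: Jc_def)
  show ?thesis unfolding good_def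
    by (rule vge_mono[OF g[unfolded good_y[OF i j l d(1)]]]) (use d(2) in \<open>simp add: \<delta>_def\<close>)
qed

text \<open>The direction is reversed, and so is the inclusion of labels:
  \<open>\<delta> i j = 0\<close> now needs equality in column \<open>l\<close>, while
  \<open>\<delta> i j = 1\<close> is settled by \<open>\<delta> i l \<le> 1\<close>.\<close>

lemma good_backward:
  assumes i: "i \<in> {1..n}" and j: "j \<in> {1..n}" and l: "l \<in> {1..n}"
    and J: "i \<in> Jc j \<Longrightarrow> i \<in> Jc l" and g: "good i j l"
  shows "good (cpred n i) j l"
proof (cases "\<delta> i j = 0")
  case True
  then have d: "\<delta> i l = 0" using J i by (auto simp: Jc_def)
  show ?thesis using g unfolding good_x[OF i j l True] unfolding good_def
    by (rule vge_mono) (use d in \<open>simp add: \<delta>_def\<close>)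
next
  case False
  then have d: "\<delta> i j = 1" using \<delta>_range(3)[OF i j] by simp
  show ?thesis unfolding good_y[OF i j l d]
    by (rule vge_mono[OF g[unfolded good_def]]) (use \<delta>_range(2)[OF i l] in \<open>simp add: \<delta>_def\<close>)
qed

text \<open>From the diagonal position \<open>j\<close> go forward to \<open>l\<close> or backward
  to \<open>l\<close>. The necklace condition puts elements of \<open>Jc l\<close> on the first arc
  into \<open>Jc j\<close>, and elements of \<open>Jc j\<close> on the second arc into
  \<open>Jc l\<close>, as the two directions require.\<close>

lemma good_all:
  assumes N: necklace_cond and i: "i \<in> {1..n}" and j: "j \<in> {1..n}" and l: "l \<in> {1..n}"
  shows "good i j l"
proof -
  let ?s = "\<lambda>m. (csucc n ^^ m) j"
  let ?A = "stp l j"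
  have A: "?A < n" "?s ?A = l" using stp[OF l j] by auto
  have s: "?s m \<in> {1..n}" for m using csucc_pow_range[OF n_pos j] .
  have ps: "cpred n (?s (Suc m)) = ?s m" for m using pred_succ(3)[OF s[of m]] by simp
  have fwd: "good (?s m) j l" if "m \<le> ?A" for m
    using that
  proof (induction m)
    case 0
    then show ?case using good_diag[OF j l] by simp
  next
    case (Suc m)
    have "?s (Suc m) \<in> Jc j" if "?s (Suc m) \<in> Jc l"
    proof -
      \<comment> \<open>The step is counted one turn later, so that it lies ahead of the walk from
        \<open>l\<close> at position \<open>?A\<close> to \<open>j\<close> at position
        \<open>n\<close>.\<close>
      have eq: "(csucc n ^^ (Suc m + n)) j = ?s (Suc m)"
        using csucc_pow_n[OF n_pos j] by (simp only: funpow_add comp_apply)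
      have "(csucc n ^^ (Suc m + n)) j \<in> Jc (?s ?A)" using that eq A(2) by simp
      then have "(csucc n ^^ (Suc m + n)) j \<in> Jc (?s n)"
        by (rule necklace_walk[OF N j, rotated -1]) (use Suc.prems A(1) in auto)
      then show ?thesis unfolding eq using csucc_pow_n[OF n_pos j] by simp
    qed
    then show ?case using good_forward[OF s[of "Suc m"] j l] Suc ps[of m] by simp
  qed
  have bwd: "good (?s m) j l" if "m \<le> n" "?A \<le> m" for m
    using that
  proof (induction m rule: inc_induct)
    case base
    then show ?case using good_diag[OF j l] csucc_pow_n[OF n_pos j] by simp
  next
    case (step m)
    have "?s (Suc m) \<in> Jc l" if "?s (Suc m) \<in> Jc j"
    proof -
      have "?s (Suc m) \<in> Jc (?s 0)" using that by simp
      then have "?s (Suc m) \<in> Jc (?s ?A)"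
        by (rule necklace_walk[OF N j, rotated -1]) (use step in auto)
      then show ?thesis using A(2) by simp
    qed
    then show ?case using good_backward[OF s[of "Suc m"] j l] step ps[of m] by simp
  qed
  have "?s (stp i j) = i" "stp i j < n" using stp[OF i j] by auto
  then show ?thesis using fwd[of "stp i j"] bwd[of "stp i j"] by (metis le_cases less_imp_le)
qed

text \<open>Entries outside row \<open>i\<close> are controlled by \<open>e_i\<close>: it fixes the
  generator but kills the other rows of its image.\<close>

lemma D_bas:
  assumes N: necklace_cond and i: "i \<in> {1..n}" and j: "j \<in> {1..n}"
  shows "D (bas i j) \<in> B"
  unfolding mem_B_iff[OF D_closed[OF bas_B[OF i j]]]
proof (intro ballI)
  fix a l assume a: "a \<in> {1..n}" and l: "l \<in> {1..n}"
  show "vge (\<beta> a l) (\<rho> (D (bas i j)) a l)"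
  proof (cases "a = i")
    case True
    then show ?thesis using good_all[OF N i j l] by (simp add: good_def)
  next
    case False
    have "\<iota> (ec i) \<otimes> bas i j = bas i j" using i j by (simp add: bas_def iota_gens elem_mult)
    moreover have "\<rho> (\<iota> (ec i) \<otimes> D (bas i j)) a l = 0"
      using i False D_closed[OF bas_B[OF i j]] by (simp add: iota_gens \<rho>_elem_mult)
    ultimately show ?thesis using hom_mod_entry[OF D gen_closed(3)[OF i] bas_B[OF i j] a l] by simp
  qed
qed

lemma D_B:
  assumes N: necklace_cond and u: "u \<in> B"
  shows "D u \<in> B"
proof -
  have "u \<in> B \<and> D u \<in> B"
  proof (rule elem_decomp[where P = "\<lambda>u. u \<in> B \<and> D u \<in> B", OF B_L[OF u]])
    fix i j assume ij: "i \<in> {1..n}" "j \<in> {1..n}"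
    obtain r where r: "\<rho> u i j = fps_to_fls r * Xp (\<beta> i j)" using vge_Xp_fps[OF \<beta>(2)[OF ij u]] by
        blast
    have "elem i j (\<rho> u i j) = \<iota> (sc r) \<otimes> bas i j"
      unfolding r bas_def using \<sigma>_elem[OF ij, of r] by (simp add: \<sigma>_def)
    then show "elem i j (\<rho> u i j) \<in> B \<and> D (elem i j (\<rho> u i j)) \<in> B"
      using D_smult[OF sc_closed bas_B[OF ij] D_bas[OF N ij]] entry_B[OF ij u] by simp
  next
    have "\<iota> (sc 0) = \<zero>" using \<sigma>_zero by (simp add: \<sigma>_def)
    then show "\<zero> \<in> B \<and> D \<zero> \<in> B" using D_iota[OF sc_closed, of 0] B_zero by simp
  qed (use B_add D_add in blast)
  then show ?thesis ..
qed

end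

lemma necklace_imp_rigid:
  assumes N: necklace_cond
  shows "rigid CA (sub_lmod L \<iota> B)"
proof (rule U.lift_imp_rigid)
  fix H assume H: "U.hom_mod_B H"
  \<comment> \<open>Evaluation at \<open>\<one>\<close> shows that a lift can only be this value
    modulo \<open>B\<close>.\<close>
  let ?z = "H \<one>"
  have z: "?z \<in> carrier L" using H B_one by (auto simp: U.hom_mod_B_def)
  note D = hom_mod_sub_right_mult[OF H z]
  have "?z \<ominus> \<one> \<otimes> ?z = \<zero>" using z by simp
  then have "?z \<ominus> \<one> \<otimes> ?z \<in> B" using B_zero by simp
  from D_B[OF D this N] show "\<exists>z\<in>carrier L. \<forall>u\<in>B. H u \<ominus> u \<otimes> z \<in> B" using z by blast
qed

text \<open>The commutator with \<open>e\<close> is a derivation,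
  \<open>[cd, e] = c [d, e] + [c, e] d\<close>, so arrows and idempotents suffice. The conclusion
  says that left multiplication by \<open>e\<close> followed by right multiplication by
  \<open>q\<close> is linear modulo \<open>B\<close>.\<close>

lemma commutator_cond:
  assumes e: "e \<in> carrier L" and q: "q \<in> carrier L"
    and x: "\<And>i u. \<lbrakk>i \<in> {1..n}; u \<in> B\<rbrakk> \<Longrightarrow> (\<iota> (xc i) \<otimes> e \<ominus> e \<otimes> \<iota> (xc i)) \<otimes> u \<otimes> q \<in> B"
    and y: "\<And>i u. \<lbrakk>i \<in> {1..n}; u \<in> B\<rbrakk> \<Longrightarrow> (\<iota> (yc i) \<otimes> e \<ominus> e \<otimes> \<iota> (yc i)) \<otimes> u \<otimes> q \<in> B"
    and ee: "\<And>i u. \<lbrakk>i \<in> {1..n}; u \<in> B\<rbrakk> \<Longrightarrow> (\<iota> (ec i) \<otimes> e \<ominus> e \<otimes> \<iota> (ec i)) \<otimes> u \<otimes> q \<in> B"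
    and c: "c \<in> carrier CA" and u: "u \<in> B"
  shows "(\<iota> c \<otimes> e \<ominus> e \<otimes> \<iota> c) \<otimes> u \<otimes> q \<in> B"
  using c u
proof (induction c arbitrary: u rule: CA_induct)
  case (sc r)
  have "\<iota> (sc r) \<otimes> e \<ominus> e \<otimes> \<iota> (sc r) = \<zero>" using \<sigma>_central[OF e, of r] e by (simp add: \<sigma>_def
      a_minus_def loc.S.r_neg)
  then show ?case using B_L[OF sc] q B_zero by simp
next
  case (add c d)
  have car: "\<iota> c \<in> carrier L" "\<iota> d \<in> carrier L" "u \<in> carrier L" using add B_L by auto
  have "(\<iota> c \<otimes> e \<ominus> e \<otimes> \<iota> c) \<otimes> u \<otimes> q \<oplus> (\<iota> d \<otimes> e \<ominus> e \<otimes> \<iota> d) \<otimes> u \<otimes> q =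
      ((\<iota> c \<oplus> \<iota> d) \<otimes> e \<ominus> e \<otimes> (\<iota> c \<oplus> \<iota> d)) \<otimes> u \<otimes> q"
    using car e q by algebra
  then show ?case using B_add[OF add.IH(1)[OF add.prems] add.IH(2)[OF add.prems]] add.hyps by simp
next
  case (mult c d)
  have car: "\<iota> c \<in> carrier L" "\<iota> d \<in> carrier L" "u \<in> carrier L" using mult B_L by auto
  have eq: "\<iota> c \<otimes> ((\<iota> d \<otimes> e \<ominus> e \<otimes> \<iota> d) \<otimes> u \<otimes> q) \<oplus> (\<iota> c \<otimes> e \<ominus> e \<otimes> \<iota> c) \<otimes> (\<iota> d \<otimes> u) \<otimes> q =
      ((\<iota> c \<otimes> \<iota> d) \<otimes> e \<ominus> e \<otimes> (\<iota> c \<otimes> \<iota> d)) \<otimes> u \<otimes> q"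
    using car e q by algebra
  have "\<iota> d \<otimes> u \<in> B" by (rule B_mult[OF iota_B[OF mult.hyps(2)] mult.prems])
  from B_add[OF B_mult[OF iota_B[OF mult.hyps(1)] mult.IH(2)[OF mult.prems]] mult.IH(1)[OF this]]
  show ?case unfolding eq loc.hom_mult[OF mult.hyps(1,2)] .
qed (use x y ee in blast)+

text \<open>If the necklace condition fails, cutting the circle at the two places where the shift
  between the lattices \<open>B e\<^sub>j\<close> and \<open>B e\<^sub>l\<close> jumps gives a homomorphism modulo \<open>B\<close> that does not
  lift.\<close>

lemma rigid_imp_necklace:
  assumes rig: "rigid CA (sub_lmod L \<iota> B)"
  shows necklace_cond
  unfolding necklace_cond_def
proof (intro ballI subsetI, rule ccontr)
  fix l m assume l: "l \<in> {1..n}" and "m \<in> Jc (cpred n l) - {l}" and "m \<notin> Jc l"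
  let ?j = "cpred n l" and ?p = "cpred n m"
  have m: "m \<in> {1..n}" "\<delta> m ?j = 0" "m \<noteq> l" using \<open>m \<in> Jc ?j - {l}\<close> by (auto simp: Jc_def)
  have dl: "\<delta> m l = 1" using \<delta>_range(3)[OF m(1) l] \<open>m \<notin> Jc l\<close> m(1) by (auto simp: Jc_def)
  have j: "?j \<in> {1..n}" and p: "?p \<in> {1..n}" using pred_succ l m by auto
  let ?c = "\<beta> ?j l"
  \<comment> \<open>Put \<open>c i = \<beta> i l - \<beta> i ?j\<close>. Then \<open>jl\<close>
    bounds the drop from \<open>?j\<close> to \<open>l\<close> by one, \<open>cm\<close> and
    \<open>cp\<close> use that \<open>c\<close> is minimal at \<open>l\<close> and maximal at
    \<open>?j\<close>, and \<open>d\<close> says that \<open>c\<close> drops by one from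
    \<open>?p\<close> to \<open>m\<close>. So \<open>?p\<close> attains the maximum
    \<open>?c\<close> and \<open>m\<close> the minimum \<open>?c - 1\<close>.\<close>
  have jl: "\<beta> ?j l + \<beta> l ?j \<le> 1" using \<beta>_gens[OF l] by simp
  have cm: "\<beta> m ?j - \<beta> l ?j + \<beta> l l \<le> \<beta> m l + \<beta> l l" using \<beta>_triangle[OF m(1) l j] by simp
  have cp: "\<beta> ?p l \<le> \<beta> ?p ?j + ?c" using \<beta>_triangle[OF p j l] .
  have d: "\<beta> ?p l - \<beta> m l = 1 + (\<beta> ?p ?j - \<beta> m ?j)" using m(2) dl by (simp add: \<delta>_def)
  have eqs: "\<beta> m l = \<beta> m ?j + ?c - 1" "\<beta> ?p l = \<beta> ?p ?j + ?c" "\<beta> l ?j = 1 - ?c"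
    using jl cm cp d by linarith+
  let ?s = "\<lambda>a. (csucc n ^^ a) l"
  let ?A = "stp m l"
  have A: "?A < n" "?s ?A = m" using stp[OF m(1) l] by auto
  have A0: "0 < ?A" using A(2) m(3) by (cases ?A) auto
  have s: "?s a \<in> {1..n}" for a using csucc_pow_range[OF n_pos l] .
  have ps: "cpred n (?s (Suc a)) = ?s a" for a using pred_succ(3)[OF s[of a]] by simp
  \<comment> \<open>The arc from \<open>l\<close> to \<open>?p\<close>. Membership changes only at
    the steps into \<open>l\<close> and into \<open>m\<close>, at both of which \<open>c\<close>
    falls from \<open>?c\<close> to \<open>?c - 1\<close>.\<close>
  define S where "S = {i \<in> {1..n}. stp i l < ?A}"
  have S_iff: "?s a \<in> S \<longleftrightarrow> a < ?A" if "a < n" for a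
    using stp_eqI[OF l that refl] s[of a] by (simp add: S_def)
  have jn: "?j = ?s (n - 1)"
    using ps[of "n - 1"] csucc_pow_n[OF n_pos l] n_pos by simp
  have jS: "?j \<notin> S" unfolding jn using S_iff[of "n - 1"] A(1) n_pos by simp
  have pS: "?p \<in> S"
  proof -
    have "?p = ?s (?A - 1)" using ps[of "?A - 1"] A0 A(2) by simp
    then show ?thesis using S_iff[of "?A - 1"] A A0 by simp
  qed
  have bd: "i = l \<or> i = m" if i: "i \<in> {1..n}" and ne: "(cpred n i \<in> S) \<noteq> (i \<in> S)" for i
  proof -
    obtain a where a: "a < n" "?s a = i" using stp[OF i l] by blast
    show ?thesis
    proof (cases a)
      case (Suc b)
      then have "cpred n i = ?s b" using ps[of b] a(2) by simp
      then have "a = ?A" using ne a S_iff[of a] S_iff[of b] Suc by auto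
      then show ?thesis using a A by simp
    qed (use a in simp)
  qed
  obtain e where e: "e \<in> carrier L" "\<And>a b. \<lbrakk>a \<in> {1..n}; b \<in> {1..n}\<rbrakk> \<Longrightarrow> \<rho> e a b = (if a = b \<and> a \<in> S
      then 1 else 0)"
    using \<rho>_surj[of "\<lambda>a b. if a = b \<and> a \<in> S then 1 else 0"] by blast
  have \<rho>e: "\<rho> (e \<otimes> x) a b = (if a \<in> S then \<rho> x a b else 0)" if "x \<in> carrier L" "a \<in> {1..n}" for x
      a b
  proof -
    have "\<rho> (e \<otimes> x) a b = (\<Sum>q\<in>{1..n}. if q = a then (if a \<in> S then \<rho> x a b else 0) else 0)"
      unfolding \<rho>_mult[OF e(1) that(1)] by (intro sum.cong) (use e(2) that in auto)
    then show ?thesis using that by simp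
  qed
  \<comment> \<open>The generator of the corner at \<open>?j\<close> and \<open>l\<close>, divided
    by \<open>t\<close>. Right multiplication by it keeps column \<open>?j\<close> inside
    \<open>B\<close> at rows where \<open>c\<close> is minimal and misses \<open>B\<close> by one
    factor \<open>t\<close> where \<open>c\<close> is maximal.\<close>
  define q where "q = elem ?j l (Xp (?c - 1))"
  have q: "q \<in> carrier L" unfolding q_def by (rule elem(1)[OF j l])
  have \<rho>q: "\<rho> (x \<otimes> q) a b = (if b = l then \<rho> x a ?j * Xp (?c - 1) else 0)" if "x \<in> carrier L" for
      x a b
    unfolding q_def by (rule \<rho>_mult_elem[OF j l that])
  have comm: "(elem a b f \<otimes> e \<ominus> e \<otimes> elem a b f) \<otimes> u \<otimes> q \<in> B"
    if a: "a \<in> {1..n}" and b: "b \<in> {1..n}" and u: "u \<in> B"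
      and cond: "(a \<in> S) \<noteq> (b \<in> S) \<Longrightarrow> vge (\<beta> a l - \<beta> b ?j - ?c + 1) f" for a b f u
  proof -
    let ?E = "elem a b f"
    have E: "?E \<in> carrier L" using elem(1)[OF a b] .
    have uL: "u \<in> carrier L" using B_L[OF u] .
    have eq: "(?E \<otimes> e \<ominus> e \<otimes> ?E) \<otimes> u \<otimes> q = (?E \<otimes> (e \<otimes> u) \<ominus> e \<otimes> (?E \<otimes> u)) \<otimes> q"
      using E e(1) uL q by algebra
    have in_L: "?E \<otimes> (e \<otimes> u) \<ominus> e \<otimes> (?E \<otimes> u) \<in> carrier L" using E e(1) uL by simp
    show ?thesis unfolding eq
    proof (subst mem_B_iff, use in_L q in simp, intro ballI)
      fix a' b' assume a': "a' \<in> {1..n}" and b': "b' \<in> {1..n}"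
      have r: "\<rho> (?E \<otimes> (e \<otimes> u) \<ominus> e \<otimes> (?E \<otimes> u)) a' ?j =
          (if a' = a then ((if b \<in> S then 1 else 0) - (if a \<in> S then 1 else 0)) * (f * \<rho> u b ?j)
              else 0)"
        using E e(1) uL a' b by (simp add: \<rho>_minus \<rho>_elem_mult[OF a b] \<rho>e)
      have v: "vge (\<beta> b ?j) (\<rho> u b ?j)" by (rule \<beta>(2)[OF b j u])
      have "vge (\<beta> a l) (((if b \<in> S then 1 else 0) - (if a \<in> S then 1 else 0)) * (f * \<rho> u b ?j) *
          Xp (?c - 1))"
      proof (cases "(a \<in> S) = (b \<in> S)")
        case False
        have "vge (\<beta> a l - \<beta> b ?j - ?c + 1 + \<beta> b ?j + (?c - 1)) (f * \<rho> u b ?j * Xp (?c - 1))"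
          by (intro vge_mult cond False v) simp
        then have w: "vge (\<beta> a l) (f * \<rho> u b ?j * Xp (?c - 1))" by simp
        from vge_diff[OF vge_zero w] w False show ?thesis by auto
      qed auto
      then show "vge (\<beta> a' b') (\<rho> ((?E \<otimes> (e \<otimes> u) \<ominus> e \<otimes> (?E \<otimes> u)) \<otimes> q) a' b')"
        unfolding \<rho>q[OF in_L] r by auto
    qed
  qed
  have cc: "(\<iota> c \<otimes> e \<ominus> e \<otimes> \<iota> c) \<otimes> u \<otimes> q \<in> B" if "c \<in> carrier CA" "u \<in> B" for c u
  proof (rule commutator_cond[OF e(1) q _ _ _ that])
    fix i u assume i: "i \<in> {1..n}" and u: "u \<in> B"
    note pi = pred_succ(1)[OF i]
    \<comment> \<open>Both boundary steps end at a vertex where \<open>c\<close> is minimal, so the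
      division by \<open>t\<close> does no harm there: what remains for \<open>x_i\<close> is
      \<open>\<delta> i ?j \<ge> 0\<close>, and for \<open>y_i\<close> it is
      \<open>\<delta> i l \<le> 1\<close>.\<close>
    have vals: "\<beta> i l = \<beta> i ?j + ?c - 1" if "(i \<in> S) \<noteq> (cpred n i \<in> S)"
      using bd[OF i] that eqs(1,3) \<beta>_diag[OF l] by auto
    show "(\<iota> (xc i) \<otimes> e \<ominus> e \<otimes> \<iota> (xc i)) \<otimes> u \<otimes> q \<in> B"
      unfolding iota_gens[OF i]
    proof (rule comm[OF i pi u])
      assume "(i \<in> S) \<noteq> (cpred n i \<in> S)"
      from vals[OF this] show "vge (\<beta> i l - \<beta> (cpred n i) ?j - ?c + 1) (Xp (\<epsilon> i))"
        using \<delta>_range(1)[OF i j] by (simp add: \<delta>_def)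
    qed
    show "(\<iota> (yc i) \<otimes> e \<ominus> e \<otimes> \<iota> (yc i)) \<otimes> u \<otimes> q \<in> B"
      unfolding iota_gens[OF i]
    proof (rule comm[OF pi i u])
      assume "(cpred n i \<in> S) \<noteq> (i \<in> S)"
      then have "\<beta> i l = \<beta> i ?j + ?c - 1" using vals by blast
      then show "vge (\<beta> (cpred n i) l - \<beta> i ?j - ?c + 1) (Xp (1 - \<epsilon> i))"
        using \<delta>_range(2)[OF i l] by (simp add: \<delta>_def)
    qed
    show "(\<iota> (ec i) \<otimes> e \<ominus> e \<otimes> \<iota> (ec i)) \<otimes> u \<otimes> q \<in> B"
      unfolding iota_gens[OF i] by (rule comm[OF i i u]) simp
  qed
  define H where "H u = e \<otimes> u \<otimes> q" for u
  have "U.hom_mod_B H"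
    unfolding U.hom_mod_B_def
  proof (intro conjI ballI)
    show "H \<in> B \<rightarrow> carrier L" using e(1) q B_L by (auto simp: H_def)
    fix u assume u: "u \<in> B"
    then have uL: "u \<in> carrier L" by (rule B_L)
    { fix v assume v: "v \<in> B"
      then have vL: "v \<in> carrier L" by (rule B_L)
      have "e \<otimes> (u \<oplus> v) \<otimes> q \<ominus> (e \<otimes> u \<otimes> q \<oplus> e \<otimes> v \<otimes> q) = \<zero>"
        using uL vL e(1) q by algebra
      then show "H (u \<oplus> v) \<ominus> (H u \<oplus> H v) \<in> B" using B_zero by (simp add: H_def) }
    fix a assume a: "a \<in> carrier CA"
    then have aL: "\<iota> a \<in> carrier L" by simp
    have "e \<otimes> (\<iota> a \<otimes> u) \<otimes> q \<ominus> \<iota> a \<otimes> (e \<otimes> u \<otimes> q) =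
        \<zero> \<ominus> (\<iota> a \<otimes> e \<ominus> e \<otimes> \<iota> a) \<otimes> u \<otimes> q"
      using uL aL e(1) q by algebra
    then show "H (\<iota> a \<otimes> u) \<ominus> \<iota> a \<otimes> H u \<in> B"
      using U.B_minus[OF B_zero cc[OF a u]] by (simp add: H_def)
  qed
  then obtain z where z: "z \<in> carrier L" "\<And>u. u \<in> B \<Longrightarrow> H u \<ominus> u \<otimes> z \<in> B"
    by (rule U.rigid_imp_lift[OF rig]) blast
  have val: "vge (\<beta> i l) ((if i \<in> S then f * Xp (?c - 1) else 0) - f * \<rho> z ?j l)"
    if i: "i \<in> {1..n}" and f: "vge (\<beta> i ?j) f" for i f
  proof -
    let ?u = "elem i ?j f"
    have u: "?u \<in> B" using f elem_B_iff[OF i j] by simp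
    have uL: "?u \<in> carrier L" by (rule B_L[OF u])
    have "\<rho> (H ?u \<ominus> ?u \<otimes> z) i l = (if i \<in> S then f * Xp (?c - 1) else 0) - f * \<rho> z ?j l"
      unfolding H_def using e(1) uL q z(1) i
      by (simp add: \<rho>_minus \<rho>q \<rho>e elem(2)[OF i j] \<rho>_elem_mult[OF i j])
    then show ?thesis using \<beta>(2)[OF i l z(2)[OF u]] by simp
  qed
  \<comment> \<open>Row \<open>?j\<close> lies outside \<open>S\<close>, where \<open>H\<close>
    vanishes, so this entry of \<open>z\<close> is at least as divisible as the generator of its
    corner.\<close>
  have z1: "vge ?c (\<rho> z ?j l)"
    using vge_diff[OF vge_zero val[OF j, of 1]] jS \<beta>_diag[OF j] by simp
  \<comment> \<open>Row \<open>?p\<close> lies inside \<open>S\<close>, and \<open>c\<close> is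
    maximal there. The term with \<open>z\<close> meets the bound, so the term from \<open>q\<close>
    must meet it too, but it is short by one power of \<open>t\<close>.\<close>
  have "vge (\<beta> ?p l) (Xp (\<beta> ?p ?j) * Xp (?c - 1) - Xp (\<beta> ?p ?j) * \<rho> z ?j l)"
    using val[OF p, of "Xp (\<beta> ?p ?j)"] pS by simp
  moreover have "vge (\<beta> ?p l) (Xp (\<beta> ?p ?j) * \<rho> z ?j l)"
    unfolding vge_Xp_mult using z1 eqs(2) by simp
  ultimately have "vge (\<beta> ?p l) (Xp (\<beta> ?p ?j) * Xp (?c - 1))" using vge_diff_iff by blast
  then show False using eqs(2) by (simp add: Xp_mult)
qed

end

section \<open>Columns of the order as rank one modules\<close>

context circle_order
begin

definition col :: "nat \<Rightarrow> 'l set" where "col l = {b \<otimes> \<iota> (ec l) | b. b \<in> B}"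

lemma col_iff:
  assumes l: "l \<in> {1..n}"
  shows "x \<in> col l \<longleftrightarrow> x \<in> B \<and> (\<forall>i\<in>{1..n}. \<forall>j\<in>{1..n}. j \<noteq> l \<longrightarrow> \<rho> x i j = 0)"
proof
  assume "x \<in> col l"
  then obtain b where b: "b \<in> B" "x = b \<otimes> \<iota> (ec l)" by (auto simp: col_def)
  then show "x \<in> B \<and> (\<forall>i\<in>{1..n}. \<forall>j\<in>{1..n}. j \<noteq> l \<longrightarrow> \<rho> x i j = 0)"
    using B_mult[OF b(1) iota_B[OF gen_closed(3)[OF l]]] l B_L[OF b(1)] by (simp add: iota_gens
        \<rho>_mult_elem)
next
  assume x: "x \<in> B \<and> (\<forall>i\<in>{1..n}. \<forall>j\<in>{1..n}. j \<noteq> l \<longrightarrow> \<rho> x i j = 0)"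
  then have xL: "x \<in> carrier L" using B_L by blast
  have "x = x \<otimes> \<iota> (ec l)"
  proof (rule \<rho>_inj)
    fix i j assume "i \<in> {1..n}" "j \<in> {1..n}"
    then show "\<rho> x i j = \<rho> (x \<otimes> \<iota> (ec l)) i j"
      using x xL l by (auto simp: iota_gens \<rho>_mult_elem)
  qed (use xL l in auto)
  then show "x \<in> col l" unfolding col_def using x by blast
qed

lemma elem_col:
  assumes "i \<in> {1..n}" "l \<in> {1..n}" "vge (\<beta> i l) f"
  shows "elem i l f \<in> col l"
  unfolding col_iff[OF assms(2)] using assms by (auto simp: elem_B_iff elem)

text \<open>Coordinates of \<open>B e_l\<close> in the basis of matrix units scaled by
  \<open>t^(\<beta> i l)\<close>; outside the vertices they are zero, as the carrier of the rank one
  module demands.\<close>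

definition coord :: "nat \<Rightarrow> 'l \<Rightarrow> nat \<Rightarrow> complex fps" where
  "coord l b = (\<lambda>i. if i \<in> {1..n} then fls_regpart (Xp (- \<beta> i l) * \<rho> b i l) else 0)"

lemma coord:
  assumes "i \<in> {1..n}" "l \<in> {1..n}" "b \<in> B"
  shows "\<rho> b i l = fps_to_fls (coord l b i) * Xp (\<beta> i l)"
  using vge_Xp_fps[OF \<beta>(2)[OF assms]] assms by (simp add: coord_def)

text \<open>The diagonal matrix of the \<open>t^(\<beta> i l)\<close> conjugates the action for
  \<open>Jc l\<close> into the one for \<open>J0\<close>. On arrows this is the definition of
  \<delta>; sums and products inherit it.\<close>

lemma mat_intertwine:
  assumes l: "l \<in> {1..n}" and c: "c \<in> carrier CA" and i: "i \<in> {1..n}" and p: "p \<in> {1..n}"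
  shows "Xp (\<beta> i l) * fps_to_fls (mat (Jc l) c i p) = fps_to_fls (mat0 c i p) * Xp (\<beta> p l)"
  using c i p
proof (induction c arbitrary: i p rule: CA_induct)
  case (sc r)
  then show ?case by (simp add: mat_sc[OF k_set_J0] mat_sc[OF k_set_Jc[OF l]])
next
  case (xc a)
  have "fps_to_fls (fps_X ^ (if a \<in> Jc l then 0 else 1)) = Xp (\<delta> a l)"
    using \<delta>_range(3)[OF xc(1) l] xc(1) by (auto simp: Jc_def Xp_power[of 1, simplified])
  moreover have "fps_to_fls (fps_X ^ (if a \<in> J0 then 0 else 1)) = Xp (\<epsilon> a)"
    by (auto simp: \<epsilon>_def Xp_power[of 1, simplified])
  ultimately show ?case unfolding mat_gens(1)[OF k_set_J0 xc(1)] mat_gens(1)[OF k_set_Jc[OF l]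
      xc(1)]
    by (auto simp: Xp_mult \<delta>_def algebra_simps simp del: fps_to_fls_eq_iff)
next
  case (yc a)
  have "fps_to_fls (fps_X ^ (if a \<in> Jc l then 1 else 0)) = Xp (1 - \<delta> a l)"
    using \<delta>_range(3)[OF yc(1) l] yc(1) by (auto simp: Jc_def Xp_power[of 1, simplified])
  moreover have "fps_to_fls (fps_X ^ (if a \<in> J0 then 1 else 0)) = Xp (1 - \<epsilon> a)"
    by (auto simp: \<epsilon>_def Xp_power[of 1, simplified])
  ultimately show ?case unfolding mat_gens(2)[OF k_set_J0 yc(1)] mat_gens(2)[OF k_set_Jc[OF l]
      yc(1)]
    by (auto simp: Xp_mult \<delta>_def algebra_simps simp del: fps_to_fls_eq_iff)
next
  case (ec a)
  then show ?case by (auto simp: mat_gens[OF k_set_J0] mat_gens[OF k_set_Jc[OF l]])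
next
  case (add c d)
  then show ?case by (simp add: mat_add[OF k_set_J0] mat_add[OF k_set_Jc[OF l]] algebra_simps)
next
  case (mult c d)
  have "Xp (\<beta> i l) * fps_to_fls (mat (Jc l) (c \<otimes>\<^bsub>CA\<^esub> d) i p) =
      (\<Sum>q\<in>{1..n}. Xp (\<beta> i l) * fps_to_fls (mat (Jc l) c i q) * fps_to_fls (mat (Jc l) d q p))"
    using mult.hyps(1,2) by (simp add: mat_mult[OF k_set_Jc[OF l]] fps_to_fls_sum
        fls_times_fps_to_fls sum_distrib_left mult.assoc)
  also have "\<dots> = (\<Sum>q\<in>{1..n}. fps_to_fls (mat0 c i q) * fps_to_fls (mat0 d q p) * Xp (\<beta> p l))"
  proof (rule sum.cong)
    fix q assume q: "q \<in> {1..n}"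
    show "Xp (\<beta> i l) * fps_to_fls (mat (Jc l) c i q) * fps_to_fls (mat (Jc l) d q p) =
        fps_to_fls (mat0 c i q) * fps_to_fls (mat0 d q p) * Xp (\<beta> p l)"
      unfolding mult.IH(1)[OF mult.prems(1) q] using mult.IH(2)[OF q mult.prems(2)] by (simp add:
          mult.assoc)
  qed simp
  also have "\<dots> = fps_to_fls (mat0 (c \<otimes>\<^bsub>CA\<^esub> d) i p) * Xp (\<beta> p l)"
    using mult.hyps(1,2) by (simp add: mat_mult[OF k_set_J0] fps_to_fls_sum fls_times_fps_to_fls
        sum_distrib_right)
  finally show ?case .
qed

lemma rank_one_simps:
  "carrier (rank_one_module n J) = {v. \<forall>i. i \<notin> {1..n} \<longrightarrow> v i = 0}"
  "v \<oplus>\<^bsub>rank_one_module n J\<^esub> w = (\<lambda>i. v i + w i)"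
  by (simp_all add: rank_one_module_def)

lemma col_B: "l \<in> {1..n} \<Longrightarrow> x \<in> col l \<Longrightarrow> x \<in> B"
  by (simp add: col_iff)

lemma col_add: "\<lbrakk>l \<in> {1..n}; x \<in> col l; y \<in> col l\<rbrakk> \<Longrightarrow> x \<oplus> y \<in> col l"
  using B_L by (simp add: col_iff B_add \<rho>_add)

lemma col_smult:
  assumes "l \<in> {1..n}" "c \<in> carrier CA" "x \<in> col l"
  shows "\<iota> c \<otimes> x \<in> col l"
proof -
  have "\<rho> (\<iota> c \<otimes> x) i j = 0" if "j \<in> {1..n}" "j \<noteq> l" for i j
    using assms that B_L[of x] by (subst \<rho>_mult) (auto simp: col_iff intro!: sum.neutral)
  then show ?thesis using assms by (simp add: col_iff B_mult iota_B)
qed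

lemma fls_cancel_Xp: "f * Xp a = g * Xp a \<longleftrightarrow> f = g"
  by simp

text \<open>Coordinates are linear by the intertwining relation, and every vector of power series
  occurs because \<open>B\<close> is cut out by entrywise bounds.\<close>

lemma col_iso:
  assumes l: "l \<in> {1..n}"
  shows "lmod_iso CA (sub_lmod L \<iota> (col l)) (rank_one_module n (Jc l))"
proof -
  let ?J = "Jc l" and ?f = "restrict (coord l) (col l)"
  note J = k_set_Jc[OF l]
  have add: "coord l (x \<oplus> y) = (\<lambda>i. coord l x i + coord l y i)" if "x \<in> col l" "y \<in> col l" for x y
    using that col_B[OF l] B_L by (auto simp: coord_def fun_eq_iff \<rho>_add algebra_simps)
  have smult: "coord l (\<iota> c \<otimes> x) = c \<odot>\<^bsub>rank_one_module n ?J\<^esub> coord l x" if c: "c \<in> carrier CA" and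
      x: "x \<in> col l" for c x
  proof
    fix i
    have xB: "x \<in> B" using col_B[OF l x] .
    show "coord l (\<iota> c \<otimes> x) i = (c \<odot>\<^bsub>rank_one_module n ?J\<^esub> coord l x) i"
    proof (cases "i \<in> {1..n}")
      case True
      have "fps_to_fls (coord l (\<iota> c \<otimes> x) i) * Xp (\<beta> i l) = \<rho> (\<iota> c \<otimes> x) i l"
        using coord[OF True l B_mult[OF iota_B[OF c] xB]] by simp
      also have "\<dots> = (\<Sum>p\<in>{1..n}. fps_to_fls (mat0 c i p) * Xp (\<beta> p l) * fps_to_fls (coord l x p))"
        unfolding \<rho>_mult[OF loc.hom_closed[OF c] B_L[OF xB]] \<rho>_iota[OF c]
        by (rule sum.cong) (use coord[OF _ l xB] in \<open>simp_all add: mult_ac\<close>)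
      also have "\<dots> = (\<Sum>p\<in>{1..n}. Xp (\<beta> i l) * fps_to_fls (mat ?J c i p) * fps_to_fls (coord l x p))"
        by (rule sum.cong) (simp_all only: mat_intertwine[OF l c True])
      also have "\<dots> = fps_to_fls ((c \<odot>\<^bsub>rank_one_module n ?J\<^esub> coord l x) i) * Xp (\<beta> i l)"
        by (simp add: rank_one_smult_mat[OF J c] fps_to_fls_sum fls_times_fps_to_fls
            sum_distrib_left mult_ac)
      finally show ?thesis unfolding fls_cancel_Xp by simp
    next
      case False
      show ?thesis unfolding coord_def if_not_P[OF False] rank_one_smult_mat[OF J c]
        using mat_range[OF J c False] by simp
    qed
  qed
  have hom: "?f \<in> lmod_hom CA (sub_lmod L \<iota> (col l)) (rank_one_module n ?J)"
    unfolding lmod_hom_def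
    using add smult col_add[OF l] col_smult[OF l]
    by (auto simp: rank_one_simps coord_def[of l] simp del: atLeastAtMost_iff)
  have "bij_betw ?f (col l) {v. \<forall>i. i \<notin> {1..n} \<longrightarrow> v i = 0}"
  proof (rule bij_betwI')
    fix x y assume x: "x \<in> col l" and y: "y \<in> col l"
    have "x = y" if eq: "coord l x = coord l y"
    proof (rule \<rho>_inj)
      fix i j assume ij: "i \<in> {1..n}" "j \<in> {1..n}"
      show "\<rho> x i j = \<rho> y i j"
        using coord[OF ij(1) l col_B[OF l x]] coord[OF ij(1) l col_B[OF l y]] x y ij eq
        by (cases "j = l") (auto simp: col_iff[OF l])
    qed (use x y col_B[OF l] B_L in auto)
    then show "(?f x = ?f y) = (x = y)" using x y by auto
  next
    fix x assume "x \<in> col l"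
    then show "?f x \<in> {v. \<forall>i. i \<notin> {1..n} \<longrightarrow> v i = 0}" by (simp add: coord_def)
  next
    fix v assume v: "v \<in> {v :: nat \<Rightarrow> complex fps. \<forall>i. i \<notin> {1..n} \<longrightarrow> v i = 0}"
    obtain x where x: "x \<in> carrier L" "\<And>i j. \<lbrakk>i \<in> {1..n}; j \<in> {1..n}\<rbrakk> \<Longrightarrow>
        \<rho> x i j = (if j = l then Xp (\<beta> i l) * fps_to_fls (v i) else 0)"
      using \<rho>_surj[of "\<lambda>i j. if j = l then Xp (\<beta> i l) * fps_to_fls (v i) else 0"] by blast
    have "x \<in> B" unfolding mem_B_iff[OF x(1)] using x(2) by (simp add: vge_Xp_mult)
    then have xc: "x \<in> col l" unfolding col_iff[OF l] using x(2) by simp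
    have "coord l x i = v i" for i
    proof (cases "i \<in> {1..n}")
      case True
      have "Xp (- \<beta> i l) * \<rho> x i l = fps_to_fls (v i)"
        unfolding x(2)[OF True l] by (simp add: mult.assoc[symmetric] Xp_mult)
      then show ?thesis using True by (simp add: coord_def)
    next
      case False
      show ?thesis unfolding coord_def if_not_P[OF False] using v False by simp
    qed
    then have "coord l x = v" by (rule ext)
    then show "\<exists>x\<in>col l. v = ?f x" using xc by (intro bexI[of _ x]) auto
  qed
  then show ?thesis unfolding lmod_iso_def using hom by (intro bexI[of _ ?f]) (auto simp:
      rank_one_simps)
qed

text \<open>In the module of \<open>J\<close> the arrow \<open>x_i\<close> reaches a generator at
  \<open>i\<close> iff \<open>i\<close> is in \<open>J\<close>, and \<open>y_i\<close> reaches one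
  at \<open>i - 1\<close> iff it is not. An isomorphism preserves this, and in \<open>B e_l\<close>
  the same test reads off \<open>\<delta> i l\<close>.\<close>

lemma label_unique:
  assumes l: "l \<in> {1..n}" and J: "k_set J"
    and iso: "lmod_iso CA (sub_lmod L \<iota> (col l)) (rank_one_module n J)"
  shows "J = Jc l"
proof -
  obtain f where f: "f \<in> lmod_hom CA (sub_lmod L \<iota> (col l)) (rank_one_module n J)"
    and bij: "bij_betw f (col l) {v. \<forall>i. i \<notin> {1..n} \<longrightarrow> v i = 0}"
    using iso unfolding lmod_iso_def by (auto simp: rank_one_simps)
  have fs: "f (\<iota> c \<otimes> x) i = (\<Sum>p\<in>{1..n}. mat J c i p * f x p)" if "c \<in> carrier CA" "x \<in> col l" for
      c x i
    using f that rank_one_smult_mat[OF J that(1), of "f x" i] by (simp add: lmod_hom_def)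
  have unit: "\<exists>x. elem a l x \<in> col l \<and> vge (\<beta> a l) x \<and> f (elem a l x) a = 1" if a: "a \<in> {1..n}"
      for a
  proof -
    have "unit_vec a \<in> {v. \<forall>i. i \<notin> {1..n} \<longrightarrow> v i = 0}" using a by (auto simp: unit_vec_def)
    then have "unit_vec a \<in> f ` col l" unfolding bij_betw_imp_surj_on[OF bij] .
    then obtain b where b: "b \<in> col l" "f b = unit_vec a" by (rule imageE) simp
    have bB: "b \<in> B" using col_B[OF l b(1)] .
    have eq: "\<iota> (ec a) \<otimes> b = elem a l (\<rho> b a l)"
    proof (rule \<rho>_inj)
      fix i j assume "i \<in> {1..n}" "j \<in> {1..n}"
      then show "\<rho> (\<iota> (ec a) \<otimes> b) i j = \<rho> (elem a l (\<rho> b a l)) i j"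
        using a l b(1) B_L[OF bB] by (auto simp: iota_gens \<rho>_elem_mult elem col_iff[OF l])
    qed (use a l B_L[OF bB] elem in auto)
    have "f (\<iota> (ec a) \<otimes> b) a = (\<Sum>p\<in>{1..n}. if p = a then 1 else 0)"
      unfolding fs[OF gen_closed(3)[OF a] b(1)] b(2)
      by (rule sum.cong) (auto simp: mat_gens[OF J a] unit_vec_def)
    then have "f (elem a l (\<rho> b a l)) a = 1" using a by (simp add: eq)
    moreover have "vge (\<beta> a l) (\<rho> b a l)" by (rule \<beta>(2)[OF a l bB])
    ultimately show ?thesis using elem_col[OF a l] by blast
  qed
  have "i \<in> J \<longleftrightarrow> i \<in> Jc l" if i: "i \<in> {1..n}" for i
  proof -
    let ?p = "cpred n i"
    have p: "?p \<in> {1..n}" using pred_succ(1)[OF i] .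
    show ?thesis
    proof (cases "\<delta> i l = 0")
      case True
      obtain x where x: "vge (\<beta> i l) x" "f (elem i l x) i = 1" using unit[OF i] by blast
      \<comment> \<open>With \<open>\<delta> i l = 0\<close>, division by the power of
        \<open>t\<close> in \<open>x_i\<close> stays inside the column, so the preimage of the unit
        vector is \<open>x_i ?w\<close> up to its other entries.\<close>
      let ?w = "elem ?p l (Xp (- \<epsilon> i) * x)"
      have w: "?w \<in> col l"
        by (rule elem_col[OF p l]) (use x True in \<open>simp add: vge_Xp_mult \<delta>_def vge_mono\<close>)
      have "\<iota> (xc i) \<otimes> ?w = elem i l x"
        using i l p by (simp add: iota_gens elem_mult mult.assoc[symmetric] Xp_mult)
      then have "1 = (\<Sum>q\<in>{1..n}. mat J (xc i) i q * f ?w q)" using fs[OF gen_closed(1)[OF i] w, of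
          i] x by simp
      also have "\<dots> = (\<Sum>q\<in>{1..n}. if q = ?p then fps_X ^ (if i \<in> J then 0 else 1) * f ?w ?p else 0)"
        by (rule sum.cong) (auto simp: mat_gens[OF J i])
      also have "\<dots> = fps_X ^ (if i \<in> J then 0 else 1) * f ?w ?p" using p by simp
      finally have "(1 :: complex fps) = fps_X ^ (if i \<in> J then 0 else 1) * f ?w ?p" .
      \<comment> \<open>With a factor \<open>t\<close> present the constant term on the right would
        vanish.\<close>
      then have "i \<in> J" by (auto split: if_splits dest: arg_cong[where f = "\<lambda>g. fps_nth g 0"])
      then show ?thesis using True i by (simp add: Jc_def)
    next
      case False
      then have d: "\<delta> i l = 1" using \<delta>_range(3)[OF i l] by simp
      obtain x where x: "vge (\<beta> ?p l) x" "f (elem ?p l x) ?p = 1" using unit[OF p] by blast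
      let ?w = "elem i l (Xp (\<epsilon> i - 1) * x)"
      have w: "?w \<in> col l"
        by (rule elem_col[OF i l]) (use x d in \<open>simp add: vge_Xp_mult \<delta>_def vge_mono\<close>)
      have "\<iota> (yc i) \<otimes> ?w = elem ?p l x"
        using i l p by (simp add: iota_gens elem_mult mult.assoc[symmetric] Xp_mult)
      then have "1 = (\<Sum>q\<in>{1..n}. mat J (yc i) ?p q * f ?w q)" using fs[OF gen_closed(2)[OF i] w,
          of ?p] x by simp
      also have "\<dots> = (\<Sum>q\<in>{1..n}. if q = i then fps_X ^ (if i \<in> J then 1 else 0) * f ?w i else 0)"
        by (rule sum.cong) (auto simp: mat_gens[OF J i])
      also have "\<dots> = fps_X ^ (if i \<in> J then 1 else 0) * f ?w i" using i by simp
      finally have "(1 :: complex fps) = fps_X ^ (if i \<in> J then 1 else 0) * f ?w i" .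
      then have "i \<notin> J" by (auto split: if_splits dest: arg_cong[where f = "\<lambda>g. fps_nth g 0"])
      then show ?thesis using False by (simp add: Jc_def)
    qed
  qed
  then show ?thesis using J by (auto simp: k_set_def Jc_def)
qed

text \<open>Since \<open>\<beta> l l = 0\<close> the corner is exactly \<open>R e_l\<close>, so the
  normalisation in the definition of \<open>B_I\<close> holds for every order.\<close>

lemma corner:
  assumes l: "l \<in> {1..n}"
  shows "{\<iota> (ec l) \<otimes> b \<otimes> \<iota> (ec l) | b. b \<in> B} = {\<iota> (sc r) \<otimes> \<iota> (ec l) | r. True}"
proof -
  have 1: "\<iota> (ec l) \<otimes> b \<otimes> \<iota> (ec l) = elem l l (\<rho> b l l)" if "b \<in> B" for b
    by (rule e_mult_e[OF l l B_L[OF that]])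
  have 2: "\<iota> (sc r) \<otimes> \<iota> (ec l) = elem l l (fps_to_fls r)" for r
    using \<sigma>_elem[OF l l, of r 1] l by (simp add: \<sigma>_def iota_gens)
  have 3: "\<exists>r. \<rho> b l l = fps_to_fls r" if "b \<in> B" for b
    using vge_0_fps[of "\<rho> b l l"] \<beta>(2)[OF l l that] \<beta>_diag[OF l] by metis
  have 4: "\<exists>b\<in>B. \<rho> b l l = fps_to_fls r" for r
    using \<sigma>_B[of r] \<rho>_iota[OF sc_closed, of r l l] mat_sc[OF k_set_J0 l, of r l] by (auto simp:
        \<sigma>_def)
  show ?thesis
  proof (intro equalityI subsetI)
    fix x assume "x \<in> {\<iota> (ec l) \<otimes> b \<otimes> \<iota> (ec l) | b. b \<in> B}"
    then obtain b where b: "b \<in> B" "x = elem l l (\<rho> b l l)" using 1 by auto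
    then show "x \<in> {\<iota> (sc r) \<otimes> \<iota> (ec l) | r. True}" using 3[OF b(1)] 2 by auto
  next
    fix x assume "x \<in> {\<iota> (sc r) \<otimes> \<iota> (ec l) | r. True}"
    then obtain r where r: "x = elem l l (fps_to_fls r)" using 2 by auto
    obtain b where b: "b \<in> B" "\<rho> b l l = fps_to_fls r" using 4 by blast
    have "x = \<iota> (ec l) \<otimes> b \<otimes> \<iota> (ec l)" unfolding 1[OF b(1)] b(2) r ..
    then show "x \<in> {\<iota> (ec l) \<otimes> b \<otimes> \<iota> (ec l) | b. b \<in> B}" using b(1) by blast
  qed
qed

text \<open>Closure, containment of \<open>C\<close> and the corner condition hold for any order, so
  only the isomorphism types of the columns remain.\<close>

lemma necklace_module_iff:
  "is_necklace_module k n L \<iota> I B \<longleftrightarrow>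
    (\<forall>l\<in>{1..n}. lmod_iso CA (sub_lmod L \<iota> (col l)) (rank_one_module n (I (csucc n l))))"
  unfolding is_necklace_module_def Let_def col_def[symmetric]
  using U.B.additive_subgroup_axioms B_mult iota_B corner by auto

text \<open>Columns determine labels, so a witnessing necklace must be \<open>Jc\<close> shifted by
  one index; conversely the shifted \<open>Jc\<close> always has the required columns.\<close>

lemma necklace_algebra_iff: "is_necklace_algebra k n L \<iota> B \<longleftrightarrow> necklace_cond"
proof
  assume "is_necklace_algebra k n L \<iota> B"
  then obtain I where I: "grassmann_necklace k n I"
    and iso: "\<And>l. l \<in> {1..n} \<Longrightarrow> lmod_iso CA (sub_lmod L \<iota> (col l)) (rank_one_module n (I (csucc n
        l)))"
    by (auto simp: is_necklace_algebra_def necklace_module_iff)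
  have J: "I (csucc n l) = Jc l" if l: "l \<in> {1..n}" for l
    by (rule label_unique[OF l _ iso[OF l]])
      (use I pred_succ(4)[OF l] in \<open>simp add: grassmann_necklace_def k_set_def\<close>)
  show necklace_cond
    unfolding necklace_cond_def
  proof
    fix i assume i: "i \<in> {1..n}"
    have "I i - {i} \<subseteq> I (csucc n i)" using I i by (simp add: grassmann_necklace_def)
    then show "Jc (cpred n i) - {i} \<subseteq> Jc i"
      using J[OF i] J[OF pred_succ(1)[OF i]] pred_succ(2)[OF i] by simp
  qed
next
  assume N: necklace_cond
  define I where "I i = Jc (cpred n i)" for i
  have "grassmann_necklace k n I"
    unfolding grassmann_necklace_def
  proof
    fix i assume i: "i \<in> {1..n}"
    show "I i \<subseteq> {1..n} \<and> card (I i) = k \<and> I i - {i} \<subseteq> I (csucc n i)"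
      using k_set_Jc[OF pred_succ(1)[OF i]] N i pred_succ(3)[OF i]
      by (simp add: I_def k_set_def necklace_cond_def)
  qed
  moreover have "is_necklace_module k n L \<iota> I B"
    unfolding necklace_module_iff using col_iso pred_succ(3) by (simp add: I_def)
  ultimately show "is_necklace_algebra k n L \<iota> B" by (auto simp: is_necklace_algebra_def)
qed

end

theorem proposition2p19:
  fixes k n :: nat
    and L :: "('l, 'y) ring_scheme"
    and \<iota> :: "path_fun set \<Rightarrow> 'l"
    and B :: "'l set"
  assumes "0 < k" and "k < n"
    and "is_central_localization (circle_algebra k n) (scalar k n fps_X) L \<iota>"
    and "is_R_order k n L \<iota> B"
    and "\<iota> ` carrier (circle_algebra k n) \<subseteq> B"
  shows "rigid (circle_algebra k n) (sub_lmod L \<iota> B) \<longleftrightarrow> is_necklace_algebra k n L \<iota> B"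
proof -
  interpret circle_order k n L \<iota> B
    using assms by unfold_locales
  show ?thesis
    unfolding necklace_algebra_iff using necklace_imp_rigid rigid_imp_necklace by blast
qed

end
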